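(* Let $G$ be a group and $k\geq 1$ an integer. Let $T_k,T_{(k)}$ be the functors from groups to groups given by $T_k(G)=G/\gamma_{k+1}(G)$ and $T_{(k)}(G)=G/\Gamma_{k+1}(G)$, and let $\mathbf{L}_1$ denote the first non-abelian left derived functor. (i) There is an epimorphism of groups $$\ker\{\lambda_{k+1}^G\colon G^{\otimes k+1}\to G\}\to \mathbf{L}_1T_k(G).$$ (ii) There is an isomorphism of groups $$\ker\{\mu_{k+1}^G\colon G^{\wedge(k+1)}\to G\}\cong \mathbf{L}_1T_{(k)}(G).$$
   Context: Commutators are $[g,h]=ghg^{-1}h^{-1}$, conjugation is ${}^{g}g'=gg'g^{-1}$, all actions are left actions. Lower central series: $\gamma_1(G)=G$, $\gamma_{n+1}(G)=[\gamma_n(G),G]$. Derived series: $\Gamma_1(G)=G$, $\Gamma_{n+1}(G)=[\Gamma_n(G),\Gamma_n(G)]$. Tensor products. Groups $G,H$ acting on each other (and on themselves by conjugation) act compatibly if ${}^{({}^{h}g)}h'={}^{h}({}^{g}({}^{h^{-1}}h'))$ and ${}^{({}^{g}h)}g'={}^{g}({}^{h}({}^{g^{-1}}g'))$ for all $g,g'\in G$, $h,h'\in H$. Then the non-abelian tensor product $G\otimes H$ is the group generated by symbols $g\otimes h$ with relations $gg'\otimes h=({}^{g}g'\otimes{}^{g}h)(g\otimes h)$ and $g\otimes hh'=(g\otimes h)({}^{h}g\otimes{}^{h}h')$. The $n$-fold tensor products are $G^{\otimes 1}=G$, $G^{\otimes 2}=G\otimes G$ (conjugation actions), and $G^{\otimes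 n}=G^{\otimes n-1}\otimes G$ for $n\geq 3$, where $G$ acts on $G^{\otimes n-1}$ diagonally by conjugation on each tensor factor, and a generator $(\cdots(g_1\otimes g_2)\otimes\cdots\otimes g_{n-1})$ of $G^{\otimes n-1}$ acts on $G$ by conjugation by $[\cdots[g_1,g_2],\cdots,g_{n-1}]$; these actions are compatible. The homomorphism $\lambda_n^G\colon G^{\otimes n}\to G$ is given on generators by $(\cdots((g_1\otimes g_2)\otimes g_3)\otimes\cdots\otimes g_n)\mapsto[\cdots[[g_1,g_2],g_3],\cdots,g_n]$. Exterior products. The non-abelian exterior square $G\wedge G$ is the group generated by symbols $g\wedge h$ ($g,h\in G$) with relations $gg'\wedge h=({}^{g}g'\wedge{}^{g}h)(g\wedge h)$, $g\wedge hh'=(g\wedge h)({}^{h}g\wedge{}^{h}h')$, $g\wedge g=1$. The homomorphism $\mu^G\colon G\wedge G\to G$ is given by $g\wedge h\mapsto[g,h]$. Put $G^{\wedge(1)}=G$, $G^{\wedge(n+1)}=G^{\wedge(n)}\wedge G^{\wedge(n)}$, and for $n\geq 2$ let $\mu_n^G=\mu^{G^{\wedge(1)}}\circ\cdots\circ\mu^{G^{\wedge(n-1)}}\colon G^{\wedge(n)}\to G$, where $\mu^{G^{\wedge(i)}}\colon G^{\wedge(i+1)}\to G^{\wedge(i)}$. Derived functors. Let $\mathcal{P}=\mathcal{F}\mathcal{U}$ be the comonad on groups induced by the free-group functor $\mathcal{F}$ and the forgetful functor $\mathcal{U}$ to sets, with counit $\epsilon$ and comultiplication $\delta$. For a group $G$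 let $\mathcal{P}_*(G)$ be the simplicial group with $\mathcal{P}_n(G)=\mathcal{P}^{n+1}(G)$, faces $d_n^i=\mathcal{P}^i(\epsilon(\mathcal{P}^{n-i}(G)))$ and degeneracies $s_n^i=\mathcal{P}^i(\delta(\mathcal{P}^{n-i}(G)))$, $0\leq i\leq n$. For a functor $T$ from groups to groups, $\mathbf{L}_nT(G)=\pi_n(T(\mathcal{P}_*(G)))$ for $n\geq 0$, with $T$ applied dimension-wise. Equivalently, $\mathbf{L}_nT(G)=\pi_n(T(F_* ))$ for any free simplicial resolution $F_*$ of $G$, i.e. a simplicial group with all $F_n$ free, $\pi_0(F_* )=G$ and $\pi_n(F_* )=1$ for $n\geq 1$. *)

theory Defs
  imports "HOL-Algebra.Generated_Groups"
begin

section \<open>Commutators and central series\<close>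

definition conjugate :: "('a, 'b) monoid_scheme \<Rightarrow> 'a \<Rightarrow> 'a \<Rightarrow> 'a" where
  "conjugate G g x = g \<otimes>\<^bsub>G\<^esub> x \<otimes>\<^bsub>G\<^esub> inv\<^bsub>G\<^esub> g"

definition commutator :: "('a, 'b) monoid_scheme \<Rightarrow> 'a \<Rightarrow> 'a \<Rightarrow> 'a" where
  "commutator G g h = g \<otimes>\<^bsub>G\<^esub> h \<otimes>\<^bsub>G\<^esub> inv\<^bsub>G\<^esub> g \<otimes>\<^bsub>G\<^esub> inv\<^bsub>G\<^esub> h"

definition commutator_subgroup :: "('a, 'b) monoid_scheme \<Rightarrow> 'a set \<Rightarrow> 'a set \<Rightarrow> 'a set" where
  "commutator_subgroup G A B = generate G {commutator G a b | a b. a \<in> A \<and> b \<in> B}"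

text \<open>Both series are indexed from \<open>1\<close>; the value at \<open>0\<close> is irrelevant.
  The constant \<^const>\<open>derived\<close> uses the same commutator convention as \<^const>\<open>commutator\<close>.\<close>

definition lower_central :: "('a, 'b) monoid_scheme \<Rightarrow> nat \<Rightarrow> 'a set" where
  "lower_central G n = ((\<lambda>A. commutator_subgroup G A (carrier G)) ^^ (n - 1)) (carrier G)"

definition derived_series :: "('a, 'b) monoid_scheme \<Rightarrow> nat \<Rightarrow> 'a set" where
  "derived_series G n = (derived G ^^ (n - 1)) (carrier G)"

definition kernel_group ::
    "('a, 'c) monoid_scheme \<Rightarrow> ('b, 'd) monoid_scheme \<Rightarrow> ('a \<Rightarrow> 'b) \<Rightarrow> ('a, 'c) monoid_scheme" where
  "kernel_group G H h = G\<lparr>carrier := kernel G H h\<rparr>"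


section \<open>Groups given by generators and relations\<close>

text \<open>The iterated tensor powers, exterior powers and free groups over a group \<open>G\<close> must live in
  one type, independently of the number of iterations. Given the element type \<^typ>\<open>'a\<close> of \<open>G\<close>, we
  use the following type: \<open>Elem\<close> embeds the elements of \<open>G\<close>, \<open>Symb g h\<close> is a formal symbol
  (\<open>g \<otimes> h\<close> or \<open>g \<and> h\<close>), and \<open>Word w\<close> turns a word into an element
  again. In a word, \<open>(True, x)\<close> stands for the letter \<open>x\<close> and \<open>(False, x)\<close> for its
  formal inverse.\<close>

datatype 'a uni =
    Elem (elem: 'a)
  | Symb (left: "'a uni") (right: "'a uni")
  | Word (letters: "(bool \<times> 'a uni) list")

text \<open>The isomorphic copy of a group inside this type.\<close>

definition embed_group :: "('a, 'b) monoid_scheme \<Rightarrow> 'a uni monoid" where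
  "embed_group G = \<lparr>carrier = Elem ` carrier G,
              monoid.mult = (\<lambda>x y. Elem (elem x \<otimes>\<^bsub>G\<^esub> elem y)),
              one = Elem \<one>\<^bsub>G\<^esub>\<rparr>"

text \<open>Equality of words in the group with generators \<open>X\<close> and relations \<open>u = v\<close>
  for \<open>(u, v) \<in> R\<close>.\<close>

inductive word_eq ::
    "'x set \<Rightarrow> ((bool \<times> 'x) list \<times> (bool \<times> 'x) list) set
      \<Rightarrow> (bool \<times> 'x) list \<Rightarrow> (bool \<times> 'x) list \<Rightarrow> bool"
  for X R where
  refl: "word_eq X R u u"
| sym: "word_eq X R u v \<Longrightarrow> word_eq X R v u"
| trans: "word_eq X R u v \<Longrightarrow> word_eq X R v w \<Longrightarrow> word_eq X R u w"
| congr: "word_eq X R u v \<Longrightarrow> word_eq X R (p @ u @ q) (p @ v @ q)"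
| cancel: "x \<in> X \<Longrightarrow> word_eq X R [(b, x), (\<not> b, x)] []"
| relation: "(u, v) \<in> R \<Longrightarrow> word_eq X R u v"

text \<open>The elements of the presented group are equivalence classes of words. A datatype cannot
  recurse through sets, so a class is represented by a chosen member.\<close>

definition word_class ::
    "'a uni set \<Rightarrow> ((bool \<times> 'a uni) list \<times> (bool \<times> 'a uni) list) set
      \<Rightarrow> (bool \<times> 'a uni) list \<Rightarrow> 'a uni" where
  "word_class X R w = Word (SOME v. word_eq X R w v)"

definition presented_group ::
    "'a uni set \<Rightarrow> ((bool \<times> 'a uni) list \<times> (bool \<times> 'a uni) list) set \<Rightarrow> 'a uni monoid" where
  "presented_group X R =
     \<lparr>carrier = {word_class X R w | w. snd ` set w \<subseteq> X},
      monoid.mult = (\<lambda>a b. word_class X R (letters a @ letters b)),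
      one = word_class X R []\<rparr>"

text \<open>The map on a presented group determined by the images of its generators; it is a homomorphism
  to \<open>K\<close> whenever \<open>f\<close> respects the relations.\<close>

definition hom_extend :: "('b, 'c) monoid_scheme \<Rightarrow> ('a uni \<Rightarrow> 'b) \<Rightarrow> 'a uni \<Rightarrow> 'b" where
  "hom_extend K f a =
     foldr (\<lambda>(b, x) y. (if b then f x else inv\<^bsub>K\<^esub> (f x)) \<otimes>\<^bsub>K\<^esub> y) (letters a) \<one>\<^bsub>K\<^esub>"


section \<open>Non-abelian tensor products\<close>

text \<open>The action of \<open>g \<in> G\<close> on \<open>h \<in> H\<close> is \<open>actG g h\<close>,
  the action of \<open>h \<in> H\<close> on \<open>g \<in> G\<close> is \<open>actH h g\<close>.\<close>

definition tensor_gens :: "'a uni monoid \<Rightarrow> 'a uni monoid \<Rightarrow> 'a uni set" where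
  "tensor_gens G H = {Symb g h | g h. g \<in> carrier G \<and> h \<in> carrier H}"

definition tensor_rels ::
    "'a uni monoid \<Rightarrow> 'a uni monoid \<Rightarrow> ('a uni \<Rightarrow> 'a uni \<Rightarrow> 'a uni) \<Rightarrow> ('a uni \<Rightarrow> 'a uni \<Rightarrow> 'a uni)
      \<Rightarrow> ((bool \<times> 'a uni) list \<times> (bool \<times> 'a uni) list) set" where
  "tensor_rels G H actG actH =
     {([(True, Symb (g \<otimes>\<^bsub>G\<^esub> g') h)],
       [(True, Symb (conjugate G g g') (actG g h)), (True, Symb g h)])
      | g g' h. g \<in> carrier G \<and> g' \<in> carrier G \<and> h \<in> carrier H}
   \<union> {([(True, Symb g (h \<otimes>\<^bsub>H\<^esub> h'))],
       [(True, Symb g h), (True, Symb (actH h g) (conjugate H h h'))])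
      | g h h'. g \<in> carrier G \<and> h \<in> carrier H \<and> h' \<in> carrier H}"

definition tensor_class ::
    "'a uni monoid \<Rightarrow> 'a uni monoid \<Rightarrow> ('a uni \<Rightarrow> 'a uni \<Rightarrow> 'a uni) \<Rightarrow> ('a uni \<Rightarrow> 'a uni \<Rightarrow> 'a uni)
      \<Rightarrow> 'a uni \<Rightarrow> 'a uni \<Rightarrow> 'a uni" where
  "tensor_class G H actG actH g h =
     word_class (tensor_gens G H) (tensor_rels G H actG actH) [(True, Symb g h)]"

definition tensor_product ::
    "'a uni monoid \<Rightarrow> 'a uni monoid \<Rightarrow> ('a uni \<Rightarrow> 'a uni \<Rightarrow> 'a uni) \<Rightarrow> ('a uni \<Rightarrow> 'a uni \<Rightarrow> 'a uni)
      \<Rightarrow> 'a uni monoid" where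
  "tensor_product G H actG actH = presented_group (tensor_gens G H) (tensor_rels G H actG actH)"

text \<open>The homomorphism from the \<open>n\<close>-th tensor power to \<open>G\<close> (\<open>n \<ge> 1\<close>), sending
  \<open>x \<otimes> g\<close> to the commutator of the image of \<open>x\<close> with \<open>g\<close>, hence
  \<open>(\<dots>(g\<^sub>1 \<otimes> g\<^sub>2) \<otimes> \<dots>) \<otimes> g\<^sub>n\<close> to the iterated commutator.\<close>

fun tensor_lambda :: "'a uni monoid \<Rightarrow> nat \<Rightarrow> 'a uni \<Rightarrow> 'a uni" where
  "tensor_lambda G (Suc 0) = (\<lambda>x. x)"
| "tensor_lambda G (Suc (Suc n)) =
     hom_extend G (\<lambda>s. commutator G (tensor_lambda G (Suc n) (left s)) (right s))"

text \<open>The \<open>n\<close>-th tensor power (\<open>n \<ge> 1\<close>), and the diagonal action of \<open>G\<close> on it by conjugation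
  on each tensor factor. An element of the \<open>n\<close>-th tensor power acts on \<open>G\<close> by conjugation by its
  image under \<^const>\<open>tensor_lambda\<close>; on a generator this is conjugation by the iterated commutator.
  For \<open>n = 1\<close> both actions are conjugation in \<open>G\<close>, so that the second tensor power is the usual
  tensor square.\<close>

function (sequential)
      tensor_power :: "'a uni monoid \<Rightarrow> nat \<Rightarrow> 'a uni monoid"
  and diag_act :: "'a uni monoid \<Rightarrow> nat \<Rightarrow> 'a uni \<Rightarrow> 'a uni \<Rightarrow> 'a uni" where
  "tensor_power G (Suc 0) = G"
| "tensor_power G (Suc (Suc n)) =
     tensor_product (tensor_power G (Suc n)) G
       (\<lambda>x g. conjugate G (tensor_lambda G (Suc n) x) g) (diag_act G (Suc n))"
| "diag_act G (Suc 0) = conjugate G"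
| "diag_act G (Suc (Suc n)) =
     (\<lambda>g. hom_extend (tensor_power G (Suc (Suc n)))
       (\<lambda>s. tensor_class (tensor_power G (Suc n)) G
              (\<lambda>x g. conjugate G (tensor_lambda G (Suc n) x) g) (diag_act G (Suc n))
              (diag_act G (Suc n) g (left s)) (conjugate G g (right s))))"
  by pat_completeness auto
termination
  by (relation "measure (\<lambda>x. case x of Inl (G, n) \<Rightarrow> 2 * n | Inr (G, n) \<Rightarrow> 2 * n + 1)") auto


section \<open>Non-abelian exterior squares\<close>

definition exterior_rels ::
    "'a uni monoid \<Rightarrow> ((bool \<times> 'a uni) list \<times> (bool \<times> 'a uni) list) set" where
  "exterior_rels G = tensor_rels G G (conjugate G) (conjugate G)
     \<union> {([(True, Symb g g)], []) | g. g \<in> carrier G}"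

definition exterior_square :: "'a uni monoid \<Rightarrow> 'a uni monoid" where
  "exterior_square G = presented_group (tensor_gens G G) (exterior_rels G)"

definition exterior_mu :: "'a uni monoid \<Rightarrow> 'a uni \<Rightarrow> 'a uni" where
  "exterior_mu G = hom_extend G (\<lambda>s. commutator G (left s) (right s))"

text \<open>Both are indexed by \<open>n \<ge> 1\<close>. The map is the composite of the maps
  \<^const>\<open>exterior_mu\<close> of the iterated squares \<open>1, \<dots>, n - 1\<close>; for \<open>n = 1\<close> it is the identity.\<close>

fun exterior_power :: "'a uni monoid \<Rightarrow> nat \<Rightarrow> 'a uni monoid" where
  "exterior_power G (Suc 0) = G"
| "exterior_power G (Suc (Suc n)) = exterior_square (exterior_power G (Suc n))"

fun exterior_mu_iter :: "'a uni monoid \<Rightarrow> nat \<Rightarrow> 'a uni \<Rightarrow> 'a uni" where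
  "exterior_mu_iter G (Suc 0) = id"
| "exterior_mu_iter G (Suc (Suc n)) =
     exterior_mu_iter G (Suc n) \<circ> exterior_mu (exterior_power G (Suc n))"


section \<open>The free group comonad\<close>

definition free_group :: "'a uni monoid \<Rightarrow> 'a uni monoid" where
  "free_group G = presented_group (carrier G) {}"

definition free_gen :: "'a uni monoid \<Rightarrow> 'a uni \<Rightarrow> 'a uni" where
  "free_gen G x = word_class (carrier G) {} [(True, x)]"

text \<open>The map between free groups induced by a map \<open>f\<close> into the carrier of \<open>H\<close>.\<close>

definition free_map :: "'a uni monoid \<Rightarrow> ('a uni \<Rightarrow> 'a uni) \<Rightarrow> 'a uni \<Rightarrow> 'a uni" where
  "free_map H f = hom_extend (free_group H) (\<lambda>x. free_gen H (f x))"

definition counit :: "'a uni monoid \<Rightarrow> 'a uni \<Rightarrow> 'a uni" where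
  "counit G = hom_extend G (\<lambda>x. x)"

definition comult :: "'a uni monoid \<Rightarrow> 'a uni \<Rightarrow> 'a uni" where
  "comult G = hom_extend (free_group (free_group G)) (\<lambda>x. free_gen (free_group G) (free_gen G x))"

text \<open>The \<open>i\<close>-th iterate of the functor on a map with codomain \<open>H\<close>.\<close>

fun free_map_iter :: "nat \<Rightarrow> 'a uni monoid \<Rightarrow> ('a uni \<Rightarrow> 'a uni) \<Rightarrow> 'a uni \<Rightarrow> 'a uni" where
  "free_map_iter 0 H f = f"
| "free_map_iter (Suc i) H f = free_map ((free_group ^^ i) H) (free_map_iter i H f)"


section \<open>Simplicial groups and derived functors\<close>

text \<open>\<open>face X n i\<close> goes from dimension \<open>n\<close> to \<open>n - 1\<close> (\<open>n \<ge> 1\<close>), \<open>degen X n i\<close> from dimension \<open>n\<close>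
  to \<open>n + 1\<close>, for \<open>i \<le> n\<close>.\<close>

record 'a simplicial_group =
  component :: "nat \<Rightarrow> 'a monoid"
  face :: "nat \<Rightarrow> nat \<Rightarrow> 'a \<Rightarrow> 'a"
  degen :: "nat \<Rightarrow> nat \<Rightarrow> 'a \<Rightarrow> 'a"

definition moore_carrier :: "'a simplicial_group \<Rightarrow> nat \<Rightarrow> 'a set" where
  "moore_carrier X n =
     {x \<in> carrier (component X n). \<forall>i<n. face X n i x = \<one>\<^bsub>component X (n - 1)\<^esub>}"

definition moore_cycles :: "'a simplicial_group \<Rightarrow> nat \<Rightarrow> 'a set" where
  "moore_cycles X n =
     {x \<in> moore_carrier X n. n \<noteq> 0 \<longrightarrow> face X n n x = \<one>\<^bsub>component X (n - 1)\<^esub>}"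

definition moore_boundaries :: "'a simplicial_group \<Rightarrow> nat \<Rightarrow> 'a set" where
  "moore_boundaries X n = face X (n + 1) (n + 1) ` moore_carrier X (n + 1)"

text \<open>Homotopy groups of a simplicial group, computed as homology of its Moore complex.\<close>

definition homotopy_group :: "nat \<Rightarrow> 'a simplicial_group \<Rightarrow> 'a set monoid" where
  "homotopy_group n X = (component X n)\<lparr>carrier := moore_cycles X n\<rparr> Mod moore_boundaries X n"

definition free_resolution :: "'a uni monoid \<Rightarrow> 'a uni simplicial_group" where
  "free_resolution G =
     \<lparr>component = (\<lambda>n. (free_group ^^ (n + 1)) G),
      face = (\<lambda>n i. free_map_iter i ((free_group ^^ (n - i)) G) (counit ((free_group ^^ (n - i)) G))),
      degen = (\<lambda>n i. free_map_iter i ((free_group ^^ (n - i + 2)) G)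
                       (comult ((free_group ^^ (n - i)) G)))\<rparr>"

text \<open>Data of a functor from groups to groups: its value on a group, and on a homomorphism with
  given domain and codomain.\<close>

record ('a, 'b) group_functor =
  on_obj :: "'a monoid \<Rightarrow> 'b monoid"
  on_mor :: "'a monoid \<Rightarrow> 'a monoid \<Rightarrow> ('a \<Rightarrow> 'a) \<Rightarrow> 'b \<Rightarrow> 'b"

definition apply_functor ::
    "('a, 'b) group_functor \<Rightarrow> 'a simplicial_group \<Rightarrow> 'b simplicial_group" where
  "apply_functor T X =
     \<lparr>component = (\<lambda>n. on_obj T (component X n)),
      face = (\<lambda>n i. on_mor T (component X n) (component X (n - 1)) (face X n i)),
      degen = (\<lambda>n i. on_mor T (component X n) (component X (n + 1)) (degen X n i))\<rparr>"

definition left_derived ::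
    "nat \<Rightarrow> ('a uni, 'b) group_functor \<Rightarrow> 'a uni monoid \<Rightarrow> 'b set monoid" where
  "left_derived n T G = homotopy_group n (apply_functor T (free_resolution G))"

text \<open>The quotient by a functorial normal subgroup \<open>S\<close>: a homomorphism \<open>f\<close> induces
  \<open>S(G) x \<mapsto> S(H) f(x)\<close>, which is the product of the set \<open>S(H)\<close> with the image of the coset.\<close>

definition quotient_functor :: "('a monoid \<Rightarrow> 'a set) \<Rightarrow> ('a, 'a set) group_functor" where
  "quotient_functor S =
     \<lparr>on_obj = (\<lambda>G. G Mod S G),
      on_mor = (\<lambda>G H f C. S H <#>\<^bsub>H\<^esub> (f ` C))\<rparr>"

definition nilpotent_quotient :: "nat \<Rightarrow> ('a, 'a set) group_functor" where
  "nilpotent_quotient k = quotient_functor (\<lambda>G. lower_central G (k + 1))"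

definition solvable_quotient :: "nat \<Rightarrow> ('a, 'a set) group_functor" where
  "solvable_quotient k = quotient_functor (\<lambda>G. derived_series G (k + 1))"

end

(*
  Write F for the simplicial group P(G), R = ker (F_0 -> G), and let S be gamma_{k+1} or Gamma_{k+1}.
  The simplicial set underlying F is contractible, so a diagram chase on S(F) -> F -> F/S(F) gives
  L_1(K |-> K/S(K))(G) = (R cap S(F_0)) / B with B = d_1(S(F_1) cap ker d_0).

  (i) Sending an iterated tensor to the iterated commutator of lifts of its entries to F_0 defines a
  homomorphism from the tensor power onto gamma_{k+1}(F_0)/B.

  (ii) By induction the exterior power is Gamma_{k+1}(F_0)/B: if Q = M/N with M free, then the
  exterior square of Q is [M,M]/[N,M], because mu : M /\ M -> M is injective for M free. The latter is
  shown by collecting words into normal form: a free group S acts on pairs of an element of S /\ S and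
  an exponent vector in such a way that mu(c) acts as left multiplication by c. The groups
  Gamma_j(F_0) are only subgroups of a free group, but these are retracts of free groups, which is
  all that is needed.
*)

theory Submission
  imports Defs "HOL-Algebra.Bij" "HOL-Algebra.Group_Action"
begin

section \<open>Commutators and homomorphisms\<close>

text \<open>Degrees 0 to 2 of the resolution determine the first homotopy group, so
  \<open>truncated_resolution\<close> records just these. The quotient of the overview is handled
  through a subgroup \<open>W\<close> of \<open>F1\<close> that maps onto the derived functor with
  known kernel; the kernels of \<lambda> and \<mu> are compared with \<open>W\<close>. The delicate
  object is \<open>B\<close>: its elements come from products of commutators whose factors need not
  be killed by \<open>d0\<close> one by one. That commutators lie in \<open>B\<close> is shown by
  explicit ones in \<open>F1\<close>, with one entry in ker \<open>d0\<close> and the other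
  degenerate; this suffices for (i). That a map p kills \<open>B\<close> cannot be tested on
  factors, but the equaliser condition p d0 = p d1 can, and it implies the former; (ii) combines
  both facts. Freeness enters (ii) through the injectivity of \<mu>, a property that passes to
  retracts; a section of the counit makes a subgroup M of a free group a retract of the free group
  on the set M. In the collection, the exponents are bookkeeping that tells each generator what it
  has to pass, and the conclusion is read off from the other coordinate.\<close>

context group
begin

lemma inv_cancel_left [simp]:
  assumes "x \<in> carrier G" "y \<in> carrier G"
  shows "x \<otimes> (inv x \<otimes> y) = y" "inv x \<otimes> (x \<otimes> y) = y"
  using assms by (simp_all flip: m_assoc)

lemmas word_simps = m_assoc inv_mult_group conjugate_def commutator_def

lemma conjugate_closed [simp, intro]:
  "g \<in> carrier G \<Longrightarrow> x \<in> carrier G \<Longrightarrow> conjugate G g x \<in> carrier G"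
  by (simp add: conjugate_def)

lemma commutator_closed [simp, intro]:
  "g \<in> carrier G \<Longrightarrow> x \<in> carrier G \<Longrightarrow> commutator G g x \<in> carrier G"
  by (simp add: commutator_def)

lemma conjugate_conjugate:
  assumes "g \<in> carrier G" "h \<in> carrier G" "x \<in> carrier G"
  shows "conjugate G g (conjugate G h x) = conjugate G (g \<otimes> h) x"
  using assms by (simp add: word_simps)

lemma conjugate_one [simp]: "x \<in> carrier G \<Longrightarrow> conjugate G \<one> x = x"
  by (simp add: conjugate_def)

lemma conjugate_mult:
  assumes "g \<in> carrier G" "x \<in> carrier G" "y \<in> carrier G"
  shows "conjugate G g (x \<otimes> y) = conjugate G g x \<otimes> conjugate G g y"
  using assms by (simp add: word_simps)

lemma conjugate_commutator:
  assumes "g \<in> carrier G" "x \<in> carrier G" "y \<in> carrier G"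
  shows "conjugate G g (commutator G x y) = commutator G (conjugate G g x) (conjugate G g y)"
  using assms by (simp add: word_simps)

lemma commutator_mult_left:
  assumes "g \<in> carrier G" "g' \<in> carrier G" "h \<in> carrier G"
  shows "commutator G (g \<otimes> g') h
    = commutator G (conjugate G g g') (conjugate G g h) \<otimes> commutator G g h"
  using assms by (simp add: word_simps)

lemma commutator_mult_right:
  assumes "g \<in> carrier G" "h \<in> carrier G" "h' \<in> carrier G"
  shows "commutator G g (h \<otimes> h')
    = commutator G g h \<otimes> commutator G (conjugate G h g) (conjugate G h h')"
  using assms by (simp add: word_simps)

end

lemma (in group_hom) hom_conjugate:
  "g \<in> carrier G \<Longrightarrow> x \<in> carrier G \<Longrightarrow> h (conjugate G g x) = conjugate H (h g) (h x)"
  by (simp add: conjugate_def)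

lemma (in group_hom) hom_commutator:
  "g \<in> carrier G \<Longrightarrow> x \<in> carrier G \<Longrightarrow> h (commutator G g x) = commutator H (h g) (h x)"
  by (simp add: commutator_def)

lemma hom_eq_on_generate:
  assumes "group_hom G H f" "group_hom G H g" "A \<subseteq> carrier G"
    and "\<And>a. a \<in> A \<Longrightarrow> f a = g a" and "x \<in> generate G A"
  shows "f x = g x"
proof -
  interpret f: group_hom G H f by fact
  interpret g: group_hom G H g by fact
  have "x \<in> carrier G \<and> f x = g x"
    using assms(5)
    by induct (use assms(3,4) in \<open>auto simp: subset_iff\<close>)
  then show ?thesis by simp
qed

lemma group_homI:
  "group G \<Longrightarrow> group H \<Longrightarrow> h \<in> hom G H \<Longrightarrow> group_hom G H h"
  by (simp add: group_hom.intro group_hom_axioms.intro)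

lemma (in group_hom) hom_comp:
  assumes "group_hom H K f"
  shows "group_hom G K (\<lambda>x. f (h x))"
proof -
  interpret f: group_hom H K f by fact
  show ?thesis
    by (intro group_homI homI) auto
qed


section \<open>Presented groups\<close>

definition over :: "'x set \<Rightarrow> (bool \<times> 'x) list \<Rightarrow> bool" where
  "over X w \<longleftrightarrow> snd ` set w \<subseteq> X"

lemma over_simps [simp]:
  "over X []" "over X (a # w) \<longleftrightarrow> snd a \<in> X \<and> over X w"
  "over X (u @ v) \<longleftrightarrow> over X u \<and> over X v"
  by (auto simp: over_def)

definition word_inv :: "(bool \<times> 'x) list \<Rightarrow> (bool \<times> 'x) list" where
  "word_inv w = rev (map (\<lambda>(b, x). (\<not> b, x)) w)"

lemma word_inv_simps [simp]:
  "word_inv [] = []" "word_inv ((b, x) # w) = word_inv w @ [(\<not> b, x)]"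
  "word_inv (u @ w) = word_inv w @ word_inv u" "word_inv (word_inv w) = w"
  by (auto simp: word_inv_def rev_map o_def case_prod_unfold)

lemma over_word_inv [simp]: "over X (word_inv w) \<longleftrightarrow> over X w"
  by (induction w) auto

lemma word_eq_append:
  assumes "word_eq X R u u'" "word_eq X R v v'"
  shows "word_eq X R (u @ v) (u' @ v')"
proof -
  have "word_eq X R (u @ v) (u' @ v)" using word_eq.congr[OF assms(1), of "[]" v] by simp
  moreover have "word_eq X R (u' @ v) (u' @ v')"
    using word_eq.congr[OF assms(2), of u' "[]"] by simp
  ultimately show ?thesis by (rule word_eq.trans)
qed

lemma word_eq_inv_left: "over X w \<Longrightarrow> word_eq X R (word_inv w @ w) []"
proof (induction w)
  case Nil
  then show ?case by (simp add: word_eq.refl)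
next
  case (Cons a w)
  obtain b x where a: "a = (b, x)" by force
  have "word_eq X R [(\<not> b, x), (b, x)] []"
    using word_eq.cancel[of x X R "\<not> b"] Cons.prems a by simp
  from word_eq.congr[OF this, of "word_inv w" w]
  have "word_eq X R (word_inv (a # w) @ a # w) (word_inv w @ w)" by (simp add: a)
  moreover have "word_eq X R (word_inv w @ w) []" using Cons by simp
  ultimately show ?case by (rule word_eq.trans)
qed

definition word_value :: "('b, 'c) monoid_scheme \<Rightarrow> ('x \<Rightarrow> 'b) \<Rightarrow> (bool \<times> 'x) list \<Rightarrow> 'b" where
  "word_value K f w = foldr (\<lambda>(b, x) y. (if b then f x else inv\<^bsub>K\<^esub> (f x)) \<otimes>\<^bsub>K\<^esub> y) w \<one>\<^bsub>K\<^esub>"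

lemma hom_extend_word_value: "hom_extend K f a = word_value K f (letters a)"
  by (simp add: hom_extend_def word_value_def)

lemma word_value_simps [simp]:
  "word_value K f [] = \<one>\<^bsub>K\<^esub>"
  "word_value K f ((b, x) # w) = (if b then f x else inv\<^bsub>K\<^esub> (f x)) \<otimes>\<^bsub>K\<^esub> word_value K f w"
  by (simp_all add: word_value_def)

lemma (in group) word_value_closed [simp]:
  "f \<in> X \<rightarrow> carrier G \<Longrightarrow> over X w \<Longrightarrow> word_value G f w \<in> carrier G"
  by (induction w) (auto simp: Pi_iff)

lemma (in group) word_value_append:
  "f \<in> X \<rightarrow> carrier G \<Longrightarrow> over X u \<Longrightarrow> over X v \<Longrightarrow>
    word_value G f (u @ v) = word_value G f u \<otimes> word_value G f v"
proof (induction u)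
  case (Cons a u)
  then show ?case
    by (cases a) (auto simp: m_assoc Pi_iff intro!: m_assoc[symmetric])
qed simp

text \<open>Relators over \<open>X\<close> make \<open>word_eq\<close> preserve words over
  \<open>X\<close>. Hence the representative chosen for such a word is again over \<open>X\<close>,
  and folding over its letters stays inside the target group.\<close>

locale presentation =
  fixes X :: "'a uni set" and R :: "((bool \<times> 'a uni) list \<times> (bool \<times> 'a uni) list) set"
  assumes rels_over: "(u, v) \<in> R \<Longrightarrow> over X u \<and> over X v"
begin

abbreviation P where "P \<equiv> presented_group X R"
abbreviation cls where "cls \<equiv> word_class X R"
abbreviation gen where "gen x \<equiv> cls [(True, x)]"

lemma word_eq_over: "word_eq X R u v \<Longrightarrow> over X u \<longleftrightarrow> over X v"
  by (induction rule: word_eq.induct) (use rels_over in auto)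

lemma word_class_letters: "word_eq X R w (letters (cls w))"
  using someI[of "word_eq X R w", OF word_eq.refl] by (simp add: word_class_def)

text \<open>By symmetry and transitivity the two predicates are equal as functions, so Hilbert
  choice returns the same representative.\<close>

lemma word_class_eqI:
  assumes "word_eq X R u v" shows "cls u = cls v"
proof -
  have "word_eq X R u = word_eq X R v"
    using assms by (auto simp: fun_eq_iff intro: word_eq.trans word_eq.sym)
  then show ?thesis by (simp add: word_class_def)
qed

lemma mult_class: "cls u \<otimes>\<^bsub>P\<^esub> cls v = cls (u @ v)"
proof -
  have "word_eq X R (u @ v) (letters (cls u) @ letters (cls v))"
    by (intro word_eq_append word_class_letters)
  then show ?thesis by (simp add: presented_group_def word_class_eqI)
qed

lemma one_class: "\<one>\<^bsub>P\<^esub> = cls []"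
  by (simp add: presented_group_def)

lemma in_carrier_iff: "a \<in> carrier P \<longleftrightarrow> (\<exists>w. over X w \<and> a = cls w)"
  by (auto simp: presented_group_def over_def)

lemma class_closed [simp]: "over X w \<Longrightarrow> cls w \<in> carrier P"
  by (auto simp: in_carrier_iff)

lemma group_P: "group P"
proof (rule groupI)
  fix x assume "x \<in> carrier P"
  then obtain w where "over X w" "x = cls w" by (auto simp: in_carrier_iff)
  then show "\<exists>y\<in>carrier P. y \<otimes>\<^bsub>P\<^esub> x = \<one>\<^bsub>P\<^esub>"
    by (intro bexI[of _ "cls (word_inv w)"])
       (auto simp: mult_class one_class intro: word_class_eqI word_eq_inv_left)
next
  show "x \<otimes>\<^bsub>P\<^esub> y \<in> carrier P" if "x \<in> carrier P" "y \<in> carrier P" for x y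
    using that by (metis in_carrier_iff mult_class over_simps(3))
  show "\<one>\<^bsub>P\<^esub> \<in> carrier P"
    by (simp add: one_class)
qed (auto simp: in_carrier_iff mult_class one_class)

sublocale P: group P by (rule group_P)

lemma inv_class: "over X w \<Longrightarrow> inv\<^bsub>P\<^esub> (cls w) = cls (word_inv w)"
  by (rule P.inv_equality)
     (auto simp: mult_class one_class intro: word_class_eqI word_eq_inv_left)

lemma gen_closed [simp]: "x \<in> X \<Longrightarrow> gen x \<in> carrier P"
  by simp

lemma class_in_generate: "over X w \<Longrightarrow> cls w \<in> generate P (gen ` (snd ` set w))"
proof (induction w)
  case Nil
  then show ?case by (simp flip: one_class add: generate.one)
next
  case (Cons a w)
  obtain b x where a: "a = (b, x)" by force
  let ?A = "gen ` (snd ` set (a # w))"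
  have x: "x \<in> X" and w: "cls w \<in> generate P ?A"
    using Cons a P.mono_generate[of "gen ` (snd ` set w)" ?A] by auto
  have "(if b then gen x else inv\<^bsub>P\<^esub> gen x) \<in> generate P ?A"
    by (auto simp: a intro: generate.incl generate.inv)
  moreover have "cls (a # w) = (if b then gen x else inv\<^bsub>P\<^esub> gen x) \<otimes>\<^bsub>P\<^esub> cls w"
    using x by (auto simp: inv_class mult_class a)
  ultimately show ?case using w by (simp add: generate.eng)
qed

lemma carrier_generate: "carrier P = generate P (gen ` X)"
proof
  show "carrier P \<subseteq> generate P (gen ` X)"
  proof
    fix a assume "a \<in> carrier P"
    then obtain w where w: "over X w" "a = cls w" by (auto simp: in_carrier_iff)
    have "gen ` (snd ` set w) \<subseteq> gen ` X" using w by (auto simp: over_def)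
    from P.mono_generate[OF this] show "a \<in> generate P (gen ` X)"
      using class_in_generate[OF w(1)] w(2) by blast
  qed
  show "generate P (gen ` X) \<subseteq> carrier P"
    by (rule P.generate_incl) auto
qed

lemma hom_eqI:
  assumes "group_hom P K f" "group_hom P K g" "\<And>x. x \<in> X \<Longrightarrow> f (gen x) = g (gen x)"
    and "a \<in> carrier P"
  shows "f a = g a"
  by (rule hom_eq_on_generate[OF assms(1,2), of "gen ` X"])
     (use assms carrier_generate in auto)

text \<open>Induction on the derivation. Being over \<open>X\<close> is carried along, because the
  context words of \<open>congr\<close> must have values in \<open>K\<close> before the value of a
  concatenation can be split.\<close>

lemma word_value_eq:
  assumes K: "group K" and f: "f \<in> X \<rightarrow> carrier K"
    and R: "\<And>u v. (u, v) \<in> R \<Longrightarrow> word_value K f u = word_value K f v"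
    and "word_eq X R u v" "over X u"
  shows "word_value K f u = word_value K f v"
proof -
  interpret K: group K by fact
  show ?thesis using assms(4,5)
  proof (induction rule: word_eq.induct)
    case (sym u v)
    then show ?case using word_eq_over by simp
  next
    case (trans u v w)
    then show ?case using word_eq_over by simp
  next
    case (congr u v p q)
    moreover have "over X v" using congr word_eq_over[of u v] by simp
    ultimately show ?case by (simp add: K.word_value_append[OF f])
  next
    case (cancel x b)
    then have "f x \<in> carrier K" using f by auto
    then show ?case by (cases b) auto
  qed (use R in auto)
qed

lemma
  assumes K: "group K" and f: "f \<in> X \<rightarrow> carrier K"
    and R: "\<And>u v. (u, v) \<in> R \<Longrightarrow> word_value K f u = word_value K f v"
  shows hom_extend_class: "over X w \<Longrightarrow> hom_extend K f (cls w) = word_value K f w"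
    and hom_extend_gen: "x \<in> X \<Longrightarrow> hom_extend K f (gen x) = f x"
    and hom_extend_hom: "group_hom P K (hom_extend K f)"
proof -
  interpret K: group K by fact
  show cl: "hom_extend K f (cls w) = word_value K f w" if "over X w" for w
    using word_value_eq[OF K f R word_class_letters that]
    by (simp add: hom_extend_word_value)
  show "hom_extend K f (gen x) = f x" if "x \<in> X"
  proof -
    have "f x \<in> carrier K" using f that by auto
    then show ?thesis using cl[of "[(True, x)]"] that by simp
  qed
  show "group_hom P K (hom_extend K f)"
  proof (rule group_homI[OF group_P K homI])
    fix a assume "a \<in> carrier P"
    then obtain u where u: "over X u" "a = cls u" by (auto simp: in_carrier_iff)
    show "hom_extend K f a \<in> carrier K"
      using u by (simp add: cl K.word_value_closed[OF f])
    fix b assume "b \<in> carrier P"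
    then obtain v where v: "over X v" "b = cls v" by (auto simp: in_carrier_iff)
    show "hom_extend K f (a \<otimes>\<^bsub>P\<^esub> b) = hom_extend K f a \<otimes>\<^bsub>K\<^esub> hom_extend K f b"
      using u v cl[of "u @ v"] by (simp add: mult_class cl K.word_value_append[OF f])
  qed
qed

text \<open>Even if \<open>f\<close> violates the relations, \<^const>\<open>hom_extend\<close> is the value of \<open>f\<close> on some word.\<close>

lemma hom_extend_closed:
  assumes "group K" "f \<in> X \<rightarrow> carrier K" "a \<in> carrier P"
  shows "hom_extend K f a \<in> carrier K"
proof -
  obtain w where "over X w" "a = cls w" using assms(3) by (auto simp: in_carrier_iff)
  then have "over X (letters a)" using word_class_letters word_eq_over by blast
  then show ?thesis using assms(1,2) by (simp add: hom_extend_word_value group.word_value_closed)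
qed

lemma class_of_letters:
  assumes "a \<in> carrier P" shows "over X (letters a)" "cls (letters a) = a"
proof -
  obtain w where w: "over X w" "a = cls w" using assms by (auto simp: in_carrier_iff)
  then show "over X (letters a)" using word_class_letters word_eq_over by blast
  show "cls (letters a) = a"
    using w word_class_eqI[OF word_class_letters[of w]] by simp
qed

end

section \<open>The first derived functor of a quotient functor\<close>

locale functorial_normal =
  fixes S :: "'a monoid \<Rightarrow> 'a set"
  assumes normal: "group K \<Longrightarrow> S K \<lhd> K"
    and functorial: "group_hom K L f \<Longrightarrow> f ` S K \<subseteq> S L"
begin

lemma hom_mem: "group_hom K L f \<Longrightarrow> x \<in> S K \<Longrightarrow> f x \<in> S L"
  using functorial by blast

end

text \<open>Multiplying by \<open>B\<close> absorbs the image of \<open>A\<close>, so the morphism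
  part of \<open>quotient_functor\<close> acts on a coset through any one representative.\<close>

lemma (in group_hom) coset_image:
  assumes "A \<lhd> G" "B \<lhd> H" "h ` A \<subseteq> B" "x \<in> carrier G"
  shows "B <#>\<^bsub>H\<^esub> (h ` (A #>\<^bsub>G\<^esub> x)) = B #>\<^bsub>H\<^esub> h x"
proof -
  interpret A: normal A G by fact
  interpret B: normal B H by fact
  show ?thesis
  proof (intro equalityI subsetI)
    fix y assume "y \<in> B <#>\<^bsub>H\<^esub> (h ` (A #>\<^bsub>G\<^esub> x))"
    then obtain b a where ab: "b \<in> B" "a \<in> A" "y = b \<otimes>\<^bsub>H\<^esub> h (a \<otimes>\<^bsub>G\<^esub> x)"
      by (auto simp: set_mult_def r_coset_def)
    moreover have "a \<in> carrier G" "b \<in> carrier H" "h a \<in> B"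
      using ab assms(3) by auto
    ultimately have "y = (b \<otimes>\<^bsub>H\<^esub> h a) \<otimes>\<^bsub>H\<^esub> h x" "b \<otimes>\<^bsub>H\<^esub> h a \<in> B"
      using assms(4) by (simp_all add: H.m_assoc)
    then show "y \<in> B #>\<^bsub>H\<^esub> h x" by (auto simp: r_coset_def)
  next
    fix y assume "y \<in> B #>\<^bsub>H\<^esub> h x"
    then obtain b where "b \<in> B" "y = b \<otimes>\<^bsub>H\<^esub> h x"
      by (auto simp: r_coset_def)
    moreover have "h x \<in> h ` (A #>\<^bsub>G\<^esub> x)"
      using G.rcos_self[OF assms(4) A.subgroup_axioms] by simp
    ultimately show "y \<in> B <#>\<^bsub>H\<^esub> (h ` (A #>\<^bsub>G\<^esub> x))"
      unfolding set_mult_def by blast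
  qed
qed

lemma (in normal) coset_eq_iff:
  assumes "x \<in> carrier G" "y \<in> carrier G"
  shows "H #> x = H #> y \<longleftrightarrow> x \<otimes> inv y \<in> H"
proof
  assume "H #> x = H #> y"
  then have "x \<in> H #> y" using rcos_self[OF assms(1) subgroup_axioms] by simp
  then show "x \<otimes> inv y \<in> H" using rcos_module_imp[OF group_axioms assms(2)] by simp
next
  assume h: "x \<otimes> inv y \<in> H"
  have "x = (x \<otimes> inv y) \<otimes> y" using assms by (simp add: m_assoc)
  then have "x \<in> H #> y" using h unfolding r_coset_def by blast
  then show "H #> x = H #> y" using repr_independence[OF _ assms(2) subgroup_axioms] by simp
qed

lemma (in normal) coset_eq_self_iff:
  assumes "x \<in> carrier G" shows "H #> x = H \<longleftrightarrow> x \<in> H"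
  using coset_join1[of H x] coset_join2[of x H] assms subgroup_axioms by blast

lemma (in normal) quotient_hom: "group_hom G (G Mod H) (\<lambda>x. H #> x)"
  by (intro group_homI is_group factorgroup_is_group r_coset_hom_Mod)

text \<open>This is the composite of \<open>W\<close> onto \<open>q\<close>
  W\<open>and the projection modulo\<close>q \<open>V\<close>. Giving the kernel as a condition on
  \<open>W\<close> lets a homotopy group of a quotient be studied upstairs, before passing to
  cosets.\<close>

lemma subquotient_epi:
  assumes q: "group_hom K Q q" and surj: "q ` carrier K = carrier Q"
    and W: "subgroup W K" and V: "V \<lhd> K" "V \<subseteq> W"
  defines "L \<equiv> Q\<lparr>carrier := q ` W\<rparr> Mod q ` V"
  obtains \<zeta> where "group_hom (K\<lparr>carrier := W\<rparr>) L \<zeta>" "\<zeta> ` W = carrier L"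
    "\<And>x. x \<in> W \<Longrightarrow> \<zeta> x = \<one>\<^bsub>L\<^esub> \<longleftrightarrow> q x \<in> q ` V"
proof -
  interpret q: group_hom K Q q by fact
  interpret W: subgroup W K by fact
  interpret V: normal V K by fact
  have "q ` V \<lhd> Q" using V.surj_hom_normal_subgroup[OF q surj] .
  moreover have qW: "subgroup (q ` W) Q" by (rule q.subgroup_img_is_subgroup[OF W])
  ultimately have n: "q ` V \<lhd> Q\<lparr>carrier := q ` W\<rparr>"
    using V(2) by (intro q.H.normal_restrict_supergroup) auto
  interpret N: normal "q ` V" "Q\<lparr>carrier := q ` W\<rparr>" by fact
  interpret r: group_hom "K\<lparr>carrier := W\<rparr>" "Q\<lparr>carrier := q ` W\<rparr>" q
    by (rule q.induced_group_hom[OF W])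
  let ?z = "\<lambda>x. q ` V #>\<^bsub>Q\<lparr>carrier := q ` W\<rparr>\<^esub> q x"
  show thesis
  proof (rule that[of ?z])
    show "group_hom (K\<lparr>carrier := W\<rparr>) L ?z"
      unfolding L_def by (rule r.hom_comp[OF N.quotient_hom])
    show "?z ` W = carrier L"
      by (auto simp: L_def carrier_FactGroup)
    show "?z x = \<one>\<^bsub>L\<^esub> \<longleftrightarrow> q x \<in> q ` V" if "x \<in> W" for x
      using that N.coset_eq_self_iff[of "q x"] by (simp add: L_def)
  qed
qed

text \<open>\<open>d0\<close>, \<open>d1\<close> and \<open>e0\<close>, \<open>e1\<close>,
  \<open>e2\<close> are the faces out of degrees 1 and 2; \<open>s\<close>, \<open>t0\<close>,
  \<open>t1\<close> are degeneracies. \<open>exact0\<close> and \<open>exact1\<close> state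
  acyclicity in the Moore normalisation, where every face but the last vanishes.\<close>

locale truncated_resolution =
  \<epsilon>: group_hom F0 G \<epsilon> +
  d0: group_hom F1 F0 d0 + d1: group_hom F1 F0 d1 +
  e0: group_hom F2 F1 e0 + e1: group_hom F2 F1 e1 + e2: group_hom F2 F1 e2 +
  s: group_hom F0 F1 s + t0: group_hom F1 F2 t0 + t1: group_hom F1 F2 t1
  for G F0 F1 F2 :: "'a monoid" and \<epsilon> d0 d1 e0 e1 e2 s t0 t1 +
  assumes eps_d: "x \<in> carrier F1 \<Longrightarrow> \<epsilon> (d0 x) = \<epsilon> (d1 x)"
    and d_s [simp]: "a \<in> carrier F0 \<Longrightarrow> d0 (s a) = a" "a \<in> carrier F0 \<Longrightarrow> d1 (s a) = a"
    and d_e: "y \<in> carrier F2 \<Longrightarrow> d0 (e1 y) = d0 (e0 y)"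
      "y \<in> carrier F2 \<Longrightarrow> d0 (e2 y) = d1 (e0 y)"
      "y \<in> carrier F2 \<Longrightarrow> d1 (e2 y) = d1 (e1 y)"
    and e_t: "x \<in> carrier F1 \<Longrightarrow> e0 (t0 x) = x"
      "x \<in> carrier F1 \<Longrightarrow> e0 (t1 x) = s (d0 x)" "x \<in> carrier F1 \<Longrightarrow> e1 (t1 x) = x"
    and eps_surj: "\<epsilon> ` carrier F0 = carrier G"
    and exact0: "a \<in> carrier F0 \<Longrightarrow> \<epsilon> a = \<one>\<^bsub>G\<^esub> \<Longrightarrow>
      \<exists>x\<in>carrier F1. d0 x = \<one>\<^bsub>F0\<^esub> \<and> d1 x = a"
    and exact1: "x \<in> carrier F1 \<Longrightarrow> d0 x = \<one>\<^bsub>F0\<^esub> \<Longrightarrow> d1 x = \<one>\<^bsub>F0\<^esub> \<Longrightarrow>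
      \<exists>y\<in>carrier F2. e0 y = \<one>\<^bsub>F1\<^esub> \<and> e1 y = \<one>\<^bsub>F1\<^esub> \<and> e2 y = x"

text \<open>These are the Moore boundaries in degree 0 of the simplicial subgroup T(F).
  \<open>T\<close> is a parameter because the inductions along a series compare \<open>B\<close> for
  consecutive terms.\<close>

definition (in truncated_resolution) B :: "('a monoid \<Rightarrow> 'a set) \<Rightarrow> 'a set" where
  "B T = d1 ` {x \<in> T F1. d0 x = \<one>\<^bsub>F0\<^esub>}"

locale resolved_quotient =
  truncated_resolution G F0 F1 F2 \<epsilon> d0 d1 e0 e1 e2 s t0 t1 + functorial_normal S
  for G F0 F1 F2 :: "'a monoid" and \<epsilon> d0 d1 e0 e1 e2 s t0 t1
    and S :: "'a monoid \<Rightarrow> 'a set"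
begin

text \<open>\<open>cycles\<close> and \<open>boundaries\<close> are the Moore cycles and boundaries
  of F/S(F) in degree 1, with the morphism part of \<open>quotient_functor\<close> unfolded; a face
  is trivial when it is the coset \<open>S F0\<close> or \<open>S F1\<close> itself.\<close>

definition cycles where
  "cycles = {C \<in> carrier (F1 Mod S F1).
     S F0 <#>\<^bsub>F0\<^esub> (d0 ` C) = S F0 \<and> S F0 <#>\<^bsub>F0\<^esub> (d1 ` C) = S F0}"

definition boundaries where
  "boundaries = (\<lambda>C. S F1 <#>\<^bsub>F1\<^esub> (e2 ` C)) ` {C \<in> carrier (F2 Mod S F2).
     S F1 <#>\<^bsub>F1\<^esub> (e0 ` C) = S F1 \<and> S F1 <#>\<^bsub>F1\<^esub> (e1 ` C) = S F1}"

text \<open>Lifts of the cycles of the quotient, normalised so that \<open>d0\<close> vanishes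
  exactly and not merely modulo \<open>S F0\<close>.\<close>

definition W where "W = {x \<in> carrier F1. d0 x = \<one>\<^bsub>F0\<^esub> \<and> d1 x \<in> S F0}"

text \<open>The Moore cycles of F itself in degree 1, all of which bound by
  \<open>exact1\<close>.\<close>

definition V where "V = {x \<in> carrier F1. d0 x = \<one>\<^bsub>F0\<^esub> \<and> d1 x = \<one>\<^bsub>F0\<^esub>}"

sublocale N0: normal "S F0" F0 by (rule normal) (rule \<epsilon>.G.group_axioms)
sublocale N1: normal "S F1" F1 by (rule normal) (rule d0.G.group_axioms)
sublocale N2: normal "S F2" F2 by (rule normal) (rule e0.G.group_axioms)

lemmas S_hom = hom_mem[OF d0.group_hom_axioms] hom_mem[OF d1.group_hom_axioms]
  hom_mem[OF e0.group_hom_axioms] hom_mem[OF e1.group_hom_axioms]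
  hom_mem[OF e2.group_hom_axioms] hom_mem[OF s.group_hom_axioms]
  hom_mem[OF t0.group_hom_axioms] hom_mem[OF t1.group_hom_axioms]

lemma face_coset:
  "x \<in> carrier F1 \<Longrightarrow> S F0 <#>\<^bsub>F0\<^esub> (d0 ` (S F1 #>\<^bsub>F1\<^esub> x)) = S F0 \<longleftrightarrow> d0 x \<in> S F0"
  "x \<in> carrier F1 \<Longrightarrow> S F0 <#>\<^bsub>F0\<^esub> (d1 ` (S F1 #>\<^bsub>F1\<^esub> x)) = S F0 \<longleftrightarrow> d1 x \<in> S F0"
  "y \<in> carrier F2 \<Longrightarrow> S F1 <#>\<^bsub>F1\<^esub> (e0 ` (S F2 #>\<^bsub>F2\<^esub> y)) = S F1 \<longleftrightarrow> e0 y \<in> S F1"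
  "y \<in> carrier F2 \<Longrightarrow> S F1 <#>\<^bsub>F1\<^esub> (e1 ` (S F2 #>\<^bsub>F2\<^esub> y)) = S F1 \<longleftrightarrow> e1 y \<in> S F1"
  "y \<in> carrier F2 \<Longrightarrow> S F1 <#>\<^bsub>F1\<^esub> (e2 ` (S F2 #>\<^bsub>F2\<^esub> y)) = S F1 #>\<^bsub>F1\<^esub> e2 y"
  by (simp_all add: N0.coset_eq_self_iff N1.coset_eq_self_iff
      d0.coset_image[OF N1.normal_axioms N0.normal_axioms functorial[OF d0.group_hom_axioms]]
      d1.coset_image[OF N1.normal_axioms N0.normal_axioms functorial[OF d1.group_hom_axioms]]
      e0.coset_image[OF N2.normal_axioms N1.normal_axioms functorial[OF e0.group_hom_axioms]]
      e1.coset_image[OF N2.normal_axioms N1.normal_axioms functorial[OF e1.group_hom_axioms]]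
      e2.coset_image[OF N2.normal_axioms N1.normal_axioms functorial[OF e2.group_hom_axioms]])

text \<open>The degeneracy \<open>s\<close> splits \<open>d0\<close> and sends \<open>S F0\<close>
  into \<open>S F1\<close>. Dividing a representative by \<open>s (d0 x)\<close> therefore makes
  \<open>d0\<close> vanish without leaving the coset.\<close>

lemma cycles_eq: "cycles = (\<lambda>x. S F1 #>\<^bsub>F1\<^esub> x) ` W"
proof (intro equalityI subsetI)
  fix C assume "C \<in> cycles"
  then obtain x where x: "x \<in> carrier F1" "C = S F1 #>\<^bsub>F1\<^esub> x" "d0 x \<in> S F0" "d1 x \<in> S F0"
    by (auto simp: cycles_def carrier_FactGroup face_coset)
  let ?u = "s (d0 x)"
  have u: "?u \<in> S F1" using x S_hom by blast
  have "inv\<^bsub>F1\<^esub> ?u \<otimes>\<^bsub>F1\<^esub> x \<in> W" using x by (simp add: W_def)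
  moreover have "C = S F1 #>\<^bsub>F1\<^esub> (inv\<^bsub>F1\<^esub> ?u \<otimes>\<^bsub>F1\<^esub> x)"
    using x u by (simp add: N1.coset_eq_iff d0.G.inv_mult_group)
  ultimately show "C \<in> (\<lambda>x. S F1 #>\<^bsub>F1\<^esub> x) ` W" by blast
next
  fix C assume "C \<in> (\<lambda>x. S F1 #>\<^bsub>F1\<^esub> x) ` W"
  then obtain x where "x \<in> carrier F1" "d0 x = \<one>\<^bsub>F0\<^esub>" "d1 x \<in> S F0"
    and C: "C = S F1 #>\<^bsub>F1\<^esub> x"
    by (auto simp: W_def)
  then show "C \<in> cycles"
    by (simp add: C cycles_def carrier_FactGroup face_coset)
qed

text \<open>A filler whose faces vanish modulo \<open>S\<close> is corrected by degenerate elements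
  to one whose faces \<open>e0\<close> and \<open>e1\<close> vanish strictly; the coset of
  \<open>e2\<close> does not change, and strictness puts \<open>e2\<close> into \<open>V\<close>.
  The converse is \<open>exact1\<close>.\<close>

lemma boundaries_eq: "boundaries = (\<lambda>x. S F1 #>\<^bsub>F1\<^esub> x) ` V"
proof (intro equalityI subsetI)
  fix C assume "C \<in> boundaries"
  then obtain y where y: "y \<in> carrier F2" "e0 y \<in> S F1" "e1 y \<in> S F1"
    and C: "C = S F1 #>\<^bsub>F1\<^esub> e2 y"
    by (auto simp: boundaries_def carrier_FactGroup face_coset)
  \<comment> \<open>Since \<open>e0 (t0 u) = u\<close>, this clears \<open>e0\<close>; the factor
    lies in \<open>S F2\<close>, so \<open>e1\<close> stays in \<open>S F1\<close>.\<close>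
  define y1 where "y1 = y \<otimes>\<^bsub>F2\<^esub> inv\<^bsub>F2\<^esub> t0 (e0 y)"
  have y1: "y1 \<in> carrier F2" "e0 y1 = \<one>\<^bsub>F1\<^esub>" "e1 y1 \<in> S F1"
    using y S_hom by (auto simp: y1_def e_t)
  \<comment> \<open>This clears \<open>e1\<close> and keeps \<open>e0\<close> trivial:
    \<open>e0 (t1 (e1 y1))\<close> is \<open>s (d0 (e1 y1))\<close>, and
    \<open>d0 (e1 y1) = d0 (e0 y1)\<close> is trivial already.\<close>
  define y2 where "y2 = y1 \<otimes>\<^bsub>F2\<^esub> inv\<^bsub>F2\<^esub> t1 (e1 y1)"
  have y2: "y2 \<in> carrier F2" "e0 y2 = \<one>\<^bsub>F1\<^esub>" "e1 y2 = \<one>\<^bsub>F1\<^esub>"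
    using y1 by (auto simp: y2_def e_t d_e)
  have "d0 (e2 y2) = \<one>\<^bsub>F0\<^esub>" "d1 (e2 y2) = \<one>\<^bsub>F0\<^esub>"
    using y2 by (simp_all add: d_e)
  then have "e2 y2 \<in> V" using y2 by (simp add: V_def)
  \<comment> \<open>The correction stands on the right of \<open>y\<close>, so the quotient is a
    conjugate of an element of \<open>S F1\<close>; here normality is needed.\<close>
  have "e2 y1 \<otimes>\<^bsub>F1\<^esub> inv\<^bsub>F1\<^esub> e2 y \<in> S F1"
  proof -
    let ?w = "e2 (t0 (e0 y))"
    have "?w \<in> S F1" using y(2) by (intro S_hom(5,7))
    then have "inv\<^bsub>F1\<^esub> ?w \<in> S F1" by simp
    then have "e2 y \<otimes>\<^bsub>F1\<^esub> inv\<^bsub>F1\<^esub> ?w \<otimes>\<^bsub>F1\<^esub> inv\<^bsub>F1\<^esub> e2 y \<in> S F1"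
      using y by (intro N1.inv_op_closed2) auto
    then show ?thesis using y by (simp add: y1_def)
  qed
  then have 1: "S F1 #>\<^bsub>F1\<^esub> e2 y1 = S F1 #>\<^bsub>F1\<^esub> e2 y"
    using y1 y by (subst N1.coset_eq_iff) auto
  have "e2 y2 \<otimes>\<^bsub>F1\<^esub> inv\<^bsub>F1\<^esub> e2 y1 \<in> S F1"
  proof -
    let ?w = "e2 (t1 (e1 y1))"
    have "?w \<in> S F1" using y1(3) by (intro S_hom(5,8))
    then have "inv\<^bsub>F1\<^esub> ?w \<in> S F1" by simp
    then have "e2 y1 \<otimes>\<^bsub>F1\<^esub> inv\<^bsub>F1\<^esub> ?w \<otimes>\<^bsub>F1\<^esub> inv\<^bsub>F1\<^esub> e2 y1 \<in> S F1"
      using y1 by (intro N1.inv_op_closed2) auto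
    then show ?thesis using y1(1) by (simp add: y2_def)
  qed
  then have 2: "S F1 #>\<^bsub>F1\<^esub> e2 y2 = S F1 #>\<^bsub>F1\<^esub> e2 y1"
    using y1 y2 by (subst N1.coset_eq_iff) auto
  show "C \<in> (\<lambda>x. S F1 #>\<^bsub>F1\<^esub> x) ` V"
    using C 1 2 \<open>e2 y2 \<in> V\<close> by auto
next
  fix C assume "C \<in> (\<lambda>x. S F1 #>\<^bsub>F1\<^esub> x) ` V"
  then obtain x where x: "x \<in> V" "C = S F1 #>\<^bsub>F1\<^esub> x" by blast
  then obtain y where y: "y \<in> carrier F2" "e0 y = \<one>\<^bsub>F1\<^esub>" "e1 y = \<one>\<^bsub>F1\<^esub>" "e2 y = x"
    using exact1[of x] by (auto simp: V_def)
  have "S F2 #>\<^bsub>F2\<^esub> y \<in> {C \<in> carrier (F2 Mod S F2).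
     S F1 <#>\<^bsub>F1\<^esub> (e0 ` C) = S F1 \<and> S F1 <#>\<^bsub>F1\<^esub> (e1 ` C) = S F1}"
    using y by (simp add: carrier_FactGroup face_coset)
  moreover have "C = S F1 <#>\<^bsub>F1\<^esub> (e2 ` (S F2 #>\<^bsub>F2\<^esub> y))"
    using x y by (simp add: face_coset)
  ultimately show "C \<in> boundaries" unfolding boundaries_def by (rule rev_image_eqI)
qed

lemma subgroup_W: "subgroup W F1"
  by (rule d0.G.subgroupI) (auto simp: W_def intro!: exI[of _ "\<one>\<^bsub>F1\<^esub>"])

lemma normal_V: "V \<lhd> F1"
proof -
  have "subgroup V F1"
    by (rule d0.G.subgroupI) (auto simp: V_def intro!: exI[of _ "\<one>\<^bsub>F1\<^esub>"])
  then show ?thesis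
    by (auto simp: d0.G.normal_inv_iff) (auto simp: V_def)
qed

lemma d1_W: "d1 ` W = {a \<in> S F0. \<epsilon> a = \<one>\<^bsub>G\<^esub>}"
proof (intro equalityI subsetI)
  fix a assume "a \<in> d1 ` W"
  then show "a \<in> {a \<in> S F0. \<epsilon> a = \<one>\<^bsub>G\<^esub>}"
    by (auto simp: W_def simp flip: eps_d)
next
  fix a assume "a \<in> {a \<in> S F0. \<epsilon> a = \<one>\<^bsub>G\<^esub>}"
  then show "a \<in> d1 ` W" using exact0[of a] by (auto simp: W_def)
qed

text \<open>Through \<open>d1\<close> this says that the derived functor is (ker \<epsilon> \<inter>
  \<open>S F0\<close>) / \<open>B S\<close>. An element of \<open>W\<close> becomes trivial when it
  differs from some v in \<open>V\<close> by an element of \<open>S F1\<close>; that difference also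
  lies in ker \<open>d0\<close>, and \<open>d1\<close> does not see v.\<close>

lemma derived_epi:
  defines "L \<equiv> (F1 Mod S F1)\<lparr>carrier := cycles\<rparr> Mod boundaries"
  obtains \<zeta> where "group_hom (F1\<lparr>carrier := W\<rparr>) L \<zeta>" "\<zeta> ` W = carrier L"
    "\<And>x. x \<in> W \<Longrightarrow> \<zeta> x = \<one>\<^bsub>L\<^esub> \<longleftrightarrow> d1 x \<in> B S"
proof -
  have surj: "(\<lambda>x. S F1 #>\<^bsub>F1\<^esub> x) ` carrier F1 = carrier (F1 Mod S F1)"
    by (simp add: carrier_FactGroup)
  have "V \<subseteq> W" by (auto simp: V_def W_def)
  from subquotient_epi[OF N1.quotient_hom surj subgroup_W normal_V this]
  obtain \<zeta> where z: "group_hom (F1\<lparr>carrier := W\<rparr>) L \<zeta>" "\<zeta> ` W = carrier L"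
    and ker: "\<And>x. x \<in> W \<Longrightarrow> \<zeta> x = \<one>\<^bsub>L\<^esub> \<longleftrightarrow> S F1 #>\<^bsub>F1\<^esub> x \<in> (\<lambda>x. S F1 #>\<^bsub>F1\<^esub> x) ` V"
    unfolding L_def cycles_eq boundaries_eq by blast
  show thesis
  proof (rule that[OF z])
    fix x assume x: "x \<in> W"
    have "S F1 #>\<^bsub>F1\<^esub> x \<in> (\<lambda>x. S F1 #>\<^bsub>F1\<^esub> x) ` V \<longleftrightarrow> d1 x \<in> B S"
    proof
      assume "S F1 #>\<^bsub>F1\<^esub> x \<in> (\<lambda>x. S F1 #>\<^bsub>F1\<^esub> x) ` V"
      then obtain v where v: "v \<in> V" "S F1 #>\<^bsub>F1\<^esub> x = S F1 #>\<^bsub>F1\<^esub> v" by blast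
      then have "x \<otimes>\<^bsub>F1\<^esub> inv\<^bsub>F1\<^esub> v \<in> S F1"
        using x N1.coset_eq_iff by (auto simp: V_def W_def)
      moreover have "d0 (x \<otimes>\<^bsub>F1\<^esub> inv\<^bsub>F1\<^esub> v) = \<one>\<^bsub>F0\<^esub>" "d1 (x \<otimes>\<^bsub>F1\<^esub> inv\<^bsub>F1\<^esub> v) = d1 x"
        using x v by (auto simp: V_def W_def)
      ultimately show "d1 x \<in> B S" unfolding B_def by (intro rev_image_eqI[of "x \<otimes>\<^bsub>F1\<^esub> inv\<^bsub>F1\<^esub> v"]) auto
    next
      assume "d1 x \<in> B S"
      then obtain t where t: "t \<in> S F1" "d0 t = \<one>\<^bsub>F0\<^esub>" "d1 x = d1 t"
        by (auto simp: B_def)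
      have xt: "x \<in> carrier F1" "t \<in> carrier F1" "d0 x = \<one>\<^bsub>F0\<^esub>"
        using x t by (auto simp: W_def)
      have "inv\<^bsub>F1\<^esub> t \<otimes>\<^bsub>F1\<^esub> x \<in> V" using xt t by (simp add: V_def)
      moreover have "S F1 #>\<^bsub>F1\<^esub> x = S F1 #>\<^bsub>F1\<^esub> (inv\<^bsub>F1\<^esub> t \<otimes>\<^bsub>F1\<^esub> x)"
        using xt t by (simp add: N1.coset_eq_iff d0.G.inv_mult_group)
      ultimately show "S F1 #>\<^bsub>F1\<^esub> x \<in> (\<lambda>x. S F1 #>\<^bsub>F1\<^esub> x) ` V" by blast
    qed
    then show "\<zeta> x = \<one>\<^bsub>L\<^esub> \<longleftrightarrow> d1 x \<in> B S" using ker[OF x] by simp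
  qed
qed

end

section \<open>Free groups and the comonad resolution\<close>

lemma presentation_free: "presentation X {}"
  by unfold_locales auto

lemma free_group_group: "group (free_group H)"
  unfolding free_group_def by (rule presentation.group_P[OF presentation_free])

lemma free_gen_closed [simp]: "x \<in> carrier H \<Longrightarrow> free_gen H x \<in> carrier (free_group H)"
  unfolding free_group_def free_gen_def by (rule presentation.gen_closed[OF presentation_free])

lemma free_group_generate:
  "carrier (free_group H) = generate (free_group H) (free_gen H ` carrier H)"
  unfolding free_group_def free_gen_def by (rule presentation.carrier_generate[OF presentation_free])

lemma free_hom_extend:
  assumes "group K" "f \<in> carrier H \<rightarrow> carrier K"
  shows "group_hom (free_group H) K (hom_extend K f)"
    and "x \<in> carrier H \<Longrightarrow> hom_extend K f (free_gen H x) = f x"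
  unfolding free_group_def free_gen_def
  using presentation.hom_extend_hom[OF presentation_free assms]
    presentation.hom_extend_gen[OF presentation_free assms] by auto

lemma free_hom_eqI:
  assumes "group_hom (free_group H) K f" "group_hom (free_group H) K g"
    and "\<And>x. x \<in> carrier H \<Longrightarrow> f (free_gen H x) = g (free_gen H x)"
    and "a \<in> carrier (free_group H)"
  shows "f a = g a"
  using presentation.hom_eqI[OF presentation_free] assms
  unfolding free_group_def free_gen_def by blast

lemma
  assumes "f \<in> carrier A \<rightarrow> carrier H"
  shows free_map_hom: "group_hom (free_group A) (free_group H) (free_map H f)"
    and free_map_gen [simp]: "x \<in> carrier A \<Longrightarrow> free_map H f (free_gen A x) = free_gen H (f x)"
proof -
  have "(\<lambda>x. free_gen H (f x)) \<in> carrier A \<rightarrow> carrier (free_group H)"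
    using assms by (simp add: Pi_iff)
  from free_hom_extend[OF free_group_group this]
  show "group_hom (free_group A) (free_group H) (free_map H f)"
    "x \<in> carrier A \<Longrightarrow> free_map H f (free_gen A x) = free_gen H (f x)"
    by (simp_all add: free_map_def)
qed

lemma
  assumes "group G"
  shows counit_hom: "group_hom (free_group G) G (counit G)"
    and counit_gen [simp]: "x \<in> carrier G \<Longrightarrow> counit G (free_gen G x) = x"
  using free_hom_extend[OF assms, of "\<lambda>x. x" G] by (simp_all add: counit_def)

lemma
  shows comult_hom: "group_hom (free_group G) (free_group (free_group G)) (comult G)"
    and comult_gen [simp]:
      "x \<in> carrier G \<Longrightarrow> comult G (free_gen G x) = free_gen (free_group G) (free_gen G x)"
  using free_hom_extend[OF free_group_group, of "\<lambda>x. free_gen (free_group G) (free_gen G x)" G "free_group G"]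
  by (auto simp: comult_def)

lemma group_hom_funcset: "group_hom A B f \<Longrightarrow> f \<in> carrier A \<rightarrow> carrier B"
  by (auto simp: group_hom.hom_closed)

text \<open>Each simplicial identity equates two composites out of a free group, so it only has to
  be checked on generators.\<close>

lemma free_comp_eqI:
  assumes "group_hom (free_group H) K f" "group_hom K L g"
    and "group_hom (free_group H) K' f'" "group_hom K' L g'"
    and "\<And>x. x \<in> carrier H \<Longrightarrow> g (f (free_gen H x)) = g' (f' (free_gen H x))"
    and "a \<in> carrier (free_group H)"
  shows "g (f a) = g' (f' a)"
  by (rule free_hom_eqI[OF group_hom.hom_comp[OF assms(1,2)] group_hom.hom_comp[OF assms(3,4)]])
     (use assms in auto)

lemma id_group_hom: "group G \<Longrightarrow> group_hom G G (\<lambda>x. x)"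
  by (intro group_homI homI) auto

abbreviation \<P> :: "'a uni monoid \<Rightarrow> 'a uni monoid" where "\<P> \<equiv> free_group"

text \<open>The simplicial identities hold on generators. Exactness comes from inserting generators,
  a contraction of the underlying sets only: \<open>free_gen\<close> is not a homomorphism, and
  dividing by the generator at 1 is what turns a trivial face into a trivial group element.\<close>

lemma comonad_resolution:
  assumes "group G"
  shows "truncated_resolution G (\<P> G) (\<P> (\<P> G)) (\<P> (\<P> (\<P> G)))
    (counit G) (counit (\<P> G)) (free_map G (counit G))
    (counit (\<P> (\<P> G))) (free_map (\<P> G) (counit (\<P> G))) (free_map (\<P> G) (free_map G (counit G)))
    (comult G) (comult (\<P> G)) (free_map (\<P> (\<P> G)) (comult G))"
proof -
  interpret G: group G by fact
  have P: "group (\<P> H)" for H by (rule free_group_group)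
  interpret PG: group "\<P> G" by (rule P)
  interpret PPG: group "\<P> (\<P> G)" by (rule P)
  interpret PPPG: group "\<P> (\<P> (\<P> G))" by (rule P)
  have eps: "group_hom (\<P> H) H (counit H)" if "group H" for H
    using counit_hom[OF that] by simp
  have map: "group_hom (\<P> A) (\<P> H) (free_map H f)" if "group_hom A H f" for A H f
    using free_map_hom[OF group_hom_funcset[OF that]] by simp
  have delta: "group_hom (\<P> H) (\<P> (\<P> H)) (comult H)" for H
    by (rule comult_hom)
  note homs = eps[OF assms(1)] eps[OF P] map[OF eps[OF assms(1)]] map[OF eps[OF P]]
    map[OF map[OF eps[OF assms(1)]]] delta map[OF delta] id_group_hom[OF P]
  have gen: "free_gen H x \<in> carrier (\<P> H)" if "x \<in> carrier H" for H x
    using that by simp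
  have cg: "counit H (free_gen H x) = x" if "group H" "x \<in> carrier H" for H x
    using counit_gen that by simp
  have mg: "free_map H f (free_gen A x) = free_gen H (f x)" if "group_hom A H f" "x \<in> carrier A" for A H f x
    using free_map_gen[OF group_hom_funcset[OF that(1)]] that by simp
  have dg: "comult H (free_gen H x) = free_gen (\<P> H) (free_gen H x)" if "x \<in> carrier H" for H x
    using comult_gen that by simp
  note eqI = free_comp_eqI
  let ?\<epsilon> = "counit G" and ?d0 = "counit (\<P> G)" and ?d1 = "free_map G (counit G)"
  let ?e0 = "counit (\<P> (\<P> G))" and ?e1 = "free_map (\<P> G) (counit (\<P> G))"
  let ?e2 = "free_map (\<P> G) (free_map G (counit G))"
  let ?s = "comult G" and ?t0 = "comult (\<P> G)" and ?t1 = "free_map (\<P> (\<P> G)) (comult G)"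
  note clo = homs[THEN group_hom.hom_closed]
  note simps = gen clo cg[OF assms(1)] cg[OF P] mg[OF homs(1)] mg[OF homs(2)] mg[OF homs(3)] mg[OF homs(6)] dg
  have nat_d: "?\<epsilon> (?d0 x) = ?\<epsilon> (?d1 x)" if "x \<in> carrier (\<P> (\<P> G))" for x
    by (rule eqI[OF homs(2) homs(1) homs(3) homs(1) _ that]) (simp add: simps)
  have ds: "?d0 (?s a) = a" "?d1 (?s a) = a" if "a \<in> carrier (\<P> G)" for a
    by (rule eqI[OF homs(6) homs(2) homs(8) homs(8) _ that] eqI[OF homs(6) homs(3) homs(8) homs(8) _ that];
        simp add: simps)+
  have de: "?d0 (?e1 y) = ?d0 (?e0 y)" "?d0 (?e2 y) = ?d1 (?e0 y)" "?d1 (?e2 y) = ?d1 (?e1 y)"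
    if "y \<in> carrier (\<P> (\<P> (\<P> G)))" for y
  proof -
    show "?d0 (?e1 y) = ?d0 (?e0 y)"
      by (rule eqI[OF homs(4) homs(2) homs(2) homs(2) _ that]) (simp add: simps)
    show "?d0 (?e2 y) = ?d1 (?e0 y)"
      by (rule eqI[OF homs(5) homs(2) homs(2) homs(3) _ that]) (simp add: simps)
    show "?d1 (?e2 y) = ?d1 (?e1 y)"
      by (rule eqI[OF homs(5) homs(3) homs(4) homs(3) _ that]) (simp add: simps nat_d)
  qed
  have et: "?e0 (?t0 x) = x" "?e1 (?t0 x) = x" "?e2 (?t0 x) = ?s (?d1 x)"
    "?e0 (?t1 x) = ?s (?d0 x)" "?e1 (?t1 x) = x" "?e2 (?t1 x) = x" if "x \<in> carrier (\<P> (\<P> G))" for x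
  proof -
    show "?e0 (?t0 x) = x"
      by (rule eqI[OF homs(6) homs(2) homs(8) homs(8) _ that]) (simp add: simps)
    show "?e1 (?t0 x) = x"
      by (rule eqI[OF homs(6) homs(4) homs(8) homs(8) _ that]) (simp add: simps)
    show "?e2 (?t0 x) = ?s (?d1 x)"
      by (rule eqI[OF homs(6) homs(5) homs(3) homs(6) _ that]) (simp add: simps)
    show "?e0 (?t1 x) = ?s (?d0 x)"
      by (rule eqI[OF homs(7) homs(2) homs(2) homs(6) _ that]) (simp add: simps)
    show "?e1 (?t1 x) = x"
      by (rule eqI[OF homs(7) homs(4) homs(8) homs(8) _ that]) (simp add: simps ds)
    show "?e2 (?t1 x) = x"
      by (rule eqI[OF homs(7) homs(5) homs(8) homs(8) _ that]) (simp add: simps ds)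
  qed
  interpret \<epsilon>: group_hom "\<P> G" G ?\<epsilon> by (rule homs)
  interpret d0: group_hom "\<P> (\<P> G)" "\<P> G" ?d0 by (rule homs)
  interpret d1: group_hom "\<P> (\<P> G)" "\<P> G" ?d1 by (rule homs)
  interpret e0: group_hom "\<P> (\<P> (\<P> G))" "\<P> (\<P> G)" ?e0 by (rule homs)
  interpret e1: group_hom "\<P> (\<P> (\<P> G))" "\<P> (\<P> G)" ?e1 by (rule homs)
  interpret e2: group_hom "\<P> (\<P> (\<P> G))" "\<P> (\<P> G)" ?e2 by (rule homs)
  interpret s: group_hom "\<P> G" "\<P> (\<P> G)" ?s by (rule homs)
  interpret t0: group_hom "\<P> (\<P> G)" "\<P> (\<P> (\<P> G))" ?t0 by (rule homs)
  interpret t1: group_hom "\<P> (\<P> G)" "\<P> (\<P> (\<P> G))" ?t1 by (rule homs)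
  show ?thesis
  proof
    show "?\<epsilon> ` carrier (\<P> G) = carrier G"
    proof
      show "carrier G \<subseteq> ?\<epsilon> ` carrier (\<P> G)"
        using gen cg[OF assms(1)] by (metis image_eqI subsetI)
    qed auto
  next
    fix a assume a: "a \<in> carrier (\<P> G)" "?\<epsilon> a = \<one>\<^bsub>G\<^esub>"
    \<comment> \<open>\<open>a \<mapsto> free_gen a\<close> is the extra degeneracy of the underlying simplicial set.\<close>
    define z where "z = free_gen (\<P> G) a \<otimes>\<^bsub>\<P> (\<P> G)\<^esub> inv\<^bsub>\<P> (\<P> G)\<^esub> free_gen (\<P> G) \<one>\<^bsub>\<P> G\<^esub>"
    have z: "z \<in> carrier (\<P> (\<P> G))" "?d0 z = a" "?d1 z = \<one>\<^bsub>\<P> G\<^esub>"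
      using a by (simp_all add: z_def simps)
    \<comment> \<open>The contraction puts \<open>a\<close> on the face \<open>d0\<close>, whereas
      it is wanted on \<open>d1\<close>. Both faces of \<open>s a\<close> are \<open>a\<close>, so
      dividing it by \<open>z\<close> exchanges them.\<close>
    then show "\<exists>x\<in>carrier (\<P> (\<P> G)). ?d0 x = \<one>\<^bsub>\<P> G\<^esub> \<and> ?d1 x = a"
      using a by (intro bexI[of _ "?s a \<otimes>\<^bsub>\<P> (\<P> G)\<^esub> inv\<^bsub>\<P> (\<P> G)\<^esub> z"]) (auto simp: ds)
  next
    fix x assume x: "x \<in> carrier (\<P> (\<P> G))" "?d0 x = \<one>\<^bsub>\<P> G\<^esub>" "?d1 x = \<one>\<^bsub>\<P> G\<^esub>"
    \<comment> \<open>The same contraction one degree higher. The faces \<open>e1\<close> and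
      \<open>e2\<close> insert \<open>d0 x\<close> and \<open>d1 x\<close>, which are trivial, so
      each becomes the generator at 1 divided by itself.\<close>
    define z where "z = free_gen (\<P> (\<P> G)) x \<otimes>\<^bsub>\<P> (\<P> (\<P> G))\<^esub>
      inv\<^bsub>\<P> (\<P> (\<P> G))\<^esub> free_gen (\<P> (\<P> G)) \<one>\<^bsub>\<P> (\<P> G)\<^esub>"
    have z: "z \<in> carrier (\<P> (\<P> (\<P> G)))" "?e0 z = x" "?e1 z = \<one>\<^bsub>\<P> (\<P> G)\<^esub>" "?e2 z = \<one>\<^bsub>\<P> (\<P> G)\<^esub>"
      using x by (simp_all add: z_def simps)
    \<comment> \<open>This is \<open>t0 x\<close> inverse, times \<open>z\<close>, times
      \<open>t1 x\<close>. Its successive faces are the inverse of x times x times a trivial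
      element, the inverse of x times x, and a trivial element times x.\<close>
    let ?y = "inv\<^bsub>\<P> (\<P> (\<P> G))\<^esub> (inv\<^bsub>\<P> (\<P> (\<P> G))\<^esub> z \<otimes>\<^bsub>\<P> (\<P> (\<P> G))\<^esub> ?t0 x) \<otimes>\<^bsub>\<P> (\<P> (\<P> G))\<^esub> ?t1 x"
    have "?e0 ?y = \<one>\<^bsub>\<P> (\<P> G)\<^esub>" "?e1 ?y = \<one>\<^bsub>\<P> (\<P> G)\<^esub>" "?e2 ?y = x"
      using x z by (simp_all add: et)
    then show "\<exists>y\<in>carrier (\<P> (\<P> (\<P> G))). ?e0 y = \<one>\<^bsub>\<P> (\<P> G)\<^esub> \<and> ?e1 y = \<one>\<^bsub>\<P> (\<P> G)\<^esub> \<and> ?e2 y = x"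
      using x z by (intro bexI[of _ ?y]) auto
  qed (use nat_d ds de et in auto)
qed

lemma embed_group_group:
  assumes "group G" shows "group (embed_group G)"
proof -
  interpret group G by fact
  show ?thesis
    by (rule groupI) (auto simp: embed_group_def m_assoc intro!: bexI[of _ "Elem (inv\<^bsub>G\<^esub> _)"])
qed

section \<open>The derived functor expressed through the truncated resolution\<close>

locale resolved_functor = functorial_normal S for S :: "'a uni monoid \<Rightarrow> 'a uni set" +
  fixes G :: "'a uni monoid"
  assumes group_G: "group G"
begin

sublocale G: group G by (rule group_G)

abbreviation F0 where "F0 \<equiv> free_group G"
abbreviation F1 where "F1 \<equiv> free_group F0"
abbreviation F2 where "F2 \<equiv> free_group F1"

sublocale resolved_quotient G F0 F1 F2
    "counit G" "counit F0" "free_map G (counit G)"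
    "counit F1" "free_map F0 (counit F0)" "free_map F0 (free_map G (counit G))"
    "comult G" "comult F0" "free_map F1 (comult G)" S
  by (intro resolved_quotient.intro functorial_normal_axioms comonad_resolution[OF group_G])

lemma left_derived_eq:
  "left_derived 1 (quotient_functor S) G = (F1 Mod S F1)\<lparr>carrier := cycles\<rparr> Mod boundaries"
proof -
  have "moore_cycles (apply_functor (quotient_functor S) (free_resolution G)) 1 = cycles"
    by (auto simp: moore_cycles_def moore_carrier_def apply_functor_def quotient_functor_def
        free_resolution_def cycles_def)
  moreover have "moore_boundaries (apply_functor (quotient_functor S) (free_resolution G)) 1 = boundaries"
  proof -
    have "(\<forall>i<Suc (Suc 0). Q i) \<longleftrightarrow> Q 0 \<and> Q (Suc 0)" for Q
      by (auto simp: less_Suc_eq)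
    then show ?thesis
      by (simp add: moore_boundaries_def moore_carrier_def apply_functor_def quotient_functor_def
          free_resolution_def boundaries_def numeral_2_eq_2)
  qed
  ultimately show ?thesis
    by (simp add: left_derived_def homotopy_group_def)
       (simp add: apply_functor_def quotient_functor_def free_resolution_def)
qed

end

section \<open>Central and derived series\<close>

lemma lower_central_Suc:
  "lower_central K (Suc 0) = carrier K"
  "lower_central K (Suc (Suc n)) = commutator_subgroup K (lower_central K (Suc n)) (carrier K)"
  by (simp_all add: lower_central_def)

lemma derived_series_Suc:
  "derived_series K (Suc 0) = carrier K"
  "derived_series K (Suc (Suc n)) = derived K (derived_series K (Suc n))"
  by (simp_all add: derived_series_def)

lemma derived_commutators:
  "derived K A = generate K {commutator K a b | a b. a \<in> A \<and> b \<in> A}"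
proof -
  have "derived_set K A = {commutator K a b | a b. a \<in> A \<and> b \<in> A}"
    by (auto simp: commutator_def)
  then show ?thesis by (simp add: derived_def)
qed

context group
begin

lemma commutator_mem_subgroup:
  "a \<in> A \<Longrightarrow> b \<in> B \<Longrightarrow> commutator G a b \<in> commutator_subgroup G A B"
  by (auto simp: commutator_subgroup_def intro: generate.incl)

lemma commutator_mem_derived: "a \<in> A \<Longrightarrow> b \<in> A \<Longrightarrow> commutator G a b \<in> derived G A"
  by (auto simp: derived_commutators intro: generate.incl)

lemma normal_conjugate: "N \<lhd> G \<Longrightarrow> g \<in> carrier G \<Longrightarrow> x \<in> N \<Longrightarrow> conjugate G g x \<in> N"
  by (simp add: conjugate_def normal.inv_op_closed2)

lemma commutator_subgroup_normal:
  assumes "A \<lhd> G" "B \<lhd> G" shows "commutator_subgroup G A B \<lhd> G"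
proof -
  interpret A: normal A G by fact
  interpret B: normal B G by fact
  show ?thesis
    unfolding commutator_subgroup_def
  proof (rule normal_generateI)
    fix h g assume "h \<in> {commutator G a b | a b. a \<in> A \<and> b \<in> B}" and g: "g \<in> carrier G"
    then obtain a b where ab: "a \<in> A" "b \<in> B" "h = commutator G a b" by blast
    then have "g \<otimes> h \<otimes> inv g = commutator G (conjugate G g a) (conjugate G g b)"
      using g conjugate_commutator[of g a b] by (simp flip: conjugate_def)
    then show "g \<otimes> h \<otimes> inv g \<in> {commutator G a b | a b. a \<in> A \<and> b \<in> B}"
      using normal_conjugate[OF assms(1) g ab(1)] normal_conjugate[OF assms(2) g ab(2)] by blast
  qed auto
qed

lemma lower_central_normal: "lower_central G (Suc n) \<lhd> G"
  by (induction n) (auto simp: lower_central_Suc intro: commutator_subgroup_normal normal_self)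

lemma derived_series_normal: "derived_series G (Suc n) \<lhd> G"
  by (induction n) (auto simp: derived_series_Suc intro: derived_is_normal normal_self)

end

lemma (in group_hom) generate_image_subset:
  assumes "A \<subseteq> carrier G" "h ` A \<subseteq> B" shows "h ` generate G A \<subseteq> generate H B"
  using generate_img[OF assms(1)] H.mono_generate[OF assms(2)] by simp

lemma (in group_hom) commutator_subgroup_image:
  assumes "A \<subseteq> carrier G" "B \<subseteq> carrier G" "h ` A \<subseteq> A'" "h ` B \<subseteq> B'"
  shows "h ` commutator_subgroup G A B \<subseteq> commutator_subgroup H A' B'"
  unfolding commutator_subgroup_def
proof (rule generate_image_subset)
  show "{commutator G a b |a b. a \<in> A \<and> b \<in> B} \<subseteq> carrier G" using assms by auto
  show "h ` {commutator G a b |a b. a \<in> A \<and> b \<in> B} \<subseteq> {commutator H a b |a b. a \<in> A' \<and> b \<in> B'}"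
  proof clarify
    fix a b assume "a \<in> A" "b \<in> B"
    then have "h (commutator G a b) = commutator H (h a) (h b)" "h a \<in> A'" "h b \<in> B'"
      using assms by (auto intro!: hom_commutator)
    then show "\<exists>a' b'. h (commutator G a b) = commutator H a' b' \<and> a' \<in> A' \<and> b' \<in> B'" by blast
  qed
qed

lemma derived_commutator_subgroup: "derived K A = commutator_subgroup K A A"
  by (simp add: derived_commutators commutator_subgroup_def)

lemma functorial_lower_central: "functorial_normal (\<lambda>K. lower_central K (Suc n))"
proof (rule functorial_normal.intro)
  fix K L :: "'a monoid" and f assume f: "group_hom K L f"
  then interpret f: group_hom K L f .
  show "f ` lower_central K (Suc n) \<subseteq> lower_central L (Suc n)"
  proof (induction n)
    case (Suc n)
    then show ?case
      using f.G.lower_central_normal[of n] unfolding lower_central_Suc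
      by (intro f.commutator_subgroup_image) (auto dest: normal_imp_subgroup subgroup.subset)
  qed (auto simp: lower_central_Suc)
qed (rule group.lower_central_normal)

lemma functorial_derived_series: "functorial_normal (\<lambda>K. derived_series K (Suc n))"
proof (rule functorial_normal.intro)
  fix K L :: "'a monoid" and f assume f: "group_hom K L f"
  then interpret f: group_hom K L f .
  show "f ` derived_series K (Suc n) \<subseteq> derived_series L (Suc n)"
  proof (induction n)
    case (Suc n)
    then show ?case
      using f.G.derived_series_normal[of n] unfolding derived_series_Suc derived_commutator_subgroup
      by (intro f.commutator_subgroup_image) (auto dest: normal_imp_subgroup subgroup.subset)
  qed (auto simp: derived_series_Suc)
qed (rule group.derived_series_normal)

text \<open>Only the two elements at hand need commute with \<open>z\<close>. Along the derived
  series, the difference of two lifts is known to commute modulo the next \<open>B\<close> with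
  elements of the current term, not with the whole group.\<close>

lemma (in group) commutator_central_left:
  assumes "z \<in> carrier G" "a \<in> carrier G" "f \<in> carrier G"
    and "commutator G z a = \<one>" "commutator G z f = \<one>"
  shows "commutator G (z \<otimes> a) f = commutator G a f"
proof -
  have c: "z \<otimes> x = x \<otimes> z" if "x \<in> carrier G" "commutator G z x = \<one>" for x
  proof -
    have "z \<otimes> x \<otimes> inv z \<otimes> inv x \<otimes> (x \<otimes> z) = x \<otimes> z"
      using that assms by (simp add: commutator_def)
    then show ?thesis using that assms by (simp add: m_assoc)
  qed
  have "z \<otimes> commutator G a f \<otimes> inv z = commutator G a f"
  proof -
    have "commutator G a f = commutator G (conjugate G z a) (conjugate G z f)"
      using assms c by (simp add: conjugate_def m_assoc)
    then show ?thesis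
      using assms conjugate_commutator[of z a f] by (simp flip: conjugate_def)
  qed
  moreover have "commutator G (z \<otimes> a) f = (z \<otimes> commutator G a f \<otimes> inv z) \<otimes> commutator G z f"
    using assms(1-3) by (simp add: word_simps)
  ultimately show ?thesis using assms by simp
qed

lemma (in group) commutator_right:
  assumes "a \<in> carrier G" "f \<in> carrier G" "r \<in> carrier G" "commutator G a r = \<one>"
  shows "commutator G a (f \<otimes> r) = commutator G a f"
proof -
  have "commutator G a (f \<otimes> r) = commutator G a f \<otimes> (f \<otimes> commutator G a r \<otimes> inv f)"
    using assms(1-3) by (simp add: word_simps)
  then show ?thesis using assms by simp
qed

text \<open>The relation \<open>r w = p x\<close> sends x to \<open>\<zeta> w\<close>. It is single
  valued since ker \<open>r\<close> lies in ker \<open>\<zeta>\<close>, and total and onto since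
  \<open>p\<close> and \<open>r\<close> have the same image. The last clause keeps the value on any
  such w available, so that the kernel can be computed later.\<close>

lemma epi_through:
  assumes p: "group_hom A Q p" and r: "group_hom M Q r" and \<zeta>: "group_hom M L \<zeta>"
    and p_r: "p ` carrier A = r ` carrier M" and surj: "\<zeta> ` carrier M = carrier L"
    and ker: "\<And>w. w \<in> carrier M \<Longrightarrow> r w = \<one>\<^bsub>Q\<^esub> \<Longrightarrow> \<zeta> w = \<one>\<^bsub>L\<^esub>"
  obtains \<phi> where "\<phi> \<in> epi A L"
    "\<And>x w. x \<in> carrier A \<Longrightarrow> w \<in> carrier M \<Longrightarrow> r w = p x \<Longrightarrow> \<phi> x = \<zeta> w"
proof -
  interpret p: group_hom A Q p by fact
  interpret r: group_hom M Q r by fact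
  interpret z: group_hom M L \<zeta> by fact
  have eq: "\<zeta> v = \<zeta> w" if "v \<in> carrier M" "w \<in> carrier M" "r v = r w" for v w
  proof -
    have "\<zeta> (v \<otimes>\<^bsub>M\<^esub> inv\<^bsub>M\<^esub> w) = \<one>\<^bsub>L\<^esub>" using that by (intro ker) auto
    then show ?thesis using that by (simp add: z.H.inv_solve_right')
  qed
  define \<phi> where "\<phi> x = \<zeta> (SOME w. w \<in> carrier M \<and> r w = p x)" for x
  have val: "\<phi> x = \<zeta> w" if "x \<in> carrier A" "w \<in> carrier M" "r w = p x" for x w
  proof -
    have "(SOME w. w \<in> carrier M \<and> r w = p x) \<in> carrier M \<and> r (SOME w. w \<in> carrier M \<and> r w = p x) = p x"
      by (rule someI[of _ w]) (use that in auto)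
    then show ?thesis unfolding \<phi>_def using that by (intro eq) auto
  qed
  have lift: "\<exists>w\<in>carrier M. r w = p x" if "x \<in> carrier A" for x
    using p_r that by (metis imageE imageI)
  have "\<phi> \<in> hom A L"
  proof (rule homI)
    fix x y assume xy: "x \<in> carrier A" "y \<in> carrier A"
    obtain v w where vw: "v \<in> carrier M" "r v = p x" "w \<in> carrier M" "r w = p y"
      using lift xy by meson
    then show "\<phi> x \<in> carrier L" using val[OF xy(1)] by simp
    show "\<phi> (x \<otimes>\<^bsub>A\<^esub> y) = \<phi> x \<otimes>\<^bsub>L\<^esub> \<phi> y"
      using val[OF xy(1)] val[OF xy(2)] val[of "x \<otimes>\<^bsub>A\<^esub> y" "v \<otimes>\<^bsub>M\<^esub> w"] xy vw by simp
  qed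
  moreover have "carrier L \<subseteq> \<phi> ` carrier A"
  proof
    fix l assume "l \<in> carrier L"
    then obtain w where "w \<in> carrier M" "l = \<zeta> w" using surj by auto
    moreover then obtain x where "x \<in> carrier A" "r w = p x" using p_r by (metis imageE imageI)
    ultimately show "l \<in> \<phi> ` carrier A" using val by force
  qed
  ultimately show thesis using val by (intro that[of \<phi>]) (auto simp: epi_iff_subset)
qed


section \<open>Non-abelian tensor products\<close>

context presentation
begin

lemma hom_extend_comp:
  assumes "group K" "group_hom K L h" "f \<in> X \<rightarrow> carrier K" "a \<in> carrier P"
  shows "h (hom_extend K f a) = hom_extend L (\<lambda>x. h (f x)) a"
proof -
  interpret h: group_hom K L h by fact
  have "over X w \<Longrightarrow> h (word_value K f w) = word_value L (\<lambda>x. h (f x)) w" for w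
  proof (induction w)
    case (Cons c w)
    have "word_value K f w \<in> carrier K" "f (snd c) \<in> carrier K"
      using Cons assms(3) by auto
    then show ?case using Cons by (cases c) auto
  qed simp
  then show ?thesis
    using class_of_letters(1)[OF assms(4)] by (simp add: hom_extend_word_value)
qed

lemma hom_extend_cong:
  assumes "\<And>x. x \<in> X \<Longrightarrow> f x = g x" "a \<in> carrier P"
  shows "hom_extend K f a = hom_extend K g a"
proof -
  have "over X w \<Longrightarrow> word_value K f w = word_value K g w" for w
    by (induction w) (use assms(1) in auto)
  then show ?thesis
    using class_of_letters(1)[OF assms(2)] by (simp add: hom_extend_word_value)
qed

end

declare tensor_power.simps(2) [simp del] diag_act.simps(2) [simp del]
  tensor_lambda.simps(2) [simp del]

text \<open>The two closure conditions are what makes the tensor relators words over the generators,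
  so that \<open>presentation\<close> applies.\<close>

locale tensor_pair =
  H: group H + K: group K
  for H K :: "'a uni monoid" and actH actK :: "'a uni \<Rightarrow> 'a uni \<Rightarrow> 'a uni" +
  assumes actH_closed: "x \<in> carrier H \<Longrightarrow> k \<in> carrier K \<Longrightarrow> actH x k \<in> carrier K"
    and actK_closed: "x \<in> carrier H \<Longrightarrow> k \<in> carrier K \<Longrightarrow> actK k x \<in> carrier H"
begin

sublocale presentation "tensor_gens H K" "tensor_rels H K actH actK"
  by unfold_locales (auto simp: tensor_rels_def tensor_gens_def actH_closed actK_closed)

abbreviation cl where "cl \<equiv> tensor_class H K actH actK"

lemma cl_eq: "cl x k = gen (Symb x k)"
  by (simp add: tensor_class_def)

lemma cl_closed [simp]: "x \<in> carrier H \<Longrightarrow> k \<in> carrier K \<Longrightarrow> cl x k \<in> carrier P"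
  unfolding cl_eq by (rule gen_closed) (auto simp: tensor_gens_def)

lemma generate_cl: "carrier P = generate P {cl x k | x k. x \<in> carrier H \<and> k \<in> carrier K}"
proof -
  have "gen ` tensor_gens H K = {cl x k | x k. x \<in> carrier H \<and> k \<in> carrier K}"
    by (auto simp: tensor_gens_def cl_eq)
  then show ?thesis using carrier_generate by simp
qed

lemma
  assumes L: "group L" and closed: "\<And>x k. x \<in> carrier H \<Longrightarrow> k \<in> carrier K \<Longrightarrow> \<phi> x k \<in> carrier L"
    and rel1: "\<And>x x' k. x \<in> carrier H \<Longrightarrow> x' \<in> carrier H \<Longrightarrow> k \<in> carrier K \<Longrightarrow>
      \<phi> (x \<otimes>\<^bsub>H\<^esub> x') k = \<phi> (conjugate H x x') (actH x k) \<otimes>\<^bsub>L\<^esub> \<phi> x k"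
    and rel2: "\<And>x k k'. x \<in> carrier H \<Longrightarrow> k \<in> carrier K \<Longrightarrow> k' \<in> carrier K \<Longrightarrow>
      \<phi> x (k \<otimes>\<^bsub>K\<^esub> k') = \<phi> x k \<otimes>\<^bsub>L\<^esub> \<phi> (actK k x) (conjugate K k k')"
  shows tensor_hom: "group_hom P L (hom_extend L (\<lambda>s. \<phi> (left s) (right s)))"
    and tensor_hom_cl: "x \<in> carrier H \<Longrightarrow> k \<in> carrier K \<Longrightarrow>
      hom_extend L (\<lambda>s. \<phi> (left s) (right s)) (cl x k) = \<phi> x k"
proof -
  interpret L: group L by fact
  have f: "(\<lambda>s. \<phi> (left s) (right s)) \<in> tensor_gens H K \<rightarrow> carrier L"
    by (auto simp: tensor_gens_def closed)
  have R: "word_value L (\<lambda>s. \<phi> (left s) (right s)) u = word_value L (\<lambda>s. \<phi> (left s) (right s)) v"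
    if "(u, v) \<in> tensor_rels H K actH actK" for u v
    using that unfolding tensor_rels_def
    by (auto simp: closed rel1 rel2 actH_closed actK_closed)
  show "group_hom P L (hom_extend L (\<lambda>s. \<phi> (left s) (right s)))"
    by (rule hom_extend_hom[OF L f R])
  show "hom_extend L (\<lambda>s. \<phi> (left s) (right s)) (cl x k) = \<phi> x k"
    if "x \<in> carrier H" "k \<in> carrier K"
    using hom_extend_gen[OF L f R, of "Symb x k"] that by (simp add: cl_eq tensor_gens_def)
qed

end

section \<open>Commutators that fall into \<open>B\<close>\<close>

context truncated_resolution
begin

lemma B_I: "x \<in> T F1 \<Longrightarrow> d0 x = \<one>\<^bsub>F0\<^esub> \<Longrightarrow> d1 x \<in> B T"
  by (auto simp: B_def)

text \<open>Normality is carried along \<open>d1\<close>, which is onto because \<open>s\<close> is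
  a section of it. Elements of \<open>B\<close> die under \<epsilon> since \<epsilon> equalises the
  two faces.\<close>

lemma
  assumes "functorial_normal T"
  shows B_normal: "B T \<lhd> F0" and eps_B: "b \<in> B T \<Longrightarrow> \<epsilon> b = \<one>\<^bsub>G\<^esub>"
proof -
  interpret T: functorial_normal T by fact
  interpret N: normal "T F1" F1 by (rule T.normal) (rule d0.G.group_axioms)
  let ?M = "{x \<in> T F1. d0 x = \<one>\<^bsub>F0\<^esub>}"
  have M: "subgroup ?M F1"
    by (rule d0.G.subgroupI) (auto intro!: exI[of _ "\<one>\<^bsub>F1\<^esub>"])
  have "?M \<lhd> F1"
    using M by (auto simp: d0.G.normal_inv_iff N.inv_op_closed2)
  moreover have "d1 ` carrier F1 = carrier F0"
  proof
    show "carrier F0 \<subseteq> d1 ` carrier F1"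
    proof
      fix a assume "a \<in> carrier F0"
      then show "a \<in> d1 ` carrier F1" by (intro image_eqI[of _ _ "s a"]) auto
    qed
  qed auto
  ultimately show "B T \<lhd> F0"
    unfolding B_def by (rule normal.surj_hom_normal_subgroup[OF _ d1.group_hom_axioms])
  show "\<epsilon> b = \<one>\<^bsub>G\<^esub>" if "b \<in> B T" using that by (auto simp: B_def simp flip: eps_d)
qed

lemma B_carrier: "B (\<lambda>K. carrier K) = {a \<in> carrier F0. \<epsilon> a = \<one>\<^bsub>G\<^esub>}"
proof (intro equalityI subsetI)
  fix a assume "a \<in> B (\<lambda>K. carrier K)"
  then show "a \<in> {a \<in> carrier F0. \<epsilon> a = \<one>\<^bsub>G\<^esub>}" by (auto simp: B_def simp flip: eps_d)
next
  fix a assume "a \<in> {a \<in> carrier F0. \<epsilon> a = \<one>\<^bsub>G\<^esub>}"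
  then show "a \<in> B (\<lambda>K. carrier K)" using exact0[of a] by (auto simp: B_def)
qed

abbreviation \<gamma> :: "nat \<Rightarrow> 'a monoid \<Rightarrow> 'a set" where
  "\<gamma> n K \<equiv> lower_central K (Suc n)"

lemma
  shows gamma_subset: "\<gamma> n F0 \<subseteq> carrier F0" "\<gamma> n F1 \<subseteq> carrier F1"
    and s_gamma: "a \<in> \<gamma> n F0 \<Longrightarrow> s a \<in> \<gamma> n F1"
  using \<epsilon>.G.lower_central_normal[of n] d0.G.lower_central_normal[of n]
    functorial_normal.hom_mem[OF functorial_lower_central s.group_hom_axioms]
  by (auto dest: normal_imp_subgroup subgroup.subset)

text \<open>The witness in \<open>F1\<close> is the commutator of a preimage of \<open>b\<close> in
  ker \<open>d0\<close> with the degenerate \<open>s f\<close>: \<open>d0\<close> makes its first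
  entry trivial, and \<open>d1\<close> gives back both entries.\<close>

lemma B_gamma_commutator:
  assumes "b \<in> B (\<gamma> n)" "f \<in> carrier F0"
  shows "commutator F0 b f \<in> B (\<gamma> (Suc n))"
proof -
  obtain x where x: "x \<in> \<gamma> n F1" "d0 x = \<one>\<^bsub>F0\<^esub>" "b = d1 x" using assms(1) by (auto simp: B_def)
  have "x \<in> carrier F1" using x(1) gamma_subset by blast
  then show ?thesis
    using x assms(2) B_I[of "commutator F1 x (s f)" "\<gamma> (Suc n)"]
    by (simp add: d0.hom_commutator d1.hom_commutator d0.G.commutator_mem_subgroup lower_central_Suc)
       (simp add: commutator_def)
qed

text \<open>The entries exchange roles: \<open>r\<close> is lifted into ker \<open>d0\<close> by
  \<open>exact0\<close>, and \<open>a\<close> becomes the degenerate \<open>s a\<close>, which stays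
  in the series, so the commutator lies in the next term.\<close>

lemma gamma_commutator_kernel:
  assumes "a \<in> \<gamma> n F0" "r \<in> carrier F0" "\<epsilon> r = \<one>\<^bsub>G\<^esub>"
  shows "commutator F0 a r \<in> B (\<gamma> (Suc n))"
proof -
  obtain x where x: "x \<in> carrier F1" "d0 x = \<one>\<^bsub>F0\<^esub>" "r = d1 x" using exact0[OF assms(2,3)] by auto
  have a: "a \<in> carrier F0" using assms(1) gamma_subset by blast
  then show ?thesis
    using x assms(1) s_gamma B_I[of "commutator F1 (s a) x" "\<gamma> (Suc n)"]
    by (simp add: d0.hom_commutator d1.hom_commutator d0.G.commutator_mem_subgroup lower_central_Suc)
       (simp add: commutator_def)
qed

end

section \<open>The tensor powers as quotients of the lower central series\<close>

locale tensor_resolution =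
  truncated_resolution G F0 F1 F2 \<epsilon> d0 d1 e0 e1 e2 s t0 t1
  for G F0 F1 F2 :: "'a uni monoid" and \<epsilon> d0 d1 e0 e1 e2 s t0 t1
begin

abbreviation T where "T n \<equiv> tensor_power G (Suc n)"
abbreviation lam where "lam n \<equiv> tensor_lambda G (Suc n)"
abbreviation act where "act n \<equiv> diag_act G (Suc n)"
definition Q where "Q n = F0 Mod B (\<gamma> n)"
definition q where "q n a = B (\<gamma> n) #>\<^bsub>F0\<^esub> a"

lemma T_pair:
  assumes "group (T n)" "\<And>x. x \<in> carrier (T n) \<Longrightarrow> lam n x \<in> carrier G"
    and "\<And>g x. g \<in> carrier G \<Longrightarrow> x \<in> carrier (T n) \<Longrightarrow> act n g x \<in> carrier (T n)"
  shows "tensor_pair (T n) G (\<lambda>x g. conjugate G (lam n x) g) (act n)"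
  using assms by (intro tensor_pair.intro tensor_pair_axioms.intro \<epsilon>.H.group_axioms) auto

abbreviation cl where
  "cl n \<equiv> tensor_class (T n) G (\<lambda>x g. conjugate G (lam n x) g) (act n)"

lemma
  shows T_Suc: "T (Suc n) = presented_group (tensor_gens (T n) G)
      (tensor_rels (T n) G (\<lambda>x g. conjugate G (lam n x) g) (act n))"
    and lam_Suc: "lam (Suc n) = hom_extend G (\<lambda>s. commutator G (lam n (left s)) (right s))"
    and act_Suc: "act (Suc n) g = hom_extend (T (Suc n))
      (\<lambda>s. cl n (act n g (left s)) (conjugate G g (right s)))"
  by (simp_all add: tensor_product_def tensor_power.simps(2) tensor_lambda.simps(2) diag_act.simps(2))

text \<open>The three claims go together: the relators of the next power are words over its
  generators only if \<open>lam\<close> and \<open>act\<close> have values in the right carriers. At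
  this point neither map is known to respect relations, so \<open>hom_extend_closed\<close> is the
  tool.\<close>

lemma T_closed:
  "group (T n) \<and> (\<forall>x\<in>carrier (T n). lam n x \<in> carrier G) \<and>
    (\<forall>g\<in>carrier G. \<forall>x\<in>carrier (T n). act n g x \<in> carrier (T n))"
proof (induction n)
  case (Suc n)
  interpret t: tensor_pair "T n" G "\<lambda>x g. conjugate G (lam n x) g" "act n"
    using Suc by (intro T_pair) auto
  have f: "(\<lambda>s. commutator G (lam n (left s)) (right s)) \<in> tensor_gens (T n) G \<rightarrow> carrier G"
    using Suc by (auto simp: tensor_gens_def)
  have g: "(\<lambda>s. cl n (act n g (left s)) (conjugate G g (right s))) \<in> tensor_gens (T n) G \<rightarrow> carrier t.P"
    if "g \<in> carrier G" for g
  proof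
    fix s assume "s \<in> tensor_gens (T n) G"
    then obtain x k where "s = Symb x k" "x \<in> carrier (T n)" "k \<in> carrier G"
      by (auto simp: tensor_gens_def)
    then show "cl n (act n g (left s)) (conjugate G g (right s)) \<in> carrier t.P"
      using Suc that t.cl_closed by simp
  qed
  show ?case
    using t.group_P t.hom_extend_closed[OF \<epsilon>.H.group_axioms f] t.hom_extend_closed[OF t.group_P g]
    unfolding T_Suc lam_Suc act_Suc by blast
qed simp

lemma act_closed: "g \<in> carrier G \<Longrightarrow> x \<in> carrier (T n) \<Longrightarrow> act n g x \<in> carrier (T n)"
  using T_closed by blast

lemma T_pair': "tensor_pair (T n) G (\<lambda>x g. conjugate G (lam n x) g) (act n)"
  using T_closed act_closed by (intro T_pair) auto

lemma T_cl_closed: "x \<in> carrier (T n) \<Longrightarrow> g \<in> carrier G \<Longrightarrow> cl n x g \<in> carrier (T (Suc n))"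
  unfolding T_Suc by (rule tensor_pair.cl_closed[OF T_pair'])

lemma T_generate:
  "carrier (T (Suc n)) = generate (T (Suc n)) {cl n x g | x g. x \<in> carrier (T n) \<and> g \<in> carrier G}"
  unfolding T_Suc by (rule tensor_pair.generate_cl[OF T_pair'])

text \<open>The action is evaluated on the letters of the chosen word, and \<open>h\<close> is
  pushed through the fold by \<open>hom_extend_comp\<close>, which asks nothing of the relations.
  Equivariance of both \<lambda> and \<theta> comes from this.\<close>

lemma act_Suc_image:
  assumes h: "group_hom (T (Suc n)) K h" and \<phi>: "\<phi> \<in> tensor_gens (T n) G \<rightarrow> carrier K"
    and c: "c \<in> carrier K" and g: "g \<in> carrier G" and x: "x \<in> carrier (T (Suc n))"
    and h_cl: "\<And>y k. y \<in> carrier (T n) \<Longrightarrow> k \<in> carrier G \<Longrightarrow>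
      h (cl n (act n g y) (conjugate G g k)) = conjugate K c (\<phi> (Symb y k))"
    and h_ext: "h x = hom_extend K \<phi> x"
  shows "h (act (Suc n) g x) = conjugate K c (h x)"
proof -
  interpret t: tensor_pair "T n" G "\<lambda>x g. conjugate G (lam n x) g" "act n"
    by (rule T_pair')
  interpret h: group_hom "T (Suc n)" K h by (rule h)
  let ?f = "\<lambda>s. cl n (act n g (left s)) (conjugate G g (right s))"
  have x': "x \<in> carrier t.P" using x unfolding T_Suc .
  have f: "?f \<in> tensor_gens (T n) G \<rightarrow> carrier (T (Suc n))"
  proof
    fix s assume "s \<in> tensor_gens (T n) G"
    then show "?f s \<in> carrier (T (Suc n))"
      using g by (auto simp: tensor_gens_def intro!: T_cl_closed act_closed)
  qed
  have "h (act (Suc n) g x) = hom_extend K (\<lambda>s. h (?f s)) x"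
    unfolding act_Suc by (rule t.hom_extend_comp[OF h.G.group_axioms h f x'])
  also have "\<dots> = hom_extend K (\<lambda>s. conjugate K c (\<phi> s)) x"
    by (rule t.hom_extend_cong[OF _ x']) (auto simp: tensor_gens_def h_cl)
  also have "\<dots> = conjugate K c (hom_extend K \<phi> x)"
  proof (rule t.hom_extend_comp[symmetric, OF h.H.group_axioms _ \<phi> x'])
    show "group_hom K K (conjugate K c)"
      using c by (intro group_homI homI h.H.group_axioms) (auto simp: h.H.conjugate_mult)
  qed
  finally show ?thesis by (simp add: h_ext)
qed

lemma lam_step:
  assumes "group_hom (T n) G (lam n)"
    and eq: "\<And>g x. g \<in> carrier G \<Longrightarrow> x \<in> carrier (T n) \<Longrightarrow> lam n (act n g x) = conjugate G g (lam n x)"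
  shows "group_hom (T (Suc n)) G (lam (Suc n))"
    and "x \<in> carrier (T n) \<Longrightarrow> k \<in> carrier G \<Longrightarrow> lam (Suc n) (cl n x k) = commutator G (lam n x) k"
proof -
  interpret t: tensor_pair "T n" G "\<lambda>x g. conjugate G (lam n x) g" "act n"
    by (rule T_pair')
  interpret l: group_hom "T n" G "lam n" by fact
  have rel1: "commutator G (lam n (x \<otimes>\<^bsub>T n\<^esub> x')) k
      = commutator G (lam n (conjugate (T n) x x')) (conjugate G (lam n x) k)
        \<otimes>\<^bsub>G\<^esub> commutator G (lam n x) k"
    if "x \<in> carrier (T n)" "x' \<in> carrier (T n)" "k \<in> carrier G" for x x' k
    using that by (simp add: l.hom_conjugate \<epsilon>.H.commutator_mult_left)
  have rel2: "commutator G (lam n x) (k \<otimes>\<^bsub>G\<^esub> k')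
      = commutator G (lam n x) k \<otimes>\<^bsub>G\<^esub> commutator G (lam n (act n k x)) (conjugate G k k')"
    if "x \<in> carrier (T n)" "k \<in> carrier G" "k' \<in> carrier G" for x k k'
    using that by (simp add: eq \<epsilon>.H.commutator_mult_right)
  have closed: "commutator G (lam n x) k \<in> carrier G" if "x \<in> carrier (T n)" "k \<in> carrier G" for x k
    using that by simp
  show "group_hom (T (Suc n)) G (lam (Suc n))"
    unfolding T_Suc lam_Suc
    by (rule t.tensor_hom[where \<phi> = "\<lambda>x k. commutator G (lam n x) k", OF \<epsilon>.H.group_axioms closed rel1 rel2])
  show "x \<in> carrier (T n) \<Longrightarrow> k \<in> carrier G \<Longrightarrow> lam (Suc n) (cl n x k) = commutator G (lam n x) k"
    unfolding lam_Suc
    by (rule t.tensor_hom_cl[where \<phi> = "\<lambda>x k. commutator G (lam n x) k", OF \<epsilon>.H.group_axioms closed rel1 rel2])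
qed

text \<open>Both properties are proved in one induction, because respecting the second tensor
  relation in degree n + 1 uses equivariance in degree n.\<close>

lemma lam_hom_act:
  "group_hom (T n) G (lam n) \<and>
    (\<forall>g\<in>carrier G. \<forall>x\<in>carrier (T n). lam n (act n g x) = conjugate G g (lam n x))"
proof (induction n)
  case 0
  show ?case using id_group_hom[OF \<epsilon>.H.group_axioms] by simp
next
  case (Suc n)
  then interpret l: group_hom "T n" G "lam n" by simp
  have eq: "lam n (act n g x) = conjugate G g (lam n x)" if "g \<in> carrier G" "x \<in> carrier (T n)" for g x
    using Suc that by blast
  note step = lam_step[OF l.group_hom_axioms eq]
  have "lam (Suc n) (act (Suc n) g x) = conjugate G g (lam (Suc n) x)"
    if "g \<in> carrier G" "x \<in> carrier (T (Suc n))" for g x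
  proof (rule act_Suc_image[OF step(1) _ that(1) that])
    show "(\<lambda>s. commutator G (lam n (left s)) (right s)) \<in> tensor_gens (T n) G \<rightarrow> carrier G"
      by (auto simp: tensor_gens_def)
    show "lam (Suc n) (cl n (act n g y) (conjugate G g k))
        = conjugate G g (commutator G (lam n (left (Symb y k))) (right (Symb y k)))"
      if "y \<in> carrier (T n)" "k \<in> carrier G" for y k
      using that \<open>g \<in> carrier G\<close> step(2) act_closed eq by (simp add: \<epsilon>.H.conjugate_commutator)
  qed (simp_all add: lam_Suc)
  then show ?case using step(1) by blast
qed

lemma lam_hom: "group_hom (T n) G (lam n)"
  using lam_hom_act by blast

lemma lam_cl:
  "x \<in> carrier (T n) \<Longrightarrow> k \<in> carrier G \<Longrightarrow> lam (Suc n) (cl n x k) = commutator G (lam n x) k"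
  using lam_step(2) lam_hom_act by blast

lemma q_hom: "group_hom F0 (Q n) (q n)"
  using normal.quotient_hom[OF B_normal[OF functorial_lower_central]]  by (simp add: Q_def q_def [abs_def])

lemma q_one_iff: "a \<in> carrier F0 \<Longrightarrow> q n a = \<one>\<^bsub>Q n\<^esub> \<longleftrightarrow> a \<in> B (\<gamma> n)"
  using normal.coset_eq_self_iff[OF B_normal[OF functorial_lower_central]] by (simp add: Q_def q_def)

lemma q_eq_iff:
  "a \<in> carrier F0 \<Longrightarrow> b \<in> carrier F0 \<Longrightarrow> q n a = q n b \<longleftrightarrow> a \<otimes>\<^bsub>F0\<^esub> inv\<^bsub>F0\<^esub> b \<in> B (\<gamma> n)"
  unfolding q_def by (rule normal.coset_eq_iff[OF B_normal[OF functorial_lower_central]])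

lemma q_eps: "a \<in> carrier F0 \<Longrightarrow> b \<in> carrier F0 \<Longrightarrow> q n a = q n b \<Longrightarrow> \<epsilon> a = \<epsilon> b"
  using eps_B[OF functorial_lower_central, of "a \<otimes>\<^bsub>F0\<^esub> inv\<^bsub>F0\<^esub> b"]
  by (simp add: q_eq_iff \<epsilon>.H.inv_solve_right')

text \<open>Another choice of \<open>a\<close> differs by an element of \<open>B\<close>, whose
  commutators are absorbed by \<open>B_gamma_commutator\<close>; another choice of \<open>f\<close>
  differs by an element of ker \<epsilon>, absorbed by
  \<open>gamma_commutator_kernel\<close>.\<close>

lemma q_commutator:
  assumes "a \<in> \<gamma> n F0" "a' \<in> \<gamma> n F0" "q n a = q n a'"
    and "f \<in> carrier F0" "f' \<in> carrier F0" "\<epsilon> f = \<epsilon> f'"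
  shows "q (Suc n) (commutator F0 a f) = q (Suc n) (commutator F0 a' f')"
proof -
  interpret q: group_hom F0 "Q (Suc n)" "q (Suc n)" by (rule q_hom)
  \<comment> \<open>\<open>b\<close> is split off on the left of \<open>a\<close> and
    \<open>r\<close> on the right of \<open>f\<close>, as \<open>commutator_central_left\<close> and
    \<open>commutator_right\<close> require.\<close>
  define b where "b = a \<otimes>\<^bsub>F0\<^esub> inv\<^bsub>F0\<^esub> a'"
  define r where "r = inv\<^bsub>F0\<^esub> f' \<otimes>\<^bsub>F0\<^esub> f"
  have aa: "a \<in> carrier F0" "a' \<in> carrier F0" using assms gamma_subset by blast+
  have b: "b \<in> B (\<gamma> n)" "b \<in> carrier F0" "a = b \<otimes>\<^bsub>F0\<^esub> a'"
    using assms aa by (simp_all add: b_def \<epsilon>.G.m_assoc flip: q_eq_iff)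
  have r: "r \<in> carrier F0" "\<epsilon> r = \<one>\<^bsub>G\<^esub>" "f = f' \<otimes>\<^bsub>F0\<^esub> r"
    using assms by (simp_all add: r_def)
  have "commutator (Q (Suc n)) (q (Suc n) b) (q (Suc n) x) = \<one>\<^bsub>Q (Suc n)\<^esub>"
    if "x \<in> carrier F0" for x
    using B_gamma_commutator[OF b(1) that] b(2) that by (simp add: q_one_iff flip: q.hom_commutator)
  then have "q (Suc n) (commutator F0 a f)
      = commutator (Q (Suc n)) (q (Suc n) a') (q (Suc n) f)"
    using aa b(2,3) assms(4) q.H.commutator_central_left[of "q (Suc n) b" "q (Suc n) a'" "q (Suc n) f"]
    by (simp add: q.hom_commutator)
  also have "\<dots> = q (Suc n) (commutator F0 a' f)"
    using aa assms by (simp add: q.hom_commutator)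
  also have "\<dots> = q (Suc n) (commutator F0 a' f')"
  proof -
    have "commutator (Q (Suc n)) (q (Suc n) a') (q (Suc n) r) = \<one>\<^bsub>Q (Suc n)\<^esub>"
      using gamma_commutator_kernel[OF assms(2) r(1,2)] aa r(1)
      by (simp add: q_one_iff flip: q.hom_commutator)
    then show ?thesis
      using aa r assms(5) q.H.commutator_right[of "q (Suc n) a'" "q (Suc n) f'" "q (Suc n) r"]
      by (simp add: q.hom_commutator)
  qed
  finally show ?thesis .
qed

text \<open>\<open>\<theta>\<close> sends an iterated tensor to the class of the iterated commutator of lifts.\<close>

definition is_theta :: "nat \<Rightarrow> ('a uni \<Rightarrow> 'a uni set) \<Rightarrow> bool" where
  "is_theta n \<theta> \<longleftrightarrow> group_hom (T n) (Q n) \<theta> \<and>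
    (\<forall>x\<in>carrier (T n). \<exists>a\<in>\<gamma> n F0. \<theta> x = q n a \<and> \<epsilon> a = lam n x) \<and>
    (\<forall>a\<in>\<gamma> n F0. \<exists>x\<in>carrier (T n). \<theta> x = q n a) \<and>
    (\<forall>x\<in>carrier (T n). \<forall>f\<in>carrier F0. \<theta> (act n (\<epsilon> f) x) = conjugate (Q n) (q n f) (\<theta> x))"

text \<open>In degree 0, \<open>B\<close> is ker \<epsilon>, so \<theta> is the inverse of the
  isomorphism from \<open>F0\<close> modulo ker \<epsilon> to \<open>G\<close>, written with chosen
  lifts.\<close>

lemma theta_0: "\<exists>\<theta>. is_theta 0 \<theta>"
proof -
  define l where "l g = (SOME a. a \<in> carrier F0 \<and> \<epsilon> a = g)" for g
  have l: "l g \<in> carrier F0 \<and> \<epsilon> (l g) = g" if g: "g \<in> carrier G" for g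
  proof -
    obtain a where "a \<in> carrier F0" "\<epsilon> a = g" using g eps_surj by (metis imageE)
    then show ?thesis unfolding l_def by (intro someI[of "\<lambda>a. a \<in> carrier F0 \<and> \<epsilon> a = g" a]) simp
  qed
  interpret q: group_hom F0 "Q 0" "q 0" by (rule q_hom)
  have q: "q 0 a = q 0 b" if "a \<in> carrier F0" "b \<in> carrier F0" "\<epsilon> a = \<epsilon> b" for a b
    using that by (simp add: q_eq_iff B_carrier lower_central_Suc)
  let ?t = "\<lambda>g. q 0 (l g)"
  have t: "?t g = q 0 a" if "a \<in> carrier F0" "\<epsilon> a = g" for a g
    using that l[of g] by (intro q) auto
  have hom: "group_hom G (Q 0) ?t"
  proof (intro group_homI \<epsilon>.H.group_axioms q.H.group_axioms homI)
    fix x y assume "x \<in> carrier G" "y \<in> carrier G"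
    then show "?t (x \<otimes>\<^bsub>G\<^esub> y) = ?t x \<otimes>\<^bsub>Q 0\<^esub> ?t y"
      using l t[of "l x \<otimes>\<^bsub>F0\<^esub> l y"] by simp
  qed (use l q.hom_closed in auto)
  have "?t (conjugate G (\<epsilon> f) x) = conjugate (Q 0) (q 0 f) (?t x)"
    if "x \<in> carrier G" "f \<in> carrier F0" for x f
    using that l t[of "conjugate F0 f (l x)"] by (simp add: \<epsilon>.hom_conjugate q.hom_conjugate)
  then have "is_theta 0 ?t"
    unfolding is_theta_def lower_central_Suc tensor_power.simps(1) tensor_lambda.simps(1) diag_act.simps(1)
  proof (intro conjI ballI)
    show "\<exists>a\<in>carrier F0. ?t x = q 0 a \<and> \<epsilon> a = x" if "x \<in> carrier G" for x
      using l[OF that] by (intro bexI[of _ "l x"]) simp_all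
    show "\<exists>x\<in>carrier G. ?t x = q 0 a" if "a \<in> carrier F0" for a
      using t[OF that HOL.refl] that by (intro bexI[of _ "\<epsilon> a"]) simp_all
  qed (rule hom)
  then show ?thesis by blast
qed

text \<open>With lifts to \<open>F0\<close>, the two tensor relations become the two commutator
  identities for products. The clauses of \<open>is_theta\<close> provide lifts of all acted-on
  entries: the value of \<epsilon> on a lift handles the action of a tensor on \<open>G\<close>, and
  equivariance handles the action of \<open>G\<close> on tensors.\<close>

lemma theta_Suc:
  assumes "is_theta n \<theta>" shows "\<exists>\<theta>'. is_theta (Suc n) \<theta>'"
proof -
  interpret t: tensor_pair "T n" G "\<lambda>x g. conjugate G (lam n x) g" "act n" by (rule T_pair')
  interpret l: group_hom "T n" G "lam n" by (rule lam_hom)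
  interpret l': group_hom "T (Suc n)" G "lam (Suc n)" by (rule lam_hom)
  interpret qn: group_hom F0 "Q n" "q n" by (rule q_hom)
  interpret q: group_hom F0 "Q (Suc n)" "q (Suc n)" by (rule q_hom)
  interpret \<theta>: group_hom "T n" "Q n" \<theta> using assms by (simp add: is_theta_def)
  have lift: "\<exists>a\<in>\<gamma> n F0. \<theta> x = q n a \<and> \<epsilon> a = lam n x" if "x \<in> carrier (T n)" for x
    using assms that unfolding is_theta_def by blast
  have surj: "\<exists>x\<in>carrier (T n). \<theta> x = q n a" if "a \<in> \<gamma> n F0" for a
    using assms that unfolding is_theta_def by blast
  have equi: "\<theta> (act n (\<epsilon> f) x) = conjugate (Q n) (q n f) (\<theta> x)"
    if "x \<in> carrier (T n)" "f \<in> carrier F0" for x f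
    using assms that unfolding is_theta_def by blast
  have eps_lift: "\<exists>f\<in>carrier F0. \<epsilon> f = g" if "g \<in> carrier G" for g
    using eps_surj that by (metis imageE)
  note N = \<epsilon>.G.lower_central_normal[of n]
  have sub: "a \<in> carrier F0" if "a \<in> \<gamma> n F0" for a using gamma_subset that by blast
  define \<phi> where "\<phi> x g = q (Suc n) (commutator F0
    (SOME a. a \<in> \<gamma> n F0 \<and> \<theta> x = q n a) (SOME f. f \<in> carrier F0 \<and> \<epsilon> f = g))" for x g
  have phi: "\<phi> x g = q (Suc n) (commutator F0 a f)"
    if "a \<in> \<gamma> n F0" "\<theta> x = q n a" "f \<in> carrier F0" "\<epsilon> f = g" for x g a f
  proof -
    have 1: "(SOME a. a \<in> \<gamma> n F0 \<and> \<theta> x = q n a) \<in> \<gamma> n F0 \<and> \<theta> x = q n (SOME a. a \<in> \<gamma> n F0 \<and> \<theta> x = q n a)"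
      by (rule someI[of _ a]) (use that in auto)
    have 2: "(SOME f. f \<in> carrier F0 \<and> \<epsilon> f = g) \<in> carrier F0 \<and> \<epsilon> (SOME f. f \<in> carrier F0 \<and> \<epsilon> f = g) = g"
      by (rule someI[of _ f]) (use that in auto)
    show ?thesis unfolding \<phi>_def by (rule q_commutator) (use 1 2 that in auto)
  qed
  have closed: "\<phi> x g \<in> carrier (Q (Suc n))" if x: "x \<in> carrier (T n)" and g: "g \<in> carrier G" for x g
  proof -
    obtain a f where "a \<in> \<gamma> n F0" "\<theta> x = q n a" "f \<in> carrier F0" "\<epsilon> f = g"
      using lift[OF x] eps_lift[OF g] by blast
    then show ?thesis using phi sub by simp
  qed
  have rel1: "\<phi> (x \<otimes>\<^bsub>T n\<^esub> x') g
      = \<phi> (conjugate (T n) x x') (conjugate G (lam n x) g) \<otimes>\<^bsub>Q (Suc n)\<^esub> \<phi> x g"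
    if x: "x \<in> carrier (T n)" "x' \<in> carrier (T n)" and g: "g \<in> carrier G" for x x' g
  proof -
    obtain a a' f where a: "a \<in> \<gamma> n F0" "\<theta> x = q n a" "\<epsilon> a = lam n x"
      and a': "a' \<in> \<gamma> n F0" "\<theta> x' = q n a'" and f: "f \<in> carrier F0" "\<epsilon> f = g"
      using lift[OF x(1)] lift[OF x(2)] eps_lift[OF g] by blast
    note c = sub[OF a(1)] sub[OF a'(1)] f(1)
    have "\<phi> (x \<otimes>\<^bsub>T n\<^esub> x') g = q (Suc n) (commutator F0 (a \<otimes>\<^bsub>F0\<^esub> a') f)"
      using a a' f x c N by (intro phi) (auto intro: subgroup.m_closed dest: normal_imp_subgroup)
    \<comment> \<open>Because \<open>\<epsilon> a = lam n x\<close>, the element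
      \<open>conjugate F0 a f\<close> lifts the acted-on entry
      \<open>conjugate G (lam n x) g\<close>.\<close>
    moreover have "\<phi> (conjugate (T n) x x') (conjugate G (lam n x) g)
        = q (Suc n) (commutator F0 (conjugate F0 a a') (conjugate F0 a f))"
      using a a' f x c N
      by (intro phi) (auto simp: \<theta>.hom_conjugate qn.hom_conjugate \<epsilon>.hom_conjugate \<epsilon>.G.normal_conjugate)
    moreover have "\<phi> x g = q (Suc n) (commutator F0 a f)" using a f by (intro phi)
    ultimately show ?thesis using c by (simp add: \<epsilon>.G.commutator_mult_left)
  qed
  have rel2: "\<phi> x (g \<otimes>\<^bsub>G\<^esub> g') = \<phi> x g \<otimes>\<^bsub>Q (Suc n)\<^esub> \<phi> (act n g x) (conjugate G g g')"
    if x: "x \<in> carrier (T n)" and g: "g \<in> carrier G" "g' \<in> carrier G" for x g g'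
  proof -
    obtain a f f' where a: "a \<in> \<gamma> n F0" "\<theta> x = q n a"
      and f: "f \<in> carrier F0" "\<epsilon> f = g" "f' \<in> carrier F0" "\<epsilon> f' = g'"
      using lift[OF x] eps_lift[OF g(1)] eps_lift[OF g(2)] by blast
    note c = sub[OF a(1)] f(1,3)
    have "\<phi> x (g \<otimes>\<^bsub>G\<^esub> g') = q (Suc n) (commutator F0 a (f \<otimes>\<^bsub>F0\<^esub> f'))"
      using a f by (intro phi) auto
    \<comment> \<open>Equivariance says that \<open>conjugate F0 f a\<close> represents \<theta> of
      \<open>act n g x\<close>.\<close>
    moreover have "\<phi> (act n g x) (conjugate G g g')
        = q (Suc n) (commutator F0 (conjugate F0 f a) (conjugate F0 f f'))"
      using a f x c N equi[OF x f(1)]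
      by (intro phi) (auto simp: qn.hom_conjugate \<epsilon>.hom_conjugate \<epsilon>.G.normal_conjugate)
    moreover have "\<phi> x g = q (Suc n) (commutator F0 a f)" using a f by (intro phi)
    ultimately show ?thesis using c by (simp add: \<epsilon>.G.commutator_mult_right)
  qed
  define \<theta>' where "\<theta>' = hom_extend (Q (Suc n)) (\<lambda>s. \<phi> (left s) (right s))"
  have cl: "\<theta>' (cl n x g) = \<phi> x g" if "x \<in> carrier (T n)" "g \<in> carrier G" for x g
    unfolding \<theta>'_def by (rule t.tensor_hom_cl[OF q.H.group_axioms closed rel1 rel2 that])
  have hom: "group_hom (T (Suc n)) (Q (Suc n)) \<theta>'"
    unfolding \<theta>'_def T_Suc by (rule t.tensor_hom[OF q.H.group_axioms closed rel1 rel2])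
  interpret \<theta>': group_hom "T (Suc n)" "Q (Suc n)" \<theta>' by (rule hom)
  interpret N': normal "\<gamma> (Suc n) F0" F0 by (rule \<epsilon>.G.lower_central_normal)
  have val: "\<exists>a\<in>\<gamma> (Suc n) F0. \<theta>' x = q (Suc n) a \<and> \<epsilon> a = lam (Suc n) x"
    if "x \<in> carrier (T (Suc n))" for x
  proof -
    \<comment> \<open>One and the same lift has to represent the value of \<theta>' and map to
      \<open>lam\<close> under \<epsilon>. This joint property is closed under products and
      inverses, so generators suffice.\<close>
    have gen: "\<exists>a\<in>\<gamma> (Suc n) F0. \<theta>' (cl n y g) = q (Suc n) a \<and> \<epsilon> a = lam (Suc n) (cl n y g)"
      if y: "y \<in> carrier (T n)" and g: "g \<in> carrier G" for y g
    proof -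
      obtain a f where a: "a \<in> \<gamma> n F0" "\<theta> y = q n a" "\<epsilon> a = lam n y" and f: "f \<in> carrier F0" "\<epsilon> f = g"
        using lift[OF y] eps_lift[OF g] by blast
      then show ?thesis
        using y g sub[OF a(1)] cl phi
        by (intro bexI[of _ "commutator F0 a f"])
           (auto simp: lam_cl \<epsilon>.hom_commutator lower_central_Suc \<epsilon>.G.commutator_mem_subgroup)
    qed
    have "x \<in> generate (T (Suc n)) {cl n x g | x g. x \<in> carrier (T n) \<and> g \<in> carrier G}"
      using that T_generate by simp
    then have "x \<in> carrier (T (Suc n)) \<and> ?thesis"
    proof induct
      case one
      show ?case by (auto intro!: bexI[of _ "\<one>\<^bsub>F0\<^esub>"])
    next
      case (incl h)
      then show ?case using gen T_cl_closed by blast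
    next
      case (inv h)
      then obtain y g where yg: "h = cl n y g" "y \<in> carrier (T n)" "g \<in> carrier G" by blast
      obtain a where "a \<in> \<gamma> (Suc n) F0" "\<theta>' h = q (Suc n) a" "\<epsilon> a = lam (Suc n) h"
        using gen[OF yg(2,3)] yg(1) by blast
      then show ?case using yg T_cl_closed[OF yg(2,3)]
        by (auto intro!: bexI[of _ "inv\<^bsub>F0\<^esub> a"])
    next
      case (eng h1 h2)
      then obtain a1 a2 where "a1 \<in> \<gamma> (Suc n) F0" "\<theta>' h1 = q (Suc n) a1" "\<epsilon> a1 = lam (Suc n) h1"
        "a2 \<in> \<gamma> (Suc n) F0" "\<theta>' h2 = q (Suc n) a2" "\<epsilon> a2 = lam (Suc n) h2" by blast
      then show ?case using eng by (auto intro!: bexI[of _ "a1 \<otimes>\<^bsub>F0\<^esub> a2"])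
    qed
    then show ?thesis by simp
  qed
  moreover have "\<exists>x\<in>carrier (T (Suc n)). \<theta>' x = q (Suc n) a" if "a \<in> \<gamma> (Suc n) F0" for a
  proof -
    have gen: "\<exists>x\<in>carrier (T (Suc n)). \<theta>' x = q (Suc n) (commutator F0 a f)"
      if "a \<in> \<gamma> n F0" "f \<in> carrier F0" for a f
    proof -
      obtain x where x: "x \<in> carrier (T n)" "\<theta> x = q n a" using surj[OF \<open>a \<in> \<gamma> n F0\<close>] by blast
      then show ?thesis
        using that cl[of x "\<epsilon> f"] phi[OF that(1) x(2) that(2)] T_cl_closed[of x n "\<epsilon> f"] by auto
    qed
    have "a \<in> generate F0 {commutator F0 a b |a b. a \<in> \<gamma> n F0 \<and> b \<in> carrier F0}"
      using that by (simp add: lower_central_Suc commutator_subgroup_def)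
    then have "a \<in> carrier F0 \<and> ?thesis"
    proof induct
      case one
      show ?case by (auto intro!: bexI[of _ "\<one>\<^bsub>T (Suc n)\<^esub>"])
    next
      case (incl h)
      then show ?case using gen sub by blast
    next
      case (inv h)
      then obtain b f where bf: "h = commutator F0 b f" "b \<in> \<gamma> n F0" "f \<in> carrier F0" by blast
      obtain x where "x \<in> carrier (T (Suc n))" "\<theta>' x = q (Suc n) h"
        using gen[OF bf(2,3)] bf(1) by blast
      then show ?case using bf sub[OF bf(2)] by (auto intro!: bexI[of _ "inv\<^bsub>T (Suc n)\<^esub> x"])
    next
      case (eng h1 h2)
      then obtain x1 x2 where "x1 \<in> carrier (T (Suc n))" "\<theta>' x1 = q (Suc n) h1"
        "x2 \<in> carrier (T (Suc n))" "\<theta>' x2 = q (Suc n) h2" by blast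
      then show ?case using eng by (auto intro!: bexI[of _ "x1 \<otimes>\<^bsub>T (Suc n)\<^esub> x2"])
    qed
    then show ?thesis by simp
  qed
  moreover have "\<theta>' (act (Suc n) (\<epsilon> f) x) = conjugate (Q (Suc n)) (q (Suc n) f) (\<theta>' x)"
    if "x \<in> carrier (T (Suc n))" "f \<in> carrier F0" for x f
  proof (rule act_Suc_image[OF hom])
    show "(\<lambda>s. \<phi> (left s) (right s)) \<in> tensor_gens (T n) G \<rightarrow> carrier (Q (Suc n))"
      by (auto simp: tensor_gens_def closed)
    show "q (Suc n) f \<in> carrier (Q (Suc n))" "\<epsilon> f \<in> carrier G" "x \<in> carrier (T (Suc n))"
      using that by auto
    show "\<theta>' (cl n (act n (\<epsilon> f) y) (conjugate G (\<epsilon> f) k))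
        = conjugate (Q (Suc n)) (q (Suc n) f) (\<phi> (left (Symb y k)) (right (Symb y k)))"
      if y: "y \<in> carrier (T n)" and k: "k \<in> carrier G" for y k
    proof -
      obtain a h where a: "a \<in> \<gamma> n F0" "\<theta> y = q n a" and h: "h \<in> carrier F0" "\<epsilon> h = k"
        using lift[OF y] eps_lift[OF k] by blast
      note c = sub[OF a(1)] h(1) \<open>f \<in> carrier F0\<close>
      have "\<phi> (act n (\<epsilon> f) y) (conjugate G (\<epsilon> f) k)
          = q (Suc n) (commutator F0 (conjugate F0 f a) (conjugate F0 f h))"
        using a h y c N equi[OF y c(3)]
        by (intro phi) (auto simp: qn.hom_conjugate \<epsilon>.hom_conjugate \<epsilon>.G.normal_conjugate)
      then show ?thesis
        using c y k a h phi[OF a h] act_closed cl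
        by (simp add: q.hom_conjugate flip: \<epsilon>.G.conjugate_commutator)
    qed
  qed (simp add: \<theta>'_def)
  ultimately have "is_theta (Suc n) \<theta>'" unfolding is_theta_def by (intro conjI ballI hom)
  then show ?thesis by blast
qed

lemma theta_exists: "\<exists>\<theta>. is_theta n \<theta>"
  by (induction n) (use theta_0 theta_Suc in blast)+

end

lemma (in group_hom) restrict_hom:
  assumes "subgroup I G" shows "group_hom (G\<lparr>carrier := I\<rparr>) H h"
  using assms subgroup.mem_carrier[OF assms]
  by (intro group_homI homI) (auto intro: G.subgroup_imp_group)

text \<open>The kernel of \<lambda> and the subgroup \<open>W\<close> have the same image in
  \<open>Q k\<close>, namely the classes of elements of \<open>\<gamma> k F0\<close> in ker
  \<epsilon>; \<open>epi_through\<close> then applies.\<close>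

lemma tensor_kernel_epi:
  fixes G :: "'a uni monoid"
  assumes "group G"
  shows "\<exists>\<phi>. \<phi> \<in> epi (kernel_group (tensor_power G (Suc k)) G (tensor_lambda G (Suc k)))
      (left_derived 1 (quotient_functor (\<lambda>K. lower_central K (Suc k))) G)"
proof -
  let ?S = "\<lambda>K :: 'a uni monoid. lower_central K (Suc k)"
  interpret resolved_functor ?S G
    by (intro resolved_functor.intro functorial_lower_central resolved_functor_axioms.intro assms)
  interpret tensor_resolution G F0 F1 F2
    "counit G" "counit F0" "free_map G (counit G)"
    "counit F1" "free_map F0 (counit F0)" "free_map F0 (free_map G (counit G))"
    "comult G" "comult F0" "free_map F1 (comult G)" ..
  obtain \<theta> where \<theta>: "is_theta k \<theta>" using theta_exists by blast
  define L where "L = left_derived 1 (quotient_functor ?S) G"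
  obtain \<zeta> where \<zeta>: "group_hom (F1\<lparr>carrier := W\<rparr>) L \<zeta>" "\<zeta> ` W = carrier L"
    "\<And>x. x \<in> W \<Longrightarrow> \<zeta> x = \<one>\<^bsub>L\<^esub> \<longleftrightarrow> free_map G (counit G) x \<in> B ?S"
    using derived_epi unfolding L_def left_derived_eq by blast
  interpret \<theta>: group_hom "T k" "Q k" \<theta> using \<theta> by (simp add: is_theta_def)
  interpret l: group_hom "T k" G "lam k" by (rule lam_hom)
  interpret qk: group_hom F0 "Q k" "q k" by (rule q_hom)
  let ?A = "kernel_group (T k) G (lam k)" and ?M = "F1\<lparr>carrier := W\<rparr>"
  let ?r = "\<lambda>w. q k (free_map G (counit G) w)"
  have W: "w \<in> carrier F1" "free_map G (counit G) w \<in> ?S F0"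
    "counit G (free_map G (counit G) w) = \<one>\<^bsub>G\<^esub>" "free_map G (counit G) w \<in> carrier F0" if "w \<in> W" for w
    using that d1_W d1.hom_closed by (auto simp: W_def)
  have p: "group_hom ?A (Q k) \<theta>"
    unfolding kernel_group_def by (rule \<theta>.restrict_hom[OF l.subgroup_kernel])
  have r: "group_hom ?M (Q k) ?r"
    by (rule group_hom.hom_comp[OF d1.restrict_hom[OF subgroup_W] q_hom])
  have img: "\<theta> ` carrier ?A = ?r ` carrier ?M"
  proof (intro equalityI subsetI)
    fix y assume "y \<in> \<theta> ` carrier ?A"
    then obtain x where x: "y = \<theta> x" "x \<in> carrier (T k)" "lam k x = \<one>\<^bsub>G\<^esub>"
      by (auto simp: kernel_group_def kernel_def)
    then obtain a where a: "a \<in> \<gamma> k F0" "\<theta> x = q k a" "counit G a = \<one>\<^bsub>G\<^esub>"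
      using \<theta> unfolding is_theta_def by metis
    then have "a \<in> free_map G (counit G) ` W" unfolding d1_W by simp
    then show "y \<in> ?r ` carrier ?M" using a x by auto
  next
    fix y assume "y \<in> ?r ` carrier ?M"
    then obtain w where w: "y = ?r w" "w \<in> W" by auto
    obtain x where x: "x \<in> carrier (T k)" "\<theta> x = ?r w"
      using \<theta> W(2)[OF w(2)] unfolding is_theta_def by metis
    obtain a where a: "a \<in> \<gamma> k F0" "\<theta> x = q k a" "counit G a = lam k x"
      using \<theta> x(1) unfolding is_theta_def by metis
    \<comment> \<open>A class modulo \<open>B\<close> determines the value under \<epsilon>, so
      \<open>x\<close> lies in the kernel of \<lambda> although it was chosen only to have the right
      image under \<theta>.\<close>
    have "a \<in> carrier F0" "q k a = ?r w" using a(1,2) x(2) gamma_subset by auto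
    from q_eps[OF this(1) W(4)[OF w(2)] this(2)] have "lam k x = \<one>\<^bsub>G\<^esub>" using a x W(3)[OF w(2)] by simp
    then show "y \<in> \<theta> ` carrier ?A" using x w by (auto simp: kernel_group_def kernel_def)
  qed
  have ker: "\<zeta> w = \<one>\<^bsub>L\<^esub>" if "w \<in> carrier ?M" "?r w = \<one>\<^bsub>Q k\<^esub>" for w
    using that \<zeta>(3)[of w] W(4)[of w] by (simp add: q_one_iff)
  have surj: "\<zeta> ` carrier ?M = carrier L" using \<zeta>(2) by simp
  show ?thesis
  proof (rule epi_through[OF p r \<zeta>(1) img surj ker])
    fix \<phi> assume "\<phi> \<in> epi ?A L"
    then show ?thesis unfolding L_def by blast
  qed
qed


section \<open>The exterior square as a crossed module\<close>

locale exterior = G: group G for G :: "'a uni monoid"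
begin

sublocale presentation "tensor_gens G G" "exterior_rels G"
  by unfold_locales (auto simp: exterior_rels_def tensor_rels_def tensor_gens_def)

lemma square_eq: "exterior_square G = P"
  by (simp add: exterior_square_def)

definition w where "w x y = gen (Symb x y)"

lemma w_closed [simp]: "x \<in> carrier G \<Longrightarrow> y \<in> carrier G \<Longrightarrow> w x y \<in> carrier P"
  unfolding w_def by (rule gen_closed) (auto simp: tensor_gens_def)

lemma generate_w: "carrier P = generate P {w x y | x y. x \<in> carrier G \<and> y \<in> carrier G}"
proof -
  have "gen ` tensor_gens G G = {w x y | x y. x \<in> carrier G \<and> y \<in> carrier G}"
    by (auto simp: tensor_gens_def w_def)
  then show ?thesis using carrier_generate by simp
qed

lemma rel_class: "(u, v) \<in> exterior_rels G \<Longrightarrow> cls u = cls v"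
  by (intro word_class_eqI word_eq.relation)

lemma
  assumes "x \<in> carrier G" "y \<in> carrier G" "z \<in> carrier G"
  shows w_mult_left: "w (x \<otimes>\<^bsub>G\<^esub> y) z = w (conjugate G x y) (conjugate G x z) \<otimes>\<^bsub>P\<^esub> w x z"
    and w_mult_right: "w x (y \<otimes>\<^bsub>G\<^esub> z) = w x y \<otimes>\<^bsub>P\<^esub> w (conjugate G y x) (conjugate G y z)"
  unfolding w_def mult_class
  by (rule rel_class; use assms in \<open>force simp: exterior_rels_def tensor_rels_def\<close>)+

lemma w_self: "x \<in> carrier G \<Longrightarrow> w x x = \<one>\<^bsub>P\<^esub>"
  unfolding w_def one_class by (rule rel_class) (auto simp: exterior_rels_def)

lemma
  assumes L: "group L" and closed: "\<And>x k. x \<in> carrier G \<Longrightarrow> k \<in> carrier G \<Longrightarrow> \<phi> x k \<in> carrier L"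
    and rel1: "\<And>x x' k. x \<in> carrier G \<Longrightarrow> x' \<in> carrier G \<Longrightarrow> k \<in> carrier G \<Longrightarrow>
      \<phi> (x \<otimes>\<^bsub>G\<^esub> x') k = \<phi> (conjugate G x x') (conjugate G x k) \<otimes>\<^bsub>L\<^esub> \<phi> x k"
    and rel2: "\<And>x k k'. x \<in> carrier G \<Longrightarrow> k \<in> carrier G \<Longrightarrow> k' \<in> carrier G \<Longrightarrow>
      \<phi> x (k \<otimes>\<^bsub>G\<^esub> k') = \<phi> x k \<otimes>\<^bsub>L\<^esub> \<phi> (conjugate G k x) (conjugate G k k')"
    and rel3: "\<And>x. x \<in> carrier G \<Longrightarrow> \<phi> x x = \<one>\<^bsub>L\<^esub>"
  shows exterior_hom: "group_hom P L (hom_extend L (\<lambda>s. \<phi> (left s) (right s)))"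
    and exterior_hom_w: "x \<in> carrier G \<Longrightarrow> k \<in> carrier G \<Longrightarrow>
      hom_extend L (\<lambda>s. \<phi> (left s) (right s)) (w x k) = \<phi> x k"
proof -
  interpret L: group L by fact
  have f: "(\<lambda>s. \<phi> (left s) (right s)) \<in> tensor_gens G G \<rightarrow> carrier L"
    by (auto simp: tensor_gens_def closed)
  have R: "word_value L (\<lambda>s. \<phi> (left s) (right s)) u = word_value L (\<lambda>s. \<phi> (left s) (right s)) v"
    if "(u, v) \<in> exterior_rels G" for u v
    using that unfolding exterior_rels_def tensor_rels_def
    by (auto simp: closed rel1 rel2 rel3)
  show "group_hom P L (hom_extend L (\<lambda>s. \<phi> (left s) (right s)))"
    by (rule hom_extend_hom[OF L f R])
  show "hom_extend L (\<lambda>s. \<phi> (left s) (right s)) (w x k) = \<phi> x k"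
    if "x \<in> carrier G" "k \<in> carrier G"
    using hom_extend_gen[OF L f R, of "Symb x k"] that by (simp add: w_def tensor_gens_def)
qed

lemma hom_eq_w:
  assumes "group_hom P K f" "group_hom P K g"
    and "\<And>x y. x \<in> carrier G \<Longrightarrow> y \<in> carrier G \<Longrightarrow> f (w x y) = g (w x y)"
    and "a \<in> carrier P"
  shows "f a = g a"
  by (rule hom_eqI[OF assms(1,2) _ assms(4)])
     (use assms(3) in \<open>auto simp: tensor_gens_def w_def\<close>)

definition \<mu> where "\<mu> = exterior_mu G"

lemma mu_hom: "group_hom P G \<mu>"
  and mu_w: "x \<in> carrier G \<Longrightarrow> y \<in> carrier G \<Longrightarrow> \<mu> (w x y) = commutator G x y"
proof -
  have self: "commutator G x x = \<one>\<^bsub>G\<^esub>" if "x \<in> carrier G" for x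
    using that by (simp add: G.word_simps)
  note * = G.group_axioms G.commutator_closed G.commutator_mult_left G.commutator_mult_right self
  show "group_hom P G \<mu>"
    unfolding \<mu>_def exterior_mu_def by (rule exterior_hom[OF *])
  show "x \<in> carrier G \<Longrightarrow> y \<in> carrier G \<Longrightarrow> \<mu> (w x y) = commutator G x y"
    unfolding \<mu>_def exterior_mu_def by (rule exterior_hom_w[OF *])
qed

sublocale \<mu>: group_hom P G \<mu> by (rule mu_hom)

definition act where
  "act k = hom_extend P (\<lambda>s. w (conjugate G k (left s)) (conjugate G k (right s)))"

lemma
  assumes k: "k \<in> carrier G"
  shows act_hom: "group_hom P P (act k)"
    and act_w: "x \<in> carrier G \<Longrightarrow> y \<in> carrier G \<Longrightarrow> act k (w x y) = w (conjugate G k x) (conjugate G k y)"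
proof -
  have conj: "conjugate G k (conjugate G x y) = conjugate G (conjugate G k x) (conjugate G k y)"
    if "x \<in> carrier G" "y \<in> carrier G" for x y
    using that k by (simp add: G.word_simps)
  have closed: "w (conjugate G k x) (conjugate G k y) \<in> carrier P"
    if "x \<in> carrier G" "y \<in> carrier G" for x y
    using that k by simp
  have 1: "w (conjugate G k (x \<otimes>\<^bsub>G\<^esub> x')) (conjugate G k y) =
      w (conjugate G k (conjugate G x x')) (conjugate G k (conjugate G x y))
      \<otimes>\<^bsub>P\<^esub> w (conjugate G k x) (conjugate G k y)"
    if "x \<in> carrier G" "x' \<in> carrier G" "y \<in> carrier G" for x x' y
    using that k by (simp add: G.conjugate_mult conj w_mult_left)
  have 2: "w (conjugate G k x) (conjugate G k (y \<otimes>\<^bsub>G\<^esub> y')) =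
      w (conjugate G k x) (conjugate G k y) \<otimes>\<^bsub>P\<^esub>
      w (conjugate G k (conjugate G y x)) (conjugate G k (conjugate G y y'))"
    if "x \<in> carrier G" "y \<in> carrier G" "y' \<in> carrier G" for x y y'
    using that k by (simp add: G.conjugate_mult conj w_mult_right)
  have 3: "w (conjugate G k x) (conjugate G k x) = \<one>\<^bsub>P\<^esub>" if "x \<in> carrier G" for x
    using that k by (simp add: w_self)
  show "group_hom P P (act k)"
    unfolding act_def
    by (rule exterior_hom[where \<phi> = "\<lambda>x y. w (conjugate G k x) (conjugate G k y)", OF group_P closed 1 2 3])
  show "x \<in> carrier G \<Longrightarrow> y \<in> carrier G \<Longrightarrow> act k (w x y) = w (conjugate G k x) (conjugate G k y)"
    unfolding act_def
    by (rule exterior_hom_w[where \<phi> = "\<lambda>x y. w (conjugate G k x) (conjugate G k y)", OF group_P closed 1 2 3])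
qed

lemma act_closed [simp]: "k \<in> carrier G \<Longrightarrow> c \<in> carrier P \<Longrightarrow> act k c \<in> carrier P"
  by (rule group_hom.hom_closed[OF act_hom])

lemma act_mult: "k \<in> carrier G \<Longrightarrow> c \<in> carrier P \<Longrightarrow> c' \<in> carrier P \<Longrightarrow>
    act k (c \<otimes>\<^bsub>P\<^esub> c') = act k c \<otimes>\<^bsub>P\<^esub> act k c'"
  by (rule group_hom.hom_mult[OF act_hom])

lemma act_one [simp]: "k \<in> carrier G \<Longrightarrow> act k \<one>\<^bsub>P\<^esub> = \<one>\<^bsub>P\<^esub>"
  by (rule group_hom.hom_one[OF act_hom])

lemma act_inv: "k \<in> carrier G \<Longrightarrow> c \<in> carrier P \<Longrightarrow> act k (inv\<^bsub>P\<^esub> c) = inv\<^bsub>P\<^esub> (act k c)"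
  by (rule group_hom.hom_inv[OF act_hom])

lemma act_act:
  assumes "k \<in> carrier G" "l \<in> carrier G" "c \<in> carrier P"
  shows "act k (act l c) = act (k \<otimes>\<^bsub>G\<^esub> l) c"
  by (rule hom_eq_w[OF group_hom.hom_comp[OF act_hom[OF assms(2)] act_hom[OF assms(1)]] act_hom _ assms(3)])
     (use assms in \<open>simp_all add: act_w G.conjugate_conjugate\<close>)

lemma act_id [simp]:
  assumes "c \<in> carrier P" shows "act \<one>\<^bsub>G\<^esub> c = c"
  by (rule hom_eq_w[OF act_hom id_group_hom[OF group_P] _ assms]) (simp_all add: act_w)

lemma act_inv_cancel [simp]:
  assumes "k \<in> carrier G" "c \<in> carrier P"
  shows "act k (act (inv\<^bsub>G\<^esub> k) c) = c" "act (inv\<^bsub>G\<^esub> k) (act k c) = c"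
  using assms by (simp_all add: act_act)

lemma w_left: "x \<in> carrier G \<Longrightarrow> y \<in> carrier G \<Longrightarrow> z \<in> carrier G \<Longrightarrow>
    w (x \<otimes>\<^bsub>G\<^esub> y) z = act x (w y z) \<otimes>\<^bsub>P\<^esub> w x z"
  by (simp add: act_w w_mult_left)

lemma w_right: "x \<in> carrier G \<Longrightarrow> y \<in> carrier G \<Longrightarrow> z \<in> carrier G \<Longrightarrow>
    w x (y \<otimes>\<^bsub>G\<^esub> z) = w x y \<otimes>\<^bsub>P\<^esub> act y (w x z)"
  by (simp add: act_w w_mult_right)

lemma w_one [simp]:
  assumes "x \<in> carrier G" shows "w \<one>\<^bsub>G\<^esub> x = \<one>\<^bsub>P\<^esub>" "w x \<one>\<^bsub>G\<^esub> = \<one>\<^bsub>P\<^esub>"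
  using assms w_left[of "\<one>\<^bsub>G\<^esub>" "\<one>\<^bsub>G\<^esub>" x] w_right[of x "\<one>\<^bsub>G\<^esub>" "\<one>\<^bsub>G\<^esub>"]
  by (simp_all add: P.l_cancel_one)

lemma act_w_inv:
  assumes "x \<in> carrier G" "y \<in> carrier G"
  shows "act x (w (inv\<^bsub>G\<^esub> x) y) = inv\<^bsub>P\<^esub> (w x y)" "act y (w x (inv\<^bsub>G\<^esub> y)) = inv\<^bsub>P\<^esub> (w x y)"
proof -
  have "act x (w (inv\<^bsub>G\<^esub> x) y) \<otimes>\<^bsub>P\<^esub> w x y = \<one>\<^bsub>P\<^esub>"
    using assms w_left[of x "inv\<^bsub>G\<^esub> x" y] by simp
  then show "act x (w (inv\<^bsub>G\<^esub> x) y) = inv\<^bsub>P\<^esub> (w x y)"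
    using assms by (simp add: P.inv_equality)
  have "w x y \<otimes>\<^bsub>P\<^esub> act y (w x (inv\<^bsub>G\<^esub> y)) = \<one>\<^bsub>P\<^esub>"
    using assms w_right[of x y "inv\<^bsub>G\<^esub> y"] by simp
  then show "act y (w x (inv\<^bsub>G\<^esub> y)) = inv\<^bsub>P\<^esub> (w x y)"
    using assms P.inv_equality[of "w x y" "act y (w x (inv\<^bsub>G\<^esub> y))"]
    by (metis P.inv_comm P.inv_equality act_closed G.inv_closed w_closed)
qed

text \<open>Expanding the trivial element \<open>w (x y) (x y)\<close> leaves, up to the action of
  \<open>x\<close>, the product of \<open>w y x\<close> and \<open>w x y\<close>, since the diagonal
  factors vanish.\<close>

lemma w_swap:
  assumes "x \<in> carrier G" "y \<in> carrier G" shows "w y x = inv\<^bsub>P\<^esub> (w x y)"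
proof -
  have "\<one>\<^bsub>P\<^esub> = act x (w y (x \<otimes>\<^bsub>G\<^esub> y)) \<otimes>\<^bsub>P\<^esub> w x (x \<otimes>\<^bsub>G\<^esub> y)"
    using assms w_self[of "x \<otimes>\<^bsub>G\<^esub> y"] by (simp add: w_left)
  also have "\<dots> = act x (w y x \<otimes>\<^bsub>P\<^esub> w x y)"
    using assms by (simp add: w_right w_self act_mult)
  finally have "act (inv\<^bsub>G\<^esub> x) (act x (w y x \<otimes>\<^bsub>P\<^esub> w x y)) = act (inv\<^bsub>G\<^esub> x) \<one>\<^bsub>P\<^esub>" by simp
  then have "w y x \<otimes>\<^bsub>P\<^esub> w x y = \<one>\<^bsub>P\<^esub>" using assms by (simp del: act_mult)
  then show ?thesis using assms by (simp add: P.inv_equality)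
qed

text \<open>Expand \<open>w (g g') (h h')\<close> once starting with the left argument and once with
  the right. The outer factors agree, and cancelling them leaves a commutation rule for
  \<open>w g h\<close> with the diagonal action.\<close>

lemma peiffer_w:
  assumes g: "g \<in> carrier G" "h \<in> carrier G" and c: "c \<in> carrier P"
  shows "conjugate P (w g h) c = act (commutator G g h) c"
proof -
  have swap: "conjugate P (w g h) (act (h \<otimes>\<^bsub>G\<^esub> g) c) = act (g \<otimes>\<^bsub>G\<^esub> h) c" if c: "c \<in> carrier P" for c
  proof (rule hom_eq_w[OF _ _ _ c])
    have "group_hom P P (conjugate P (w g h))"
      using g by (intro group_homI homI group_P) (auto simp: P.conjugate_mult)
    then show "group_hom P P (\<lambda>c. conjugate P (w g h) (act (h \<otimes>\<^bsub>G\<^esub> g) c))"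
      using g by (intro group_hom.hom_comp[OF act_hom]) auto
    show "group_hom P P (act (g \<otimes>\<^bsub>G\<^esub> h))" using g by (intro act_hom) auto
    fix g' h' assume g': "g' \<in> carrier G" "h' \<in> carrier G"
    have "w (g \<otimes>\<^bsub>G\<^esub> g') (h \<otimes>\<^bsub>G\<^esub> h') = act g (w g' h) \<otimes>\<^bsub>P\<^esub>
        (act (g \<otimes>\<^bsub>G\<^esub> h) (w g' h') \<otimes>\<^bsub>P\<^esub> w g h \<otimes>\<^bsub>P\<^esub> act h (w g h'))"
      using g g' by (subst w_left) (simp_all add: w_right act_mult act_act P.m_assoc)
    moreover have "w (g \<otimes>\<^bsub>G\<^esub> g') (h \<otimes>\<^bsub>G\<^esub> h') = act g (w g' h) \<otimes>\<^bsub>P\<^esub>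
        (w g h \<otimes>\<^bsub>P\<^esub> act (h \<otimes>\<^bsub>G\<^esub> g) (w g' h') \<otimes>\<^bsub>P\<^esub> act h (w g h'))"
      using g g' by (subst w_right) (simp_all add: w_left act_mult act_act P.m_assoc)
    ultimately have "w g h \<otimes>\<^bsub>P\<^esub> act (h \<otimes>\<^bsub>G\<^esub> g) (w g' h') = act (g \<otimes>\<^bsub>G\<^esub> h) (w g' h') \<otimes>\<^bsub>P\<^esub> w g h"
      using g g' by simp
    then show "conjugate P (w g h) (act (h \<otimes>\<^bsub>G\<^esub> g) (w g' h')) = act (g \<otimes>\<^bsub>G\<^esub> h) (w g' h')"
      using g g' by (simp add: conjugate_def P.m_assoc)
  qed
  \<comment> \<open>Undoing the action of \<open>h g\<close> first leaves \<open>g h\<close> times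
    the inverse of \<open>h g\<close>, which is the commutator.\<close>
  have "conjugate P (w g h) c = act (g \<otimes>\<^bsub>G\<^esub> h) (act (inv\<^bsub>G\<^esub> (h \<otimes>\<^bsub>G\<^esub> g)) c)"
    using swap[of "act (inv\<^bsub>G\<^esub> (h \<otimes>\<^bsub>G\<^esub> g)) c"] g c by simp
  then show ?thesis
    using g c by (simp add: act_act) (simp add: G.word_simps)
qed

lemma peiffer:
  assumes c: "c \<in> carrier P" and c': "c' \<in> carrier P"
  shows "conjugate P c c' = act (\<mu> c) c'"
proof -
  have gen: "c \<in> generate P {w x y | x y. x \<in> carrier G \<and> y \<in> carrier G}"
    using c generate_w by simp
  have "c \<in> carrier P \<and> (\<forall>c'\<in>carrier P. conjugate P c c' = act (\<mu> c) c')"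
    using gen
  proof induct
    case (inv h)
    then obtain x y where h: "h = w x y" "x \<in> carrier G" "y \<in> carrier G" by blast
    show ?case
    proof (intro conjI ballI)
      fix c' assume c': "c' \<in> carrier P"
      have "c' = act (commutator G x y) (conjugate P (inv\<^bsub>P\<^esub> h) c')"
        using h c' peiffer_w[OF h(2,3), of "conjugate P (inv\<^bsub>P\<^esub> h) c'"]
        by (simp add: P.conjugate_conjugate)
      from arg_cong[OF this, of "act (inv\<^bsub>G\<^esub> (commutator G x y))"]
      show "conjugate P (inv\<^bsub>P\<^esub> h) c' = act (\<mu> (inv\<^bsub>P\<^esub> h)) c'"
        using h c' by (simp add: mu_w)
    qed (use h in simp)
  qed (auto simp: mu_w peiffer_w act_act P.conjugate_conjugate[symmetric])
  then show ?thesis using c' by blast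
qed

lemma act_conj: "c \<in> carrier P \<Longrightarrow> c' \<in> carrier P \<Longrightarrow> c \<otimes>\<^bsub>P\<^esub> c' = act (\<mu> c) c' \<otimes>\<^bsub>P\<^esub> c"
  by (simp add: conjugate_def P.m_assoc flip: peiffer)

text \<open>This is the rule \<open>w (\<mu> c) p\<close> = c times \<open>act p\<close> of the
  inverse of c, for c = \<open>w g h\<close>. It comes from writing [g,h] as g times the conjugate
  by h of the inverse of g.\<close>

lemma w_commutator:
  assumes g: "g \<in> carrier G" and h: "h \<in> carrier G" and p: "p \<in> carrier G"
  shows "w (commutator G g h) p = w g h \<otimes>\<^bsub>P\<^esub> act p (inv\<^bsub>P\<^esub> (w g h))"
proof -
  note s = g h p
  let ?g = "inv\<^bsub>G\<^esub> g"
  have "w (commutator G g h) p = w (g \<otimes>\<^bsub>G\<^esub> conjugate G h ?g) p"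
    using s by (simp add: G.word_simps)
  also have "\<dots> = act g (w (conjugate G h ?g) p) \<otimes>\<^bsub>P\<^esub> w g p"
    using s by (simp add: w_left)
  also have "w (conjugate G h ?g) p = inv\<^bsub>P\<^esub> (w ?g h) \<otimes>\<^bsub>P\<^esub> (w ?g p \<otimes>\<^bsub>P\<^esub> act p (w ?g h))"
  proof -
    have "p = conjugate G h (conjugate G (inv\<^bsub>G\<^esub> h) p)" using s by (simp add: G.conjugate_conjugate)
    then have "w (conjugate G h ?g) p = act h (w ?g (conjugate G (inv\<^bsub>G\<^esub> h) p))"
      using s by (simp add: act_w)
    \<comment> \<open>The product p h also equals h times a conjugate of p. Expanding both forms of
      the same second argument isolates the unknown factor.\<close>
    moreover have "w ?g h \<otimes>\<^bsub>P\<^esub> act h (w ?g (conjugate G (inv\<^bsub>G\<^esub> h) p)) = w ?g (p \<otimes>\<^bsub>G\<^esub> h)"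
    proof -
      have "p \<otimes>\<^bsub>G\<^esub> h = h \<otimes>\<^bsub>G\<^esub> conjugate G (inv\<^bsub>G\<^esub> h) p" using s by (simp add: G.word_simps)
      then show ?thesis using s by (simp add: w_right)
    qed
    moreover have "w ?g (p \<otimes>\<^bsub>G\<^esub> h) = w ?g p \<otimes>\<^bsub>P\<^esub> act p (w ?g h)" using s by (simp add: w_right)
    ultimately have "w ?g h \<otimes>\<^bsub>P\<^esub> w (conjugate G h ?g) p = w ?g p \<otimes>\<^bsub>P\<^esub> act p (w ?g h)" by simp
    then show ?thesis using s P.inv_cancel_left(2)[of "w ?g h" "w (conjugate G h ?g) p"] by simp
  qed
  also have "act g (inv\<^bsub>P\<^esub> (w ?g h) \<otimes>\<^bsub>P\<^esub> (w ?g p \<otimes>\<^bsub>P\<^esub> act p (w ?g h)))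
      = w g h \<otimes>\<^bsub>P\<^esub> (inv\<^bsub>P\<^esub> (w g p) \<otimes>\<^bsub>P\<^esub> act (conjugate G g p) (inv\<^bsub>P\<^esub> (w g h)))"
  proof -
    have "act g (act p (w ?g h)) = act (conjugate G g p) (act g (w ?g h))"
      using s by (simp add: act_act) (simp add: G.word_simps)
    then show ?thesis using s by (simp add: act_mult act_inv act_w_inv)
  qed
  also have "\<dots> \<otimes>\<^bsub>P\<^esub> w g p = w g h \<otimes>\<^bsub>P\<^esub>
      conjugate P (inv\<^bsub>P\<^esub> (w g p)) (act (conjugate G g p) (inv\<^bsub>P\<^esub> (w g h)))"
    using s by (simp add: conjugate_def P.m_assoc)
  also have "\<dots> = w g h \<otimes>\<^bsub>P\<^esub> act p (inv\<^bsub>P\<^esub> (w g h))"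
    using s by (simp add: peiffer mu_w act_act) (simp add: G.word_simps)
  finally show ?thesis .
qed

end

section \<open>The exterior square of a free group\<close>

text \<open>The universal property of the free group with target the symmetric group of
  \<open>Y\<close>. The maps are restricted because \<open>BijGroup\<close> consists of functions
  that are undefined off \<open>Y\<close>.\<close>

lemma free_group_action:
  assumes "\<And>x. x \<in> carrier H \<Longrightarrow> bij_betw (st x) Y Y"
  obtains \<theta> where "group_action (free_group H) Y \<theta>"
    "\<And>x y. x \<in> carrier H \<Longrightarrow> y \<in> Y \<Longrightarrow> \<theta> (free_gen H x) y = st x y"
proof -
  have f: "(\<lambda>x. restrict (st x) Y) \<in> carrier H \<rightarrow> carrier (BijGroup Y)"
    using assms by (auto simp: BijGroup_def Bij_def)
  let ?\<theta> = "hom_extend (BijGroup Y) (\<lambda>x. restrict (st x) Y)"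
  show thesis
  proof (rule that[of ?\<theta>])
    show "group_action (free_group H) Y ?\<theta>"
      by (rule group_action.intro) (rule free_hom_extend(1)[OF group_BijGroup f])
    show "?\<theta> (free_gen H x) y = st x y" if "x \<in> carrier H" "y \<in> Y" for x y
      using free_hom_extend(2)[OF group_BijGroup f that(1)] that(2) by simp
  qed
qed

context group_action
begin

lemma grp: "group G"
  using group_hom by (rule group_hom.axioms(1))

lemma action_closed: "g \<in> carrier G \<Longrightarrow> x \<in> E \<Longrightarrow> \<phi> g x \<in> E"
  using element_image by blast

lemma action_one: "x \<in> E \<Longrightarrow> \<phi> \<one> x = x"
  by (metis id_eq_one restrict_apply')

lemma action_inv:
  assumes "g \<in> carrier G" "x \<in> E"
  shows "\<phi> g (\<phi> (inv g) x) = x" "\<phi> (inv g) (\<phi> g x) = x"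
proof -
  have i: "inv g \<in> carrier G" by (rule group.inv_closed[OF grp assms(1)])
  show "\<phi> g (\<phi> (inv g) x) = x" "\<phi> (inv g) (\<phi> g x) = x"
    using composition_rule[OF assms(2) assms(1) i] composition_rule[OF assms(2) i assms(1)]
      action_one[OF assms(2)] assms group.r_inv[OF grp] group.l_inv[OF grp] by simp_all
qed

end

context exterior
begin

text \<open>Compares the two ways of moving \<open>x y\<close> past a word \<open>p q\<close> when \<open>x\<close> is to be inserted
  after \<open>p\<close> and \<open>y\<close> after \<open>p q\<close>.\<close>

lemma collect_identity:
  assumes "x \<in> carrier G" "y \<in> carrier G" "p \<in> carrier G" "q \<in> carrier G"
  shows "act x (w y (p \<otimes>\<^bsub>G\<^esub> q)) \<otimes>\<^bsub>P\<^esub> w x p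
    = w x y \<otimes>\<^bsub>P\<^esub> (act y (w x p) \<otimes>\<^bsub>P\<^esub> w y (p \<otimes>\<^bsub>G\<^esub> (x \<otimes>\<^bsub>G\<^esub> q)))"
proof -
  note s = assms
  let ?e = "act (p \<otimes>\<^bsub>G\<^esub> x) (w y q)"
  \<comment> \<open>By the Peiffer identity, passing \<open>w x p\<close> acts by [x,p], which turns
    p x into x p.\<close>
  have comm: "act (x \<otimes>\<^bsub>G\<^esub> p) (w y q) \<otimes>\<^bsub>P\<^esub> w x p = w x p \<otimes>\<^bsub>P\<^esub> ?e"
  proof -
    have "act (\<mu> (w x p)) ?e = act (x \<otimes>\<^bsub>G\<^esub> p) (w y q)"
      using s by (simp add: mu_w act_act) (simp add: G.word_simps)
    then show ?thesis using s act_conj[of "w x p" ?e] by simp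
  qed
  have "act x (w y (p \<otimes>\<^bsub>G\<^esub> q)) \<otimes>\<^bsub>P\<^esub> w x p
      = act x (w y p) \<otimes>\<^bsub>P\<^esub> (act (x \<otimes>\<^bsub>G\<^esub> p) (w y q) \<otimes>\<^bsub>P\<^esub> w x p)"
    using s by (simp add: w_right act_mult act_act P.m_assoc)
  also have "\<dots> = w (x \<otimes>\<^bsub>G\<^esub> y) p \<otimes>\<^bsub>P\<^esub> ?e"
    using s by (simp add: comm w_left P.m_assoc)
  \<comment> \<open>Writing x y as [x,y] y x brings out \<open>w x y\<close> by
    \<open>w_commutator\<close>, and its twisted inverse is the remaining factor
    \<open>act p (w y x)\<close>.\<close>
  also have "w (x \<otimes>\<^bsub>G\<^esub> y) p = w x y \<otimes>\<^bsub>P\<^esub> (w (y \<otimes>\<^bsub>G\<^esub> x) p \<otimes>\<^bsub>P\<^esub> act p (w y x))"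
  proof -
    have "x \<otimes>\<^bsub>G\<^esub> y = commutator G x y \<otimes>\<^bsub>G\<^esub> (y \<otimes>\<^bsub>G\<^esub> x)" using s by (simp add: G.word_simps)
    then have "w (x \<otimes>\<^bsub>G\<^esub> y) p = act (commutator G x y) (w (y \<otimes>\<^bsub>G\<^esub> x) p) \<otimes>\<^bsub>P\<^esub> w (commutator G x y) p"
      using s by (metis G.commutator_closed G.m_closed w_left)
    also have "\<dots> = (act (\<mu> (w x y)) (w (y \<otimes>\<^bsub>G\<^esub> x) p) \<otimes>\<^bsub>P\<^esub> w x y) \<otimes>\<^bsub>P\<^esub> act p (inv\<^bsub>P\<^esub> (w x y))"
      using s by (simp add: w_commutator mu_w P.m_assoc)
    also have "\<dots> = w x y \<otimes>\<^bsub>P\<^esub> w (y \<otimes>\<^bsub>G\<^esub> x) p \<otimes>\<^bsub>P\<^esub> act p (w y x)"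
      using s act_conj[of "w x y" "w (y \<otimes>\<^bsub>G\<^esub> x) p"] w_swap[of x y] by simp
    finally show ?thesis using s by (simp add: P.m_assoc)
  qed
  also have "w x y \<otimes>\<^bsub>P\<^esub> (w (y \<otimes>\<^bsub>G\<^esub> x) p \<otimes>\<^bsub>P\<^esub> act p (w y x)) \<otimes>\<^bsub>P\<^esub> ?e
      = w x y \<otimes>\<^bsub>P\<^esub> (act y (w x p) \<otimes>\<^bsub>P\<^esub> w y (p \<otimes>\<^bsub>G\<^esub> (x \<otimes>\<^bsub>G\<^esub> q)))"
    using s by (simp add: w_left w_right act_mult act_act P.m_assoc)
  finally show ?thesis .
qed

end

section \<open>Collection over finitely many generators of a free group\<close>

lemma (in group) generate_finite_support:
  assumes "a \<in> generate G (f ` A)"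
  shows "\<exists>B. finite B \<and> B \<subseteq> A \<and> a \<in> generate G (f ` B)"
  using assms
proof induct
  case one
  show ?case by (rule exI[of _ "{}"]) (auto intro: generate.one)
next
  case (incl h)
  then obtain b where "b \<in> A" "h = f b" by blast
  then show ?case by (intro exI[of _ "{b}"]) (auto intro: generate.incl)
next
  case (inv h)
  then obtain b where "b \<in> A" "h = f b" by blast
  then show ?case by (intro exI[of _ "{b}"]) (auto intro: generate.inv)
next
  case (eng h1 h2)
  then obtain B C where BC: "finite B" "B \<subseteq> A" "finite C" "C \<subseteq> A"
    and "h1 \<in> generate G (f ` B)" "h2 \<in> generate G (f ` C)" by blast
  moreover have "generate G (f ` B) \<subseteq> generate G (f ` (B \<union> C))"
    "generate G (f ` C) \<subseteq> generate G (f ` (B \<union> C))"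
    by (auto intro!: mono_generate image_mono)
  ultimately show ?case
    by (intro exI[of _ "B \<union> C"]) (auto intro: generate.eng)
qed

locale free_exterior = exterior "free_group H" for H :: "'a uni monoid"
begin

abbreviation F where "F \<equiv> free_group H"
abbreviation fg where "fg \<equiv> free_gen H"

text \<open>An element of the exterior square involves finitely many generators only, so an
  enumeration of these supplies the order needed for monomials.\<close>

lemma finite_support:
  assumes "c \<in> carrier P"
  shows "\<exists>A. finite A \<and> A \<subseteq> carrier H \<and>
    c \<in> generate P {w x y | x y. x \<in> generate F (fg ` A) \<and> y \<in> generate F (fg ` A)}"
proof -
  let ?W = "\<lambda>A. {w x y | x y. x \<in> generate F (fg ` A) \<and> y \<in> generate F (fg ` A)}"
  have pair: "\<exists>A. finite A \<and> A \<subseteq> carrier H \<and> x \<in> generate F (fg ` A) \<and> y \<in> generate F (fg ` A)"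
    if xy: "x \<in> carrier F" "y \<in> carrier F" for x y
  proof -
    obtain A B where AB: "finite A" "A \<subseteq> carrier H" "x \<in> generate F (fg ` A)"
      "finite B" "B \<subseteq> carrier H" "y \<in> generate F (fg ` B)"
      using G.generate_finite_support xy free_group_generate by metis
    moreover have "generate F (fg ` A) \<subseteq> generate F (fg ` (A \<union> B))"
      "generate F (fg ` B) \<subseteq> generate F (fg ` (A \<union> B))"
      by (auto intro!: G.mono_generate image_mono)
    ultimately show ?thesis by (intro exI[of _ "A \<union> B"]) auto
  qed
  have mono: "generate P (?W A) \<subseteq> generate P (?W B)" if "A \<subseteq> B" for A B
  proof -
    have "generate F (fg ` A) \<subseteq> generate F (fg ` B)"
      using that by (intro G.mono_generate image_mono)
    then have "?W A \<subseteq> ?W B" by blast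
    then show ?thesis by (rule P.mono_generate)
  qed
  have "c \<in> generate P {w x y | x y. x \<in> carrier F \<and> y \<in> carrier F}"
    using assms generate_w by simp
  then show ?thesis
  proof induct
    case one
    show ?case by (rule exI[of _ "{}"]) (auto intro: generate.one)
  next
    case (incl h)
    then obtain x y where "h = w x y" "x \<in> carrier F" "y \<in> carrier F" by blast
    with pair[of x y] show ?case by (blast intro: generate.incl)
  next
    case (inv h)
    then obtain x y where "h = w x y" "x \<in> carrier F" "y \<in> carrier F" by blast
    with pair[of x y] show ?case by (blast intro: generate.inv)
  next
    case (eng h1 h2)
    then obtain A B where AB: "finite A" "A \<subseteq> carrier H" "h1 \<in> generate P (?W A)"
      "finite B" "B \<subseteq> carrier H" "h2 \<in> generate P (?W B)" by blast
    have "h1 \<in> generate P (?W (A \<union> B))" "h2 \<in> generate P (?W (A \<union> B))"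
      using AB mono[of A "A \<union> B"] mono[of B "A \<union> B"] by auto
    then have "h1 \<otimes>\<^bsub>P\<^esub> h2 \<in> generate P (?W (A \<union> B))" by (rule generate.eng)
    then show ?case using AB by (intro exI[of _ "A \<union> B"]) auto
  qed
qed

end

text \<open>A state \<open>(c, z)\<close> stands for \<open>\<mu> c\<close> times the ordered monomial with exponents \<open>z\<close>. A generator
  \<open>e i\<close> acts by left multiplication followed by collection, which records the exterior product of
  \<open>e i\<close> with the part of the monomial it has to pass; generators outside \<open>A\<close> are not collected.\<close>

locale collection = free_exterior H for H :: "'a uni monoid" +
  fixes A :: "'a uni set" and e :: "nat \<Rightarrow> 'a uni" and n :: nat
  assumes e_bij: "bij_betw e {..<n} A" and A_sub: "A \<subseteq> carrier H"
begin

definition pos where "pos = inv_into {..<n} e"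

lemma pos: "x \<in> A \<Longrightarrow> pos x < n \<and> e (pos x) = x"
  using bij_betw_inv_into_right[OF e_bij] bij_betw_apply[OF bij_betw_inv_into[OF e_bij]]
  by (auto simp: pos_def)

text \<open>This is the part of the ordered monomial with exponents \<open>z\<close> that a
  generator at position \<open>i\<close> has to pass.\<close>

fun initial :: "nat \<Rightarrow> (nat \<Rightarrow> int) \<Rightarrow> 'a uni" where
  "initial 0 z = \<one>\<^bsub>F\<^esub>"
| "initial (Suc i) z = initial i z \<otimes>\<^bsub>F\<^esub> fg (e i) [^]\<^bsub>F\<^esub> z i"

lemma e_closed: "i < n \<Longrightarrow> fg (e i) \<in> carrier F"
  using A_sub bij_betw_apply[OF e_bij, of i] by auto

lemma initial_closed: "i \<le> n \<Longrightarrow> initial i z \<in> carrier F"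
  by (induction i) (auto simp: e_closed)

lemma initial_upd: "i \<le> j \<Longrightarrow> initial i (z(j := k)) = initial i z"
  by (induction i) auto

text \<open>Raising an exponent by one puts \<open>e i\<close> in front of its own power. The same
  tail \<open>v\<close> occurs in both monomials, which is the shape that
  \<open>collect_identity\<close> compares.\<close>

lemma initial_split:
  assumes "i < j" "j \<le> n"
  shows "\<exists>v\<in>carrier F. initial j z = initial i z \<otimes>\<^bsub>F\<^esub> v \<and>
    initial j (z(i := z i + 1)) = initial i z \<otimes>\<^bsub>F\<^esub> (fg (e i) \<otimes>\<^bsub>F\<^esub> v)"
  using assms
proof (induction j)
  case (Suc j)
  show ?case
  proof (cases "i = j")
    case True
    have "fg (e i) [^]\<^bsub>F\<^esub> (z i + 1) = fg (e i) \<otimes>\<^bsub>F\<^esub> fg (e i) [^]\<^bsub>F\<^esub> z i"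
      using Suc True e_closed[of i] G.int_pow_mult[of "fg (e i)" 1 "z i"] by (simp add: add.commute)
    then have "initial (Suc i) (z(i := z i + 1))
        = initial i z \<otimes>\<^bsub>F\<^esub> (fg (e i) \<otimes>\<^bsub>F\<^esub> fg (e i) [^]\<^bsub>F\<^esub> z i)"
      using initial_upd[of i i z "z i + 1"] by simp
    moreover have "initial (Suc i) z = initial i z \<otimes>\<^bsub>F\<^esub> fg (e i) [^]\<^bsub>F\<^esub> z i"
      "fg (e i) [^]\<^bsub>F\<^esub> z i \<in> carrier F"
      using Suc True e_closed[of i] by simp_all
    ultimately show ?thesis unfolding True by blast
  next
    case False
    then have "i < j" "j \<le> n" using Suc.prems by simp_all
    then obtain v where "v \<in> carrier F" "initial j z = initial i z \<otimes>\<^bsub>F\<^esub> v"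
      "initial j (z(i := z i + 1)) = initial i z \<otimes>\<^bsub>F\<^esub> (fg (e i) \<otimes>\<^bsub>F\<^esub> v)"
      using Suc.IH by blast
    then show ?thesis
      using Suc False e_closed[of i] e_closed[of j] initial_closed[of i z]
      by (intro bexI[of _ "v \<otimes>\<^bsub>F\<^esub> fg (e j) [^]\<^bsub>F\<^esub> z j"]) (auto simp: G.m_assoc)
  qed
qed simp

definition Y where "Y = carrier P \<times> (UNIV :: (nat \<Rightarrow> int) set)"

text \<open>With m = p v the monomial and p its part before x, one has x \<mu>(c) m =
  \<mu>(\<open>act\<close> x c) [x,p] p x v. The commutator [x,p] is recorded by its lift
  \<open>w x p\<close>, and p x v is the monomial with the exponent of x raised.\<close>

definition collect :: "'a uni \<Rightarrow> 'a uni \<times> (nat \<Rightarrow> int) \<Rightarrow> 'a uni \<times> (nat \<Rightarrow> int)" where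
  "collect x = (\<lambda>(c, z). if x \<in> A
     then (act (fg x) c \<otimes>\<^bsub>P\<^esub> w (fg x) (initial (pos x) z), z(pos x := z (pos x) + 1))
     else (act (fg x) c, z))"

lemma w_initial_closed: "x \<in> A \<Longrightarrow> w (fg x) (initial (pos x) z) \<in> carrier P"
  using pos[of x] A_sub by (intro w_closed initial_closed) auto

lemma collect_bij:
  assumes x: "x \<in> carrier H" shows "bij_betw (collect x) Y Y"
proof -
  let ?g = "fg x" and ?i = "pos x"
  have g: "?g \<in> carrier F" using x by simp
  show ?thesis
  proof (cases "x \<in> A")
    case True
    let ?b = "\<lambda>(c, z). (act (inv\<^bsub>F\<^esub> ?g) (c \<otimes>\<^bsub>P\<^esub> inv\<^bsub>P\<^esub> (w ?g (initial ?i z))), z(?i := z ?i - 1))"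
    show ?thesis
      by (rule bij_betw_byWitness[of _ ?b])
         (use True g w_initial_closed[OF True] in
          \<open>auto simp: Y_def collect_def initial_upd P.m_assoc\<close>)
  next
    case False
    show ?thesis
      by (rule bij_betw_byWitness[of _ "\<lambda>(c, z). (act (inv\<^bsub>F\<^esub> ?g) c, z)"])
         (use False g in \<open>auto simp: Y_def collect_def\<close>)
  qed
qed

definition tr :: "'a uni \<Rightarrow> 'a uni \<times> (nat \<Rightarrow> int) \<Rightarrow> 'a uni \<times> (nat \<Rightarrow> int)" where
  "tr d = (\<lambda>(c, z). (d \<otimes>\<^bsub>P\<^esub> c, z))"

lemma tr_closed [simp]: "d \<in> carrier P \<Longrightarrow> y \<in> Y \<Longrightarrow> tr d y \<in> Y"
  by (auto simp: tr_def Y_def)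

lemma tr_tr: "c \<in> carrier P \<Longrightarrow> d \<in> carrier P \<Longrightarrow> y \<in> Y \<Longrightarrow> tr c (tr d y) = tr (c \<otimes>\<^bsub>P\<^esub> d) y"
  by (auto simp: tr_def Y_def P.m_assoc)

lemma tr_one [simp]: "y \<in> Y \<Longrightarrow> tr \<one>\<^bsub>P\<^esub> y = y"
  by (auto simp: tr_def Y_def)

lemma tr_cancel:
  assumes "c \<in> carrier P" "x \<in> Y" "y \<in> Y" "tr c x = y" shows "x = tr (inv\<^bsub>P\<^esub> c) y"
  using assms by (auto simp: tr_tr)

lemma collect_tr: "x \<in> carrier H \<Longrightarrow> d \<in> carrier P \<Longrightarrow> y \<in> Y \<Longrightarrow>
    collect x (tr d y) = tr (act (fg x) d) (collect x y)"
  using w_initial_closed by (auto simp: tr_def Y_def collect_def act_mult P.m_assoc)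

text \<open>Both orders give the same exponents. The first coordinates are compared by
  \<open>collect_identity\<close>, with p the part of the monomial before x and q the part from
  there up to y.\<close>

lemma collect_swap_less:
  assumes x: "x \<in> A" and y: "y \<in> A" and less: "pos x < pos y" and v: "v \<in> Y"
  shows "collect x (collect y v) = tr (w (fg x) (fg y)) (collect y (collect x v))"
proof -
  obtain c z where cz: "v = (c, z)" "c \<in> carrier P" using v by (auto simp: Y_def)
  let ?x = "fg x" and ?y = "fg y" and ?i = "pos x" and ?j = "pos y"
  have g: "?x \<in> carrier F" "?y \<in> carrier F" using x y A_sub by auto
  have p: "initial ?i z \<in> carrier F" using pos[OF x] by (intro initial_closed) auto
  obtain q where q: "q \<in> carrier F" "initial ?j z = initial ?i z \<otimes>\<^bsub>F\<^esub> q"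
    "initial ?j (z(?i := z ?i + 1)) = initial ?i z \<otimes>\<^bsub>F\<^esub> (?x \<otimes>\<^bsub>F\<^esub> q)"
    using initial_split[OF less, of z] pos[OF x] pos[OF y] by auto
  \<comment> \<open>The Peiffer identity moves \<open>w ?x ?y\<close> to the front; this exchanges
    the actions of x and y on \<open>c\<close>.\<close>
  have "act ?x (act ?y c) \<otimes>\<^bsub>P\<^esub> w ?x ?y = w ?x ?y \<otimes>\<^bsub>P\<^esub> act ?y (act ?x c)"
  proof -
    have "act (\<mu> (w ?x ?y)) (act ?y (act ?x c)) = act ?x (act ?y c)"
      using g cz by (simp add: mu_w act_act) (simp add: G.word_simps)
    then show ?thesis using act_conj[of "w ?x ?y" "act ?y (act ?x c)"] g cz by simp
  qed
  then have "act ?x (act ?y c) \<otimes>\<^bsub>P\<^esub> (w ?x ?y \<otimes>\<^bsub>P\<^esub> d) = w ?x ?y \<otimes>\<^bsub>P\<^esub> (act ?y (act ?x c) \<otimes>\<^bsub>P\<^esub> d)"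
    if "d \<in> carrier P" for d
    using that g cz by (simp flip: P.m_assoc)
  moreover have "z(?j := z ?j + 1, ?i := z ?i + 1) = z(?i := z ?i + 1, ?j := z ?j + 1)"
    using less by (auto simp: fun_eq_iff)
  ultimately show ?thesis
    using x y g cz p q less collect_identity[OF g p q(1)]
    by (simp add: collect_def tr_def initial_upd act_mult P.m_assoc)
qed

text \<open>The reverse order follows because \<open>w y x\<close> and \<open>w x y\<close> are
  inverse translations, and the equal case because \<open>w x x\<close> is trivial.\<close>

lemma collect_swap:
  assumes x: "x \<in> A" and y: "y \<in> A" and v: "v \<in> Y"
  shows "collect x (collect y v) = tr (w (fg x) (fg y)) (collect y (collect x v))"
proof -
  have H: "x \<in> carrier H" "y \<in> carrier H" using x y A_sub by auto
  have Y: "collect a u \<in> Y" if "a \<in> carrier H" "u \<in> Y" for a u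
    using bij_betw_apply[OF collect_bij[OF that(1)] that(2)] .
  consider "pos x < pos y" | "pos y < pos x" | "x = y" using pos[OF x] pos[OF y] by (metis linorder_neqE_nat)
  then show ?thesis
  proof cases
    case 2
    then have "collect y (collect x v) = tr (w (fg y) (fg x)) (collect x (collect y v))"
      by (rule collect_swap_less[OF y x _ v])
    then show ?thesis
      using H v Y w_swap[of "fg x" "fg y"] by (simp add: tr_tr)
  qed (use H v Y collect_swap_less[OF x y _ v] in \<open>auto simp: w_self\<close>)
qed

end

locale collection_action = collection +
  fixes \<theta> assumes action: "group_action F Y \<theta>"
    and \<theta>_gen: "x \<in> carrier H \<Longrightarrow> y \<in> Y \<Longrightarrow> \<theta> (fg x) y = collect x y"
begin

sublocale \<theta>: group_action F Y \<theta> by (rule action)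

lemma \<theta>_tr:
  assumes "a \<in> carrier F" "d \<in> carrier P" "y \<in> Y"
  shows "\<theta> a (tr d y) = tr (act a d) (\<theta> a y)"
proof -
  have "a \<in> generate F (fg ` carrier H)" using assms(1) free_group_generate by metis
  then have "a \<in> carrier F \<and> (\<forall>d\<in>carrier P. \<forall>y\<in>Y. \<theta> a (tr d y) = tr (act a d) (\<theta> a y))"
  proof induct
    case one
    then show ?case by (simp add: \<theta>.action_one)
  next
    case (incl h)
    then show ?case by (auto simp: \<theta>_gen collect_tr)
  next
    case (inv h)
    then obtain x where x: "x \<in> carrier H" "h = fg x" by blast
    then have h: "h \<in> carrier F" by simp
    show ?case
    proof (intro conjI ballI)
      fix d y assume d: "d \<in> carrier P" and y: "y \<in> Y"
      let ?d = "act (inv\<^bsub>F\<^esub> h) d" and ?y = "\<theta> (inv\<^bsub>F\<^esub> h) y"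
      have y': "?y \<in> Y" using h y by (intro \<theta>.action_closed) auto
      have "\<theta> h (tr ?d ?y) = tr (act h ?d) (\<theta> h ?y)"
        using x h d y' by (simp add: \<theta>_gen collect_tr)
      also have "\<dots> = tr d y" using h d y by (simp add: \<theta>.action_inv)
      finally have "\<theta> (inv\<^bsub>F\<^esub> h) (\<theta> h (tr ?d ?y)) = \<theta> (inv\<^bsub>F\<^esub> h) (tr d y)" by simp
      then show "\<theta> (inv\<^bsub>F\<^esub> h) (tr d y) = tr ?d ?y" using h d y' by (simp add: \<theta>.action_inv)
    qed (use h in simp)
  next
    case (eng a b)
    then show ?case by (auto simp: \<theta>.composition_rule \<theta>.action_closed act_act)
  qed
  then show ?thesis using assms by blast
qed

text \<open>An inverse-free way to say that the commutator of \<open>a\<close> and \<open>b\<close>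
  acts as translation by \<open>w a b\<close>; this form extends along products.\<close>

definition swaps where
  "swaps a b \<longleftrightarrow> (\<forall>y\<in>Y. \<theta> a (\<theta> b y) = tr (w a b) (\<theta> b (\<theta> a y)))"

lemma swaps_sym:
  assumes "a \<in> carrier F" "b \<in> carrier F" "swaps a b" shows "swaps b a"
  using assms by (auto simp: swaps_def w_swap[of a b] tr_tr \<theta>.action_closed)

text \<open>The property is multiplicative in \<open>a\<close>: moving \<open>a\<close> past a
  translation twists it by \<open>act a\<close>, and the factors recombine by \<open>w_left\<close>.
  For inverses, \<open>act_w_inv\<close> plays this part.\<close>

lemma swaps_generate:
  assumes B: "B \<subseteq> carrier F" and b: "b \<in> carrier F"
    and gen: "\<And>a. a \<in> B \<Longrightarrow> swaps a b" and a: "a \<in> generate F B"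
  shows "swaps a b"
proof -
  have "a \<in> carrier F \<and> swaps a b" using a
  proof induct
    case one
    then show ?case using b by (simp add: swaps_def \<theta>.action_one \<theta>.action_closed)
  next
    case (incl h)
    then show ?case using gen B by blast
  next
    case (inv h)
    then have h: "h \<in> carrier F" "swaps h b" using gen B by auto
    have "\<theta> (inv\<^bsub>F\<^esub> h) (\<theta> b y) = tr (w (inv\<^bsub>F\<^esub> h) b) (\<theta> b (\<theta> (inv\<^bsub>F\<^esub> h) y))" if y: "y \<in> Y" for y
    proof -
      let ?i = "inv\<^bsub>F\<^esub> h"
      have i: "?i \<in> carrier F" using h by simp
      have cl: "\<theta> ?i y \<in> Y" "\<theta> b y \<in> Y" "\<theta> ?i (\<theta> b y) \<in> Y" "\<theta> b (\<theta> ?i y) \<in> Y"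
        using b i y by (simp_all add: \<theta>.action_closed)
      have "\<theta> h (\<theta> b (\<theta> ?i y)) = tr (w h b) (\<theta> b (\<theta> h (\<theta> ?i y)))"
        using h cl unfolding swaps_def by blast
      also have "\<dots> = tr (w h b) (\<theta> b y)" using h y by (simp add: \<theta>.action_inv)
      finally have "\<theta> ?i (\<theta> h (\<theta> b (\<theta> ?i y))) = \<theta> ?i (tr (w h b) (\<theta> b y))" by simp
      then have "\<theta> b (\<theta> ?i y) = tr (act ?i (w h b)) (\<theta> ?i (\<theta> b y))"
        using h b i cl by (simp add: \<theta>.action_inv \<theta>_tr)
      moreover have "w ?i b = inv\<^bsub>P\<^esub> (act ?i (w h b))"
        using act_w_inv(1)[of ?i b] h b by (simp add: act_inv)
      ultimately show ?thesis using h b i cl by (simp add: tr_tr)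
    qed
    then show ?case using h by (simp add: swaps_def)
  next
    case (eng a a')
    then have a: "a \<in> carrier F" "a' \<in> carrier F" "swaps a b" "swaps a' b" by auto
    have "\<theta> (a \<otimes>\<^bsub>F\<^esub> a') (\<theta> b y) = tr (w (a \<otimes>\<^bsub>F\<^esub> a') b) (\<theta> b (\<theta> (a \<otimes>\<^bsub>F\<^esub> a') y))" if y: "y \<in> Y" for y
    proof -
      have cl: "\<theta> a' y \<in> Y" "\<theta> b y \<in> Y" "\<theta> b (\<theta> a' y) \<in> Y" "\<theta> a (\<theta> a' y) \<in> Y" "\<theta> b (\<theta> a (\<theta> a' y)) \<in> Y"
        using a b y by (simp_all add: \<theta>.action_closed)
      have "\<theta> (a \<otimes>\<^bsub>F\<^esub> a') (\<theta> b y) = \<theta> a (\<theta> a' (\<theta> b y))"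
        using a cl by (simp add: \<theta>.composition_rule)
      also have "\<dots> = tr (act a (w a' b)) (\<theta> a (\<theta> b (\<theta> a' y)))"
        using a b y cl by (simp add: swaps_def \<theta>_tr)
      also have "\<dots> = tr (act a (w a' b)) (tr (w a b) (\<theta> b (\<theta> a (\<theta> a' y))))"
        using a(3) cl unfolding swaps_def by simp
      also have "\<dots> = tr (w (a \<otimes>\<^bsub>F\<^esub> a') b) (\<theta> b (\<theta> (a \<otimes>\<^bsub>F\<^esub> a') y))"
        using a b y cl by (simp add: tr_tr w_left \<theta>.composition_rule)
      finally show ?thesis .
    qed
    then show ?case using a by (simp add: swaps_def)
  qed
  then show ?thesis by simp
qed

text \<open>Extend one argument from generators, exchange the arguments by \<open>swaps_sym\<close>,
  and extend the other. The restriction to \<open>A\<close> is essential, since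
  \<open>collect_swap\<close> concerns collected generators.\<close>

lemma swaps_all:
  assumes "a \<in> generate F (fg ` A)" "b \<in> generate F (fg ` A)" shows "swaps a b"
proof -
  have sub: "fg ` A \<subseteq> carrier F" using A_sub by auto
  have gg: "swaps x y" if xy: "x \<in> fg ` A" "y \<in> fg ` A" for x y
  proof -
    obtain u v where uv: "x = fg u" "y = fg v" "u \<in> A" "v \<in> A" using xy by blast
    then have H: "u \<in> carrier H" "v \<in> carrier H" using A_sub by auto
    have "collect t r \<in> Y" if "t \<in> carrier H" "r \<in> Y" for t r
      using bij_betw_apply[OF collect_bij[OF that(1)] that(2)] .
    then show ?thesis
      using uv H collect_swap[OF uv(3,4)] by (simp add: swaps_def \<theta>_gen)
  qed
  have gen: "generate F (fg ` A) \<subseteq> carrier F" by (rule G.generate_incl[OF sub])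
  have "swaps x b" if x: "x \<in> fg ` A" for x
  proof (rule swaps_sym)
    show "swaps b x" by (rule swaps_generate[OF sub _ gg[OF _ x] assms(2)]) (use x sub in auto)
  qed (use x sub assms gen in auto)
  then show ?thesis using assms gen by (intro swaps_generate[OF sub _ _ assms(1)]) auto
qed

text \<open>Both sides are multiplicative in \<open>c\<close> and agree on every
  \<open>w a b\<close> by \<open>swaps_all\<close>.\<close>

lemma \<theta>_mu:
  assumes "c \<in> generate P {w x y | x y. x \<in> generate F (fg ` A) \<and> y \<in> generate F (fg ` A)}"
    and "y \<in> Y"
  shows "\<theta> (\<mu> c) y = tr c y"
proof -
  have gen: "generate F (fg ` A) \<subseteq> carrier F"
    using A_sub by (intro G.generate_incl) auto
  have step: "\<theta> (commutator F a b) y = tr (w a b) y"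
    if ab: "a \<in> generate F (fg ` A)" "b \<in> generate F (fg ` A)" and y: "y \<in> Y" for a b y
  proof -
    have c: "a \<in> carrier F" "b \<in> carrier F" using ab gen by auto
    \<comment> \<open>Chosen so that b a carries it to \<open>y\<close>; then a b carries it to the
      image of \<open>y\<close> under the commutator.\<close>
    let ?y = "\<theta> (inv\<^bsub>F\<^esub> (b \<otimes>\<^bsub>F\<^esub> a)) y"
    have y': "?y \<in> Y" using c y by (intro \<theta>.action_closed) auto
    have ba: "\<theta> b (\<theta> a ?y) = y"
      using c y y' \<theta>.action_inv(1)[of "b \<otimes>\<^bsub>F\<^esub> a" y] \<theta>.composition_rule[OF y' c(2,1)] by simp
    have "commutator F a b = a \<otimes>\<^bsub>F\<^esub> b \<otimes>\<^bsub>F\<^esub> inv\<^bsub>F\<^esub> (b \<otimes>\<^bsub>F\<^esub> a)"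
      using c by (simp add: G.word_simps)
    then have "\<theta> (commutator F a b) y = \<theta> (a \<otimes>\<^bsub>F\<^esub> b) ?y"
      using c y \<theta>.composition_rule[of y "a \<otimes>\<^bsub>F\<^esub> b" "inv\<^bsub>F\<^esub> (b \<otimes>\<^bsub>F\<^esub> a)"] by simp
    also have "\<dots> = \<theta> a (\<theta> b ?y)" using c y' by (simp add: \<theta>.composition_rule)
    also have "\<dots> = tr (w a b) y" using swaps_all[OF ab] y' ba unfolding swaps_def by simp
    finally show ?thesis .
  qed
  have "c \<in> carrier P \<and> (\<forall>y\<in>Y. \<theta> (\<mu> c) y = tr c y)"
    using assms(1)
  proof induct
    case one
    then show ?case by (simp add: \<theta>.action_one)
  next
    case (incl h)
    then obtain a b where "h = w a b" "a \<in> generate F (fg ` A)" "b \<in> generate F (fg ` A)" by blast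
    moreover then have "a \<in> carrier F" "b \<in> carrier F" using gen by auto
    ultimately show ?case using step by (simp add: mu_w)
  next
    case (inv h)
    then obtain a b where h: "h = w a b" "a \<in> generate F (fg ` A)" "b \<in> generate F (fg ` A)" by blast
    then have ab: "a \<in> carrier F" "b \<in> carrier F" using gen by auto
    then have hP: "h \<in> carrier P" using h by simp
    have "\<theta> (\<mu> (inv\<^bsub>P\<^esub> h)) y = tr (inv\<^bsub>P\<^esub> h) y" if y: "y \<in> Y" for y
    proof (rule tr_cancel[OF hP _ y])
      let ?y = "\<theta> (inv\<^bsub>F\<^esub> (\<mu> h)) y"
      have y': "?y \<in> Y" using hP y by (intro \<theta>.action_closed) auto
      then show "\<theta> (\<mu> (inv\<^bsub>P\<^esub> h)) y \<in> Y" using hP by simp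
      have "tr h ?y = \<theta> (\<mu> h) ?y" using step[OF h(2,3) y'] h ab by (simp add: mu_w)
      then show "tr h (\<theta> (\<mu> (inv\<^bsub>P\<^esub> h)) y) = y" using hP y by (simp add: \<theta>.action_inv)
    qed
    then show ?case using hP by simp
  next
    case (eng h1 h2)
    then show ?case by (simp add: \<theta>.composition_rule tr_tr)
  qed
  then show ?thesis using assms(2) by blast
qed

end

definition exterior_injective :: "'a uni monoid \<Rightarrow> bool" where
  "exterior_injective G \<longleftrightarrow>
    (\<forall>c\<in>carrier (exterior_square G). exterior_mu G c = \<one>\<^bsub>G\<^esub> \<longrightarrow> c = \<one>\<^bsub>exterior_square G\<^esub>)"

text \<open>If \<mu> c is trivial, then translation by c fixes the state with trivial first
  coordinate, while it moves that coordinate to c.\<close>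

lemma exterior_injective_free: "exterior_injective (free_group H)"
proof -
  interpret free_exterior H
    by (intro free_exterior.intro exterior.intro free_group_group)
  have "c = \<one>\<^bsub>P\<^esub>" if c: "c \<in> carrier P" "\<mu> c = \<one>\<^bsub>F\<^esub>" for c
  proof -
    obtain A where A: "finite A" "A \<subseteq> carrier H"
      "c \<in> generate P {w x y | x y. x \<in> generate F (fg ` A) \<and> y \<in> generate F (fg ` A)}"
      using finite_support[OF c(1)] by blast
    obtain e :: "nat \<Rightarrow> 'a uni" where "bij_betw e {..<card A} A"
      using ex_bij_betw_nat_finite[OF A(1)] by (auto simp: atLeast0LessThan)
    then interpret collection H A e "card A" by unfold_locales (use A in auto)
    obtain \<theta> where \<theta>: "group_action F Y \<theta>"
      "\<And>x y. x \<in> carrier H \<Longrightarrow> y \<in> Y \<Longrightarrow> \<theta> (fg x) y = collect x y"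
      using free_group_action[of H collect Y, OF collect_bij] by blast
    then interpret collection_action H A e "card A" \<theta>
      by (intro collection_action.intro collection_action_axioms.intro collection_axioms)
    let ?y = "(\<one>\<^bsub>P\<^esub>, \<lambda>_. 0)"
    have y: "?y \<in> Y" by (simp add: Y_def)
    have "tr c ?y = \<theta> \<one>\<^bsub>F\<^esub> ?y" using \<theta>_mu[OF A(3) y] c(2) by simp
    also have "\<dots> = ?y" by (rule \<theta>.action_one[OF y])
    finally show ?thesis using c by (simp add: tr_def)
  qed
  then show ?thesis unfolding exterior_injective_def square_eq \<mu>_def by blast
qed

lemma (in group)
  assumes "subgroup M G" "a \<in> M" "b \<in> M"
  shows conjugate_consistent: "conjugate (G\<lparr>carrier := M\<rparr>) a b = conjugate G a b"
    and commutator_consistent: "commutator (G\<lparr>carrier := M\<rparr>) a b = commutator G a b"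
  using assms by (simp_all add: conjugate_def commutator_def)

section \<open>Naturality of the exterior square and retracts\<close>

locale exterior_map = A: exterior A + K: exterior K + f: group_hom A K f
  for A K :: "'a uni monoid" and f
begin

definition emap where "emap = hom_extend K.P (\<lambda>s. K.w (f (left s)) (f (right s)))"

lemma
  shows emap_hom: "group_hom A.P K.P emap"
    and emap_w: "x \<in> carrier A \<Longrightarrow> y \<in> carrier A \<Longrightarrow> emap (A.w x y) = K.w (f x) (f y)"
proof -
  have closed: "K.w (f x) (f y) \<in> carrier K.P" if "x \<in> carrier A" "y \<in> carrier A" for x y
    using that by simp
  have 1: "K.w (f (x \<otimes>\<^bsub>A\<^esub> x')) (f y)
      = K.w (f (conjugate A x x')) (f (conjugate A x y)) \<otimes>\<^bsub>K.P\<^esub> K.w (f x) (f y)"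
    if "x \<in> carrier A" "x' \<in> carrier A" "y \<in> carrier A" for x x' y
    using that by (simp add: K.w_mult_left f.hom_conjugate)
  have 2: "K.w (f x) (f (y \<otimes>\<^bsub>A\<^esub> y'))
      = K.w (f x) (f y) \<otimes>\<^bsub>K.P\<^esub> K.w (f (conjugate A y x)) (f (conjugate A y y'))"
    if "x \<in> carrier A" "y \<in> carrier A" "y' \<in> carrier A" for x y y'
    using that by (simp add: K.w_mult_right f.hom_conjugate)
  have 3: "K.w (f x) (f x) = \<one>\<^bsub>K.P\<^esub>" if "x \<in> carrier A" for x
    using that by (simp add: K.w_self)
  show "group_hom A.P K.P emap"
    unfolding emap_def
    by (rule A.exterior_hom[where \<phi> = "\<lambda>x y. K.w (f x) (f y)", OF K.group_P closed 1 2 3])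
  show "x \<in> carrier A \<Longrightarrow> y \<in> carrier A \<Longrightarrow> emap (A.w x y) = K.w (f x) (f y)"
    unfolding emap_def
    by (rule A.exterior_hom_w[where \<phi> = "\<lambda>x y. K.w (f x) (f y)", OF K.group_P closed 1 2 3])
qed

lemma mu_emap: "c \<in> carrier A.P \<Longrightarrow> K.\<mu> (emap c) = f (A.\<mu> c)"
  by (rule A.hom_eq_w[OF group_hom.hom_comp[OF emap_hom K.mu_hom]
        group_hom.hom_comp[OF A.mu_hom f.group_hom_axioms]])
     (simp_all add: emap_w A.mu_w K.mu_w f.hom_commutator)

end

lemma exterior_mapI: "group_hom A K f \<Longrightarrow> exterior_map A K f"
  by (intro exterior_map.intro exterior.intro) (auto dest: group_hom.axioms)

text \<open>Naturality sends the kernel of \<mu> over \<open>A\<close> into the kernel over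
  \<open>K\<close>, which is trivial, and the map induced by \<open>\<rho>\<close> brings the
  element back unchanged.\<close>

lemma exterior_injective_retract:
  fixes A K :: "'a uni monoid"
  assumes \<sigma>: "group_hom A K \<sigma>" and \<rho>: "group_hom K A \<rho>"
    and retract: "\<And>x. x \<in> carrier A \<Longrightarrow> \<rho> (\<sigma> x) = x"
    and inj: "exterior_injective K"
  shows "exterior_injective A"
proof -
  interpret s: exterior_map A K \<sigma> by (rule exterior_mapI[OF \<sigma>])
  interpret r: exterior_map K A \<rho> by (rule exterior_mapI[OF \<rho>])
  interpret se: group_hom s.A.P s.K.P s.emap by (rule s.emap_hom)
  interpret re: group_hom s.K.P s.A.P r.emap by (rule r.emap_hom)
  have "c = \<one>\<^bsub>s.A.P\<^esub>" if c: "c \<in> carrier s.A.P" "s.A.\<mu> c = \<one>\<^bsub>A\<^esub>" for c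
  proof -
    have "s.K.\<mu> (s.emap c) = \<one>\<^bsub>K\<^esub>" using c by (simp add: s.mu_emap)
    then have "s.emap c = \<one>\<^bsub>s.K.P\<^esub>"
      using inj c unfolding exterior_injective_def s.K.square_eq s.K.\<mu>_def by simp
    moreover have "r.emap (s.emap c) = c"
      by (rule s.A.hom_eq_w[OF group_hom.hom_comp[OF s.emap_hom r.emap_hom]
            id_group_hom[OF s.A.group_P] _ c(1)])
         (simp add: s.emap_w r.emap_w retract)
    ultimately show ?thesis by simp
  qed
  then show ?thesis unfolding exterior_injective_def s.A.square_eq s.A.\<mu>_def by blast
qed


section \<open>Subgroups of free groups\<close>

text \<open>A subgroup \<open>M\<close> of a free group \<open>F\<close> is a retract of the free group on the set \<open>M\<close>: let \<open>F\<close> act on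
  pairs of a representative of a left coset of \<open>M\<close> and an element of that free group.\<close>

locale free_subgroup =
  fixes H :: "'a uni monoid" and M :: "'a uni set"
  assumes subgroup_M: "subgroup M (free_group H)"
begin

abbreviation F where "F \<equiv> free_group H"
abbreviation N where "N \<equiv> F\<lparr>carrier := M\<rparr>"

sublocale F: group F by (rule free_group_group)
sublocale M: subgroup M F by (rule subgroup_M)
sublocale N: group N by (rule F.subgroup_imp_group[OF subgroup_M])
sublocale PN: group "\<P> N" by (rule free_group_group)
sublocale counit: group_hom "\<P> N" N "counit N" by (rule counit_hom[OF N.group_axioms])

text \<open>The coset \<open>M\<close> gets the representative 1, so that \<open>M\<close> preserves
  the states over 1, where the section is read off.\<close>

definition rep where
  "rep f = (if f \<in> M then \<one>\<^bsub>F\<^esub> else SOME r. r \<in> f <#\<^bsub>F\<^esub> M)"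

lemma mem_coset: "m \<in> M \<Longrightarrow> f \<otimes>\<^bsub>F\<^esub> m \<in> f <#\<^bsub>F\<^esub> M"
  by (auto simp: l_coset_def)

lemma rep_mem: assumes "f \<in> carrier F" shows "rep f \<in> f <#\<^bsub>F\<^esub> M"
proof (cases "f \<in> M")
  case True
  then have "f \<otimes>\<^bsub>F\<^esub> inv\<^bsub>F\<^esub> f \<in> f <#\<^bsub>F\<^esub> M" by (intro mem_coset M.m_inv_closed)
  then show ?thesis using True assms by (simp add: rep_def)
next
  case False
  have "f \<otimes>\<^bsub>F\<^esub> \<one>\<^bsub>F\<^esub> \<in> f <#\<^bsub>F\<^esub> M" by (rule mem_coset[OF M.one_closed])
  then have "(SOME r. r \<in> f <#\<^bsub>F\<^esub> M) \<in> f <#\<^bsub>F\<^esub> M" by (rule someI)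
  then show ?thesis using False by (simp add: rep_def)
qed

lemma rep_closed [simp]: "f \<in> carrier F \<Longrightarrow> rep f \<in> carrier F"
  using rep_mem[of f] F.l_coset_subset_G[OF M.subset, of f] by blast

lemma rep_inv_mult:
  assumes "f \<in> carrier F" shows "inv\<^bsub>F\<^esub> (rep f) \<otimes>\<^bsub>F\<^esub> f \<in> M"
proof -
  obtain m where m: "m \<in> M" "rep f = f \<otimes>\<^bsub>F\<^esub> m" using rep_mem[OF assms] by (auto simp: l_coset_def)
  then have "inv\<^bsub>F\<^esub> (rep f) \<otimes>\<^bsub>F\<^esub> f = inv\<^bsub>F\<^esub> m" using assms by (simp add: F.word_simps)
  then show ?thesis using m by simp
qed

lemma rep_mult:
  assumes f: "f \<in> carrier F" and m: "m \<in> M" shows "rep (f \<otimes>\<^bsub>F\<^esub> m) = rep f"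
proof -
  have "f \<otimes>\<^bsub>F\<^esub> m \<in> M \<longleftrightarrow> f \<in> M"
  proof
    assume "f \<otimes>\<^bsub>F\<^esub> m \<in> M"
    then have "f \<otimes>\<^bsub>F\<^esub> m \<otimes>\<^bsub>F\<^esub> inv\<^bsub>F\<^esub> m \<in> M" using m by simp
    then show "f \<in> M" using f m by (simp add: F.m_assoc)
  qed (use m in simp)
  moreover have "f \<otimes>\<^bsub>F\<^esub> m \<in> f <#\<^bsub>F\<^esub> M" by (rule mem_coset[OF m])
  then have "f <#\<^bsub>F\<^esub> M = (f \<otimes>\<^bsub>F\<^esub> m) <#\<^bsub>F\<^esub> M" by (rule F.l_repr_independence[OF _ f subgroup_M])
  ultimately show ?thesis by (simp add: rep_def)
qed

lemma rep_mult_rep: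
  assumes "x \<in> carrier F" "f \<in> carrier F" shows "rep (x \<otimes>\<^bsub>F\<^esub> rep f) = rep (x \<otimes>\<^bsub>F\<^esub> f)"
proof -
  have "rep (x \<otimes>\<^bsub>F\<^esub> rep f \<otimes>\<^bsub>F\<^esub> (inv\<^bsub>F\<^esub> (rep f) \<otimes>\<^bsub>F\<^esub> f)) = rep (x \<otimes>\<^bsub>F\<^esub> rep f)"
    using assms by (intro rep_mult rep_inv_mult) auto
  then show ?thesis using assms by (simp add: F.m_assoc)
qed

lemma rep_M: "m \<in> M \<Longrightarrow> rep m = \<one>\<^bsub>F\<^esub>"
  by (simp add: rep_def)

definition trv where "trv = {r \<in> carrier F. rep r = r}"

definition Y where "Y = trv \<times> carrier (\<P> N)"

text \<open>The Schreier cocycle of the transversal. For a product a b at r it is the cocycle of a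
  at \<open>rep\<close> (b r) times the cocycle of b at r.\<close>

definition cocycle where
  "cocycle a r = inv\<^bsub>F\<^esub> (rep (a \<otimes>\<^bsub>F\<^esub> r)) \<otimes>\<^bsub>F\<^esub> (a \<otimes>\<^bsub>F\<^esub> r)"

lemma cocycle_mem: "a \<in> carrier F \<Longrightarrow> r \<in> trv \<Longrightarrow> cocycle a r \<in> M"
  unfolding cocycle_def by (intro rep_inv_mult) (auto simp: trv_def)

lemma rep_trv: "f \<in> carrier F \<Longrightarrow> rep f \<in> trv"
  using rep_mult_rep[of "\<one>\<^bsub>F\<^esub>" f] by (simp add: trv_def)

text \<open>\<open>F\<close> permutes cosets and multiplies by the cocycle; here the cocycle in
  \<open>M\<close> is replaced by its formal generator in \<open>\<P> N\<close>. Freeness of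
  \<open>F\<close> turns these bijections, one for each generator, into an action.\<close>

definition st where
  "st x = (\<lambda>(r, c). (rep (free_gen H x \<otimes>\<^bsub>F\<^esub> r),
     free_gen N (cocycle (free_gen H x) r) \<otimes>\<^bsub>\<P> N\<^esub> c))"

lemma gen_cocycle_closed:
  "a \<in> carrier F \<Longrightarrow> r \<in> trv \<Longrightarrow> free_gen N (cocycle a r) \<in> carrier (\<P> N)"
  using cocycle_mem by (intro free_gen_closed) simp

lemma rep_back:
  assumes "g \<in> carrier F" "r \<in> trv"
  shows "rep (g \<otimes>\<^bsub>F\<^esub> rep (inv\<^bsub>F\<^esub> g \<otimes>\<^bsub>F\<^esub> r)) = r" "rep (inv\<^bsub>F\<^esub> g \<otimes>\<^bsub>F\<^esub> rep (g \<otimes>\<^bsub>F\<^esub> r)) = r"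
  using assms by (simp_all add: rep_mult_rep trv_def)

lemma st_bij:
  assumes "x \<in> carrier H" shows "bij_betw (st x) Y Y"
proof -
  let ?g = "free_gen H x"
  have g: "?g \<in> carrier F" using assms by simp
  let ?b = "\<lambda>(r, c). (rep (inv\<^bsub>F\<^esub> ?g \<otimes>\<^bsub>F\<^esub> r),
    inv\<^bsub>\<P> N\<^esub> (free_gen N (cocycle ?g (rep (inv\<^bsub>F\<^esub> ?g \<otimes>\<^bsub>F\<^esub> r)))) \<otimes>\<^bsub>\<P> N\<^esub> c)"
  have "rep (?g \<otimes>\<^bsub>F\<^esub> r) \<in> trv" "rep (inv\<^bsub>F\<^esub> ?g \<otimes>\<^bsub>F\<^esub> r) \<in> trv"
    "free_gen N (cocycle ?g r) \<in> carrier (\<P> N)" if "r \<in> trv" for r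
  proof -
    have "r \<in> carrier F" using that by (simp add: trv_def)
    then show "rep (?g \<otimes>\<^bsub>F\<^esub> r) \<in> trv" "rep (inv\<^bsub>F\<^esub> ?g \<otimes>\<^bsub>F\<^esub> r) \<in> trv"
      using g by (simp_all add: rep_trv)
    show "free_gen N (cocycle ?g r) \<in> carrier (\<P> N)" by (rule gen_cocycle_closed[OF g that])
  qed
  then show ?thesis
    by (intro bij_betw_byWitness[of _ ?b]) (use g in \<open>auto simp: Y_def st_def rep_back\<close>)
qed

text \<open>Each element acts on the fibre over a representative as left multiplication by some
  \<kappa> whose counit is the cocycle. For m in \<open>M\<close> over the representative 1 the
  cocycle is m itself, so \<kappa> is a lift of m, multiplicative because the action is.\<close>

lemma section_exists:
  obtains \<sigma> where "group_hom N (\<P> N) \<sigma>" "\<And>m. m \<in> M \<Longrightarrow> counit N (\<sigma> m) = m"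
proof -
  obtain \<theta> where \<theta>: "group_action F Y \<theta>"
    and \<theta>_gen: "\<And>x y. x \<in> carrier H \<Longrightarrow> y \<in> Y \<Longrightarrow> \<theta> (free_gen H x) y = st x y"
    using free_group_action[of H st Y, OF st_bij] by blast
  interpret \<theta>: group_action F Y \<theta> by (rule \<theta>)
  have t: "r \<in> trv \<Longrightarrow> r \<in> carrier F" for r by (simp add: trv_def)
  let ?P = "\<lambda>a. \<forall>r\<in>trv. \<exists>\<kappa>\<in>carrier (\<P> N). counit N \<kappa> = cocycle a r \<and>
      (\<forall>c\<in>carrier (\<P> N). \<theta> a (r, c) = (rep (a \<otimes>\<^bsub>F\<^esub> r), \<kappa> \<otimes>\<^bsub>\<P> N\<^esub> c))"
  have step: "?P (free_gen H x)" if x: "x \<in> carrier H" for x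
  proof
    fix r assume r: "r \<in> trv"
    let ?k = "free_gen N (cocycle (free_gen H x) r)"
    have "counit N ?k = cocycle (free_gen H x) r"
      using counit_gen[OF N.group_axioms, of "cocycle (free_gen H x) r"] cocycle_mem r x by simp
    moreover have "?k \<in> carrier (\<P> N)" using gen_cocycle_closed r x by simp
    ultimately show "\<exists>\<kappa>\<in>carrier (\<P> N). counit N \<kappa> = cocycle (free_gen H x) r \<and>
      (\<forall>c\<in>carrier (\<P> N). \<theta> (free_gen H x) (r, c) = (rep (free_gen H x \<otimes>\<^bsub>F\<^esub> r), \<kappa> \<otimes>\<^bsub>\<P> N\<^esub> c))"
      using r x by (intro bexI[of _ ?k]) (auto simp: \<theta>_gen Y_def st_def)
  qed
  have val: "?P a" if a: "a \<in> carrier F" for a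
  proof -
    have "a \<in> generate F (free_gen H ` carrier H)" using a free_group_generate by metis
    then have "a \<in> carrier F \<and> ?P a"
    proof induct
      case one
      show ?case
      proof (intro conjI ballI bexI[of _ "\<one>\<^bsub>\<P> N\<^esub>"])
        fix r c assume "r \<in> trv" "c \<in> carrier (\<P> N)"
        then show "\<theta> \<one>\<^bsub>F\<^esub> (r, c) = (rep (\<one>\<^bsub>F\<^esub> \<otimes>\<^bsub>F\<^esub> r), \<one>\<^bsub>\<P> N\<^esub> \<otimes>\<^bsub>\<P> N\<^esub> c)"
          using \<theta>.action_one[of "(r, c)"] by (simp add: Y_def trv_def)
      next
        fix r assume "r \<in> trv"
        then show "counit N \<one>\<^bsub>\<P> N\<^esub> = cocycle \<one>\<^bsub>F\<^esub> r"
          using counit.hom_one by (simp add: cocycle_def trv_def)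
      qed auto
    next
      case (incl h)
      then show ?case using step by auto
    next
      case (inv h)
      then obtain x where x: "x \<in> carrier H" "h = free_gen H x" by blast
      then have h: "h \<in> carrier F" by simp
      have "\<exists>\<kappa>\<in>carrier (\<P> N). counit N \<kappa> = cocycle (inv\<^bsub>F\<^esub> h) r \<and>
        (\<forall>c\<in>carrier (\<P> N). \<theta> (inv\<^bsub>F\<^esub> h) (r, c) = (rep (inv\<^bsub>F\<^esub> h \<otimes>\<^bsub>F\<^esub> r), \<kappa> \<otimes>\<^bsub>\<P> N\<^esub> c))"
        if r: "r \<in> trv" for r
      proof -
        \<comment> \<open>The fibre that \<open>h\<close> carries onto the one over r; the
          multiplier of the inverse at r is the inverse of the multiplier of \<open>h\<close>
          there.\<close>
        let ?r = "rep (inv\<^bsub>F\<^esub> h \<otimes>\<^bsub>F\<^esub> r)"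
        have r': "?r \<in> trv" using h t[OF r] by (intro rep_trv) auto
        obtain \<kappa> where k: "\<kappa> \<in> carrier (\<P> N)" "counit N \<kappa> = cocycle h ?r"
          and val: "\<And>c. c \<in> carrier (\<P> N) \<Longrightarrow>
            \<theta> h (?r, c) = (rep (h \<otimes>\<^bsub>F\<^esub> ?r), \<kappa> \<otimes>\<^bsub>\<P> N\<^esub> c)"
          using step[OF x(1)] r' unfolding x(2) by blast
        have "\<theta> (inv\<^bsub>F\<^esub> h) (r, c) = (?r, inv\<^bsub>\<P> N\<^esub> \<kappa> \<otimes>\<^bsub>\<P> N\<^esub> c)"
          if c: "c \<in> carrier (\<P> N)" for c
        proof -
          let ?c = "inv\<^bsub>\<P> N\<^esub> \<kappa> \<otimes>\<^bsub>\<P> N\<^esub> c"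
          have "\<theta> h (?r, ?c) = (r, c)"
            using val[of ?c] k c rep_back(1)[OF h r] by simp
          moreover have "(?r, ?c) \<in> Y" using k c r' by (simp add: Y_def)
          ultimately show ?thesis using \<theta>.action_inv(2)[OF h, of "(?r, ?c)"] by simp
        qed
        moreover have "counit N (inv\<^bsub>\<P> N\<^esub> \<kappa>) = cocycle (inv\<^bsub>F\<^esub> h) r"
        proof -
          have "counit N (inv\<^bsub>\<P> N\<^esub> \<kappa>) = inv\<^bsub>F\<^esub> (cocycle h ?r)"
            using k cocycle_mem[OF h r'] F.m_inv_consistent[OF subgroup_M] by simp
          also have "\<dots> = cocycle (inv\<^bsub>F\<^esub> h) r"
            using h r t[OF r] t[OF r'] rep_back(1)[OF h r]
            by (simp add: cocycle_def F.inv_mult_group F.m_assoc)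
          finally show ?thesis .
        qed
        ultimately show ?thesis using k by (intro bexI[of _ "inv\<^bsub>\<P> N\<^esub> \<kappa>"]) auto
      qed
      then show ?case using h by simp
    next
      case (eng a b)
      have "\<exists>\<kappa>\<in>carrier (\<P> N). counit N \<kappa> = cocycle (a \<otimes>\<^bsub>F\<^esub> b) r \<and>
        (\<forall>c\<in>carrier (\<P> N). \<theta> (a \<otimes>\<^bsub>F\<^esub> b) (r, c) = (rep (a \<otimes>\<^bsub>F\<^esub> b \<otimes>\<^bsub>F\<^esub> r), \<kappa> \<otimes>\<^bsub>\<P> N\<^esub> c))"
        if r: "r \<in> trv" for r
      proof -
        have ab: "a \<in> carrier F" "b \<in> carrier F" using eng by auto
        let ?r = "rep (b \<otimes>\<^bsub>F\<^esub> r)"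
        have r': "?r \<in> trv" using ab t[OF r] by (intro rep_trv) auto
        obtain \<kappa>b where kb: "\<kappa>b \<in> carrier (\<P> N)" "counit N \<kappa>b = cocycle b r"
          "\<And>c. c \<in> carrier (\<P> N) \<Longrightarrow> \<theta> b (r, c) = (?r, \<kappa>b \<otimes>\<^bsub>\<P> N\<^esub> c)"
          using eng r by blast
        obtain \<kappa>a where ka: "\<kappa>a \<in> carrier (\<P> N)" "counit N \<kappa>a = cocycle a ?r"
          "\<And>c. c \<in> carrier (\<P> N) \<Longrightarrow> \<theta> a (?r, c) = (rep (a \<otimes>\<^bsub>F\<^esub> ?r), \<kappa>a \<otimes>\<^bsub>\<P> N\<^esub> c)"
          using eng r' by blast
        have reps: "rep (a \<otimes>\<^bsub>F\<^esub> ?r) = rep (a \<otimes>\<^bsub>F\<^esub> b \<otimes>\<^bsub>F\<^esub> r)"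
          using ab t[OF r] by (simp add: rep_mult_rep F.m_assoc)
        have "\<theta> (a \<otimes>\<^bsub>F\<^esub> b) (r, c) = (rep (a \<otimes>\<^bsub>F\<^esub> b \<otimes>\<^bsub>F\<^esub> r), \<kappa>a \<otimes>\<^bsub>\<P> N\<^esub> \<kappa>b \<otimes>\<^bsub>\<P> N\<^esub> c)"
          if c: "c \<in> carrier (\<P> N)" for c
          using \<theta>.composition_rule[of "(r, c)" a b] ab c r ka kb reps by (simp add: Y_def PN.m_assoc)
        moreover have "counit N (\<kappa>a \<otimes>\<^bsub>\<P> N\<^esub> \<kappa>b) = cocycle (a \<otimes>\<^bsub>F\<^esub> b) r"
        proof -
          have "counit N (\<kappa>a \<otimes>\<^bsub>\<P> N\<^esub> \<kappa>b) = cocycle a ?r \<otimes>\<^bsub>F\<^esub> cocycle b r"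
            using ka kb by simp
          also have "\<dots> = cocycle (a \<otimes>\<^bsub>F\<^esub> b) r"
            using ab t[OF r] t[OF r'] reps unfolding cocycle_def by (simp add: F.m_assoc)
          finally show ?thesis .
        qed
        ultimately show ?thesis using ka kb by (intro bexI[of _ "\<kappa>a \<otimes>\<^bsub>\<P> N\<^esub> \<kappa>b"]) auto
      qed
      then show ?case using eng by simp
    qed
    then show ?thesis by simp
  qed
  have one: "\<one>\<^bsub>F\<^esub> \<in> trv" by (simp add: trv_def rep_M)
  have "\<exists>\<kappa>\<in>carrier (\<P> N). counit N \<kappa> = m \<and>
      (\<forall>c\<in>carrier (\<P> N). \<theta> m (\<one>\<^bsub>F\<^esub>, c) = (\<one>\<^bsub>F\<^esub>, \<kappa> \<otimes>\<^bsub>\<P> N\<^esub> c))" if "m \<in> M" for m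
    using val[of m] one that by (force simp: cocycle_def rep_M)
  then obtain \<sigma> where \<sigma>: "\<And>m. m \<in> M \<Longrightarrow> \<sigma> m \<in> carrier (\<P> N)"
    "\<And>m. m \<in> M \<Longrightarrow> counit N (\<sigma> m) = m"
    "\<And>m c. m \<in> M \<Longrightarrow> c \<in> carrier (\<P> N) \<Longrightarrow> \<theta> m (\<one>\<^bsub>F\<^esub>, c) = (\<one>\<^bsub>F\<^esub>, \<sigma> m \<otimes>\<^bsub>\<P> N\<^esub> c)"
    by metis
  show thesis
  proof (rule that[of \<sigma>])
    show "group_hom N (\<P> N) \<sigma>"
    proof (intro group_homI N.group_axioms PN.group_axioms homI)
      fix m m' assume "m \<in> carrier N" "m' \<in> carrier N"
      then have m: "m \<in> M" "m' \<in> M" by auto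
      let ?y = "(\<one>\<^bsub>F\<^esub>, \<one>\<^bsub>\<P> N\<^esub>)"
      \<comment> \<open>Comparing second coordinates at the trivial element of \<open>\<P> N\<close>
        yields multiplicativity of \<sigma>.\<close>
      have "\<theta> (m \<otimes>\<^bsub>F\<^esub> m') ?y = \<theta> m (\<theta> m' ?y)"
        using m one by (intro \<theta>.composition_rule) (auto simp: Y_def)
      then show "\<sigma> (m \<otimes>\<^bsub>N\<^esub> m') = \<sigma> m \<otimes>\<^bsub>\<P> N\<^esub> \<sigma> m'"
        using m \<sigma> by simp
    qed (use \<sigma> in simp)
  qed (rule \<sigma>(2))
qed

lemma injective: "exterior_injective N"
proof (rule section_exists)
  fix \<sigma> assume "group_hom N (\<P> N) \<sigma>" "\<And>m. m \<in> M \<Longrightarrow> counit N (\<sigma> m) = m"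
  then show ?thesis
    by (intro exterior_injective_retract[OF _ counit.group_hom_axioms _ exterior_injective_free]) auto
qed

end

section \<open>The exterior powers as quotients of the derived series\<close>

declare exterior_power.simps(2) [simp del] exterior_mu_iter.simps(2) [simp del]

text \<open>Freeness of \<open>F0\<close> enters this section through \<open>injective\<close>,
  because each term of the derived series is a subgroup of \<open>F0\<close>.\<close>

locale exterior_resolution =
  truncated_resolution G F0 F1 F2 \<epsilon> d0 d1 e0 e1 e2 s t0 t1
  for G F0 F1 F2 :: "'a uni monoid" and \<epsilon> d0 d1 e0 e1 e2 s t0 t1 +
  assumes injective: "subgroup M F0 \<Longrightarrow> exterior_injective (F0\<lparr>carrier := M\<rparr>)"
begin

abbreviation \<Delta> :: "nat \<Rightarrow> 'a uni monoid \<Rightarrow> 'a uni set" where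
  "\<Delta> n K \<equiv> derived_series K (Suc n)"
abbreviation M where "M n \<equiv> F0\<lparr>carrier := \<Delta> n F0\<rparr>"
abbreviation E where "E n \<equiv> exterior_power G (Suc n)"
abbreviation m where "m n \<equiv> exterior_mu_iter G (Suc n)"

lemma
  shows delta_subset: "\<Delta> n F0 \<subseteq> carrier F0" "\<Delta> n F1 \<subseteq> carrier F1"
    and s_delta: "a \<in> \<Delta> n F0 \<Longrightarrow> s a \<in> \<Delta> n F1"
    and d_delta: "x \<in> \<Delta> n F1 \<Longrightarrow> d0 x \<in> \<Delta> n F0" "x \<in> \<Delta> n F1 \<Longrightarrow> d1 x \<in> \<Delta> n F0"
  using \<epsilon>.G.derived_series_normal[of n] d0.G.derived_series_normal[of n]
    functorial_normal.hom_mem[OF functorial_derived_series s.group_hom_axioms]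
    functorial_normal.hom_mem[OF functorial_derived_series d0.group_hom_axioms]
    functorial_normal.hom_mem[OF functorial_derived_series d1.group_hom_axioms]
  by (auto dest: normal_imp_subgroup subgroup.subset)

lemma delta_subgroup: "subgroup (\<Delta> n F0) F0"
  by (rule normal_imp_subgroup[OF \<epsilon>.G.derived_series_normal])

text \<open>As for the lower central series, but the degenerate entry \<open>s a\<close> must also
  lie in the current term. Both orders are stated because both arguments of an exterior product are
  lifted to the same group.\<close>

lemma B_delta_commutator:
  assumes b: "b \<in> B (\<Delta> n)" and a: "a \<in> \<Delta> n F0"
  shows "commutator F0 b a \<in> B (\<Delta> (Suc n))" "commutator F0 a b \<in> B (\<Delta> (Suc n))"
proof -
  obtain x where x: "x \<in> \<Delta> n F1" "d0 x = \<one>\<^bsub>F0\<^esub>" "b = d1 x" using b by (auto simp: B_def)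
  have c: "x \<in> carrier F1" "a \<in> carrier F0" using x(1) a delta_subset by blast+
  have "commutator F1 x (s a) \<in> \<Delta> (Suc n) F1" "commutator F1 (s a) x \<in> \<Delta> (Suc n) F1"
    unfolding derived_series_Suc(2) using x(1) s_delta[OF a]
    by (simp_all add: d0.G.commutator_mem_derived)
  moreover have "d0 (commutator F1 x (s a)) = \<one>\<^bsub>F0\<^esub>" "d0 (commutator F1 (s a) x) = \<one>\<^bsub>F0\<^esub>"
    using x(2) c by (simp_all add: commutator_def)
  ultimately have "d1 (commutator F1 x (s a)) \<in> B (\<Delta> (Suc n))" "d1 (commutator F1 (s a) x) \<in> B (\<Delta> (Suc n))"
    using B_I[where T = "\<Delta> (Suc n)"] by blast+
  then show "commutator F0 b a \<in> B (\<Delta> (Suc n))" "commutator F0 a b \<in> B (\<Delta> (Suc n))"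
    using x(3) c by (simp_all add: d1.hom_commutator)
qed

text \<open>Together the clauses say that \<open>p\<close> induces an isomorphism from
  \<open>\<Delta> n F0\<close> modulo \<open>B (\<Delta> n)\<close> to \<open>E n\<close>, turning
  \<epsilon> into \<open>m n\<close>. That \<open>p\<close> kills \<open>B\<close> is the case
  \<open>d0 x = 1\<close> of the equaliser clause, whose general form passes to commutators.\<close>

definition is_proj :: "nat \<Rightarrow> ('a uni \<Rightarrow> 'a uni) \<Rightarrow> bool" where
  "is_proj n p \<longleftrightarrow> group_hom (M n) (E n) p \<and> group_hom (E n) G (m n) \<and>
    p ` \<Delta> n F0 = carrier (E n) \<and>
    (\<forall>a\<in>\<Delta> n F0. m n (p a) = \<epsilon> a) \<and>
    (\<forall>x\<in>\<Delta> n F1. p (d0 x) = p (d1 x)) \<and>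
    (\<forall>a\<in>\<Delta> n F0. p a = \<one>\<^bsub>E n\<^esub> \<longrightarrow> a \<in> B (\<Delta> n))"

lemma proj_0: "is_proj 0 \<epsilon>"
proof -
  have "group_hom (M 0) (E 0) \<epsilon>"
    using \<epsilon>.group_hom_axioms by (simp add: derived_series_Suc)
  moreover have "group_hom (E 0) G (m 0)"
    using id_group_hom[OF \<epsilon>.H.group_axioms] by (simp add: id_def)
  ultimately show ?thesis
    unfolding is_proj_def using eps_surj by (simp add: derived_series_Suc B_carrier eps_d)
qed

text \<open>Injectivity of \<mu> identifies the exterior square of \<open>M n\<close> with its
  derived subgroup \<open>\<Delta> (Suc n) F0\<close>, so the map induced by \<open>p\<close> on
  exterior squares becomes \<open>p'\<close>. A map back from \<open>E (Suc n)\<close>, built from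
  commutators of lifts, bounds its kernel.\<close>

lemma proj_Suc:
  assumes "is_proj n p" shows "\<exists>p'. is_proj (Suc n) p'"
proof -
  interpret p: group_hom "M n" "E n" p using assms by (simp add: is_proj_def)
  interpret mn: group_hom "E n" G "m n" using assms by (simp add: is_proj_def)
  have p_surj: "p ` \<Delta> n F0 = carrier (E n)" and m_p: "\<And>a. a \<in> \<Delta> n F0 \<Longrightarrow> m n (p a) = \<epsilon> a"
    and p_d: "\<And>x. x \<in> \<Delta> n F1 \<Longrightarrow> p (d0 x) = p (d1 x)"
    and p_ker: "\<And>a. a \<in> \<Delta> n F0 \<Longrightarrow> p a = \<one>\<^bsub>E n\<^esub> \<Longrightarrow> a \<in> B (\<Delta> n)"
    using assms by (simp_all add: is_proj_def)
  interpret X: exterior_map "M n" "E n" p by (rule exterior_mapI) (rule p.group_hom_axioms)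
  interpret D: subgroup "\<Delta> n F0" F0 by (rule delta_subgroup)
  have comm_M: "commutator (M n) a b = commutator F0 a b" and conj_M: "conjugate (M n) a b = conjugate F0 a b"
    if "a \<in> \<Delta> n F0" "b \<in> \<Delta> n F0" for a b
    using \<epsilon>.G.commutator_consistent[OF delta_subgroup that] \<epsilon>.G.conjugate_consistent[OF delta_subgroup that]
    by auto
  have E_Suc: "E (Suc n) = X.K.P"
    by (simp add: exterior_power.simps(2) X.K.square_eq)
  have m_Suc: "m (Suc n) y = m n (X.K.\<mu> y)" for y
    by (simp add: exterior_mu_iter.simps(2) X.K.\<mu>_def)
  have inj: "inj_on X.A.\<mu> (carrier X.A.P)"
  proof (rule X.A.\<mu>.trivial_ker_imp_inj)
    have "\<forall>c\<in>carrier X.A.P. X.A.\<mu> c = \<one>\<^bsub>M n\<^esub> \<longrightarrow> c = \<one>\<^bsub>X.A.P\<^esub>"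
      using injective[OF delta_subgroup[of n]]
      unfolding exterior_injective_def X.A.square_eq X.A.\<mu>_def .
    then show "kernel X.A.P (M n) X.A.\<mu> = {\<one>\<^bsub>X.A.P\<^esub>}"
      by (auto simp: kernel_def)
  qed
  have gens: "{commutator (M n) x y |x y. x \<in> carrier (M n) \<and> y \<in> carrier (M n)}
      = {commutator F0 a b |a b. a \<in> \<Delta> n F0 \<and> b \<in> \<Delta> n F0}"
    using comm_M by (auto; metis)
  have img: "X.A.\<mu> ` carrier X.A.P = \<Delta> (Suc n) F0"
  proof -
    have "X.A.\<mu> ` carrier X.A.P
        = generate (M n) (X.A.\<mu> ` {X.A.w x y |x y. x \<in> carrier (M n) \<and> y \<in> carrier (M n)})"
      unfolding X.A.generate_w by (rule X.A.\<mu>.generate_img[symmetric]) auto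
    also have "X.A.\<mu> ` {X.A.w x y |x y. x \<in> carrier (M n) \<and> y \<in> carrier (M n)}
        = {commutator (M n) x y |x y. x \<in> carrier (M n) \<and> y \<in> carrier (M n)}"
    proof (intro equalityI subsetI)
      fix z assume "z \<in> {commutator (M n) x y |x y. x \<in> carrier (M n) \<and> y \<in> carrier (M n)}"
      then obtain x y where "z = X.A.\<mu> (X.A.w x y)" "x \<in> carrier (M n)" "y \<in> carrier (M n)"
        using X.A.mu_w by force
      then show "z \<in> X.A.\<mu> ` {X.A.w x y |x y. x \<in> carrier (M n) \<and> y \<in> carrier (M n)}" by blast
    qed (use X.A.mu_w in blast)
    also have "generate (M n) \<dots> = generate F0 {commutator F0 a b |a b. a \<in> \<Delta> n F0 \<and> b \<in> \<Delta> n F0}"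
      unfolding gens
    proof (rule \<epsilon>.G.generate_consistent[OF _ delta_subgroup])
      show "{commutator F0 a b |a b. a \<in> \<Delta> n F0 \<and> b \<in> \<Delta> n F0} \<subseteq> \<Delta> n F0"
        by (auto simp: commutator_def)
    qed
    finally show ?thesis by (simp add: derived_series_Suc(2) derived_commutators)
  qed
  \<comment> \<open>The inverse of the isomorphism that \<mu> has just been shown to be, from the
    exterior square of \<open>M n\<close> to \<open>\<Delta> (Suc n) F0\<close>.\<close>
  define l where "l = inv_into (carrier X.A.P) X.A.\<mu>"
  have l: "l a \<in> carrier X.A.P" "X.A.\<mu> (l a) = a" if "a \<in> \<Delta> (Suc n) F0" for a
    using that inv_into_into[of a X.A.\<mu> "carrier X.A.P"] f_inv_into_f[of a X.A.\<mu> "carrier X.A.P"]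
    unfolding img l_def by auto
  have l_mu: "l (X.A.\<mu> c) = c" if "c \<in> carrier X.A.P" for c
    unfolding l_def by (rule inv_into_f_f[OF inj that])
  define p' where "p' a = X.emap (l a)" for a
  interpret em: group_hom X.A.P X.K.P X.emap by (rule X.emap_hom)
  have p'_mu: "p' (X.A.\<mu> c) = X.emap c" if "c \<in> carrier X.A.P" for c
    using that by (simp add: p'_def l_mu)
  interpret M': group "M (Suc n)" by (rule \<epsilon>.G.subgroup_imp_group[OF delta_subgroup])
  have hom: "group_hom (M (Suc n)) (E (Suc n)) p'"
  proof (unfold E_Suc, intro group_homI M'.group_axioms X.K.group_P homI)
    fix a b assume "a \<in> carrier (M (Suc n))" "b \<in> carrier (M (Suc n))"
    then have ab: "a \<in> \<Delta> (Suc n) F0" "b \<in> \<Delta> (Suc n) F0" by auto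
    have "a \<otimes>\<^bsub>F0\<^esub> b = X.A.\<mu> (l a \<otimes>\<^bsub>X.A.P\<^esub> l b)" using l[OF ab(1)] l[OF ab(2)] by simp
    then show "p' (a \<otimes>\<^bsub>M (Suc n)\<^esub> b) = p' a \<otimes>\<^bsub>X.K.P\<^esub> p' b"
      using l[OF ab(1)] l[OF ab(2)] p'_mu[of "l a \<otimes>\<^bsub>X.A.P\<^esub> l b"] by (simp add: p'_def)
  qed (simp add: p'_def l)
  interpret p': group_hom "M (Suc n)" "E (Suc n)" p' by (rule hom)
  have p'_comm: "p' (commutator F0 a b) = X.K.w (p a) (p b)"
    if "a \<in> \<Delta> n F0" "b \<in> \<Delta> n F0" for a b
    using that p'_mu[of "X.A.w a b"] by (simp add: X.A.mu_w X.emap_w comm_M)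
  have m_hom: "group_hom (E (Suc n)) G (m (Suc n))"
    using group_hom.hom_comp[OF X.K.mu_hom mn.group_hom_axioms]
    unfolding E_Suc m_Suc[abs_def] .
  have surj: "p' ` \<Delta> (Suc n) F0 = carrier (E (Suc n))"
  proof -
    have "X.emap ` carrier X.A.P
        = generate X.K.P (X.emap ` {X.A.w x y |x y. x \<in> carrier (M n) \<and> y \<in> carrier (M n)})"
      unfolding X.A.generate_w by (rule em.generate_img[symmetric]) auto
    also have "X.emap ` {X.A.w x y |x y. x \<in> carrier (M n) \<and> y \<in> carrier (M n)}
        = {X.K.w x y |x y. x \<in> carrier (E n) \<and> y \<in> carrier (E n)}"
    proof (intro equalityI subsetI)
      fix z assume "z \<in> {X.K.w x y |x y. x \<in> carrier (E n) \<and> y \<in> carrier (E n)}"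
      then obtain x y where z: "z = X.K.w x y" "x \<in> carrier (E n)" "y \<in> carrier (E n)" by blast
      obtain a b where ab: "x = p a" "y = p b" "a \<in> \<Delta> n F0" "b \<in> \<Delta> n F0"
        using z(2,3) p_surj by (metis imageE)
      then have "z = X.emap (X.A.w a b)" using z by (simp add: X.emap_w)
      then show "z \<in> X.emap ` {X.A.w x y |x y. x \<in> carrier (M n) \<and> y \<in> carrier (M n)}"
        using ab by auto
    next
      fix z assume "z \<in> X.emap ` {X.A.w x y |x y. x \<in> carrier (M n) \<and> y \<in> carrier (M n)}"
      then obtain x y where z: "z = X.emap (X.A.w x y)" "x \<in> carrier (M n)" "y \<in> carrier (M n)" by blast
      then have "z = X.K.w (p x) (p y)" "p x \<in> carrier (E n)" "p y \<in> carrier (E n)"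
        by (simp_all only: X.emap_w p.hom_closed)
      then show "z \<in> {X.K.w x y |x y. x \<in> carrier (E n) \<and> y \<in> carrier (E n)}" by blast
    qed
    also have "generate X.K.P \<dots> = carrier X.K.P" by (rule X.K.generate_w[symmetric])
    finally have "X.emap ` carrier X.A.P = carrier (E (Suc n))" by (simp only: E_Suc)
    moreover have "p' ` \<Delta> (Suc n) F0 = X.emap ` carrier X.A.P"
      unfolding img[symmetric] image_image by (rule image_cong[OF HOL.refl p'_mu])
    ultimately show ?thesis by simp
  qed
  have m_p': "m (Suc n) (p' a) = \<epsilon> a" if a: "a \<in> \<Delta> (Suc n) F0" for a
  proof -
    have "X.K.\<mu> (p' a) = p a" using l[OF a] by (simp add: p'_def X.mu_emap)
    moreover have "a \<in> \<Delta> n F0" using X.A.\<mu>.hom_closed[OF l(1)[OF a]] l(2)[OF a] by simp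
    ultimately show ?thesis by (simp add: m_Suc m_p)
  qed
  \<comment> \<open>On a commutator [u,v] this is the induction hypothesis for u and v separately,
    so neither face has to be trivial.\<close>
  have p'_d: "p' (d0 x) = p' (d1 x)" if x: "x \<in> \<Delta> (Suc n) F1" for x
  proof -
    have gen: "p' (d0 (commutator F1 u v)) = p' (d1 (commutator F1 u v)) \<and> commutator F1 u v \<in> \<Delta> (Suc n) F1"
      if uv: "u \<in> \<Delta> n F1" "v \<in> \<Delta> n F1" for u v
    proof -
      have c: "u \<in> carrier F1" "v \<in> carrier F1" using uv delta_subset by blast+
      show ?thesis
        using uv c p_d d_delta
        by (simp add: d0.hom_commutator d1.hom_commutator p'_comm derived_series_Suc(2)
            d0.G.commutator_mem_derived)
    qed
    interpret D1: subgroup "\<Delta> (Suc n) F1" F1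
      by (rule normal_imp_subgroup[OF d0.G.derived_series_normal])
    have "x \<in> generate F1 {commutator F1 u v |u v. u \<in> \<Delta> n F1 \<and> v \<in> \<Delta> n F1}"
      using x by (simp add: derived_series_Suc(2) derived_commutators)
    then have "x \<in> \<Delta> (Suc n) F1 \<and> p' (d0 x) = p' (d1 x)"
    proof induct
      case one
      then show ?case by simp
    next
      case (incl h)
      then show ?case using gen by blast
    next
      case (inv h)
      then have h: "h \<in> \<Delta> (Suc n) F1" "p' (d0 h) = p' (d1 h)" using gen by blast+
      have inv: "p' (inv\<^bsub>F0\<^esub> a) = inv\<^bsub>E (Suc n)\<^esub> (p' a)" if "a \<in> \<Delta> (Suc n) F0" for a
        using p'.hom_inv[of a] that \<epsilon>.G.m_inv_consistent[OF delta_subgroup that] by simp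
      show ?case using h inv[OF d_delta(1)[OF h(1)]] inv[OF d_delta(2)[OF h(1)]] D1.mem_carrier[OF h(1)] by simp
    next
      case (eng x y)
      then have xy: "x \<in> \<Delta> (Suc n) F1" "y \<in> \<Delta> (Suc n) F1"
        "p' (d0 x) = p' (d1 x)" "p' (d0 y) = p' (d1 y)" by auto
      have mult: "p' (a \<otimes>\<^bsub>F0\<^esub> b) = p' a \<otimes>\<^bsub>E (Suc n)\<^esub> p' b"
        if "a \<in> \<Delta> (Suc n) F0" "b \<in> \<Delta> (Suc n) F0" for a b
        using p'.hom_mult[of a b] that by simp
      show ?case
        using xy D1.mem_carrier[OF xy(1)] D1.mem_carrier[OF xy(2)]
          mult[OF d_delta(1)[OF xy(1)] d_delta(1)[OF xy(2)]] mult[OF d_delta(2)[OF xy(1)] d_delta(2)[OF xy(2)]]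
        by simp
    qed
    then show ?thesis by simp
  qed
  have p'_ker: "a \<in> B (\<Delta> (Suc n))" if a: "a \<in> \<Delta> (Suc n) F0" "p' a = \<one>\<^bsub>E (Suc n)\<^esub>" for a
  proof -
    interpret N: normal "B (\<Delta> (Suc n))" F0 by (rule B_normal[OF functorial_derived_series])
    define Q where "Q = F0 Mod B (\<Delta> (Suc n))"
    define q where "q a = B (\<Delta> (Suc n)) #>\<^bsub>F0\<^esub> a" for a
    interpret q: group_hom F0 Q q using N.quotient_hom by (simp add: Q_def q_def[abs_def])
    have q_one: "q a = \<one>\<^bsub>Q\<^esub> \<longleftrightarrow> a \<in> B (\<Delta> (Suc n))" if "a \<in> carrier F0" for a
      using N.coset_eq_self_iff[OF that] by (simp add: Q_def q_def)
    \<comment> \<open>Two lifts of the same element differ by ker \<open>p\<close>, which lies in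
      \<open>B (\<Delta> n)\<close> by induction; commutators of such differences with
      \<open>\<Delta> n F0\<close> vanish in \<open>Q\<close>.\<close>
    have well: "q (commutator F0 a b) = q (commutator F0 a' b')"
      if ab: "a \<in> \<Delta> n F0" "a' \<in> \<Delta> n F0" "b \<in> \<Delta> n F0" "b' \<in> \<Delta> n F0" "p a = p a'" "p b = p b'" for a a' b b'
    proof -
      have pinv: "p (inv\<^bsub>F0\<^esub> c) = inv\<^bsub>E n\<^esub> (p c)" if "c \<in> \<Delta> n F0" for c
        using p.hom_inv[of c] that \<epsilon>.G.m_inv_consistent[OF delta_subgroup that] by simp
      have pmult: "p (c \<otimes>\<^bsub>F0\<^esub> d) = p c \<otimes>\<^bsub>E n\<^esub> p d" if "c \<in> \<Delta> n F0" "d \<in> \<Delta> n F0" for c d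
        using p.hom_mult[of c d] that by simp
      have pc: "p c \<in> carrier (E n)" if "c \<in> \<Delta> n F0" for c using p.hom_closed[of c] that by simp
      define z where "z = a \<otimes>\<^bsub>F0\<^esub> inv\<^bsub>F0\<^esub> a'"
      define r where "r = inv\<^bsub>F0\<^esub> b' \<otimes>\<^bsub>F0\<^esub> b"
      have cc: "a \<in> carrier F0" "a' \<in> carrier F0" "b \<in> carrier F0" "b' \<in> carrier F0" using ab by auto
      have z: "z \<in> \<Delta> n F0" "a = z \<otimes>\<^bsub>F0\<^esub> a'" using ab cc by (simp_all add: z_def \<epsilon>.G.m_assoc)
      have r: "r \<in> \<Delta> n F0" "b = b' \<otimes>\<^bsub>F0\<^esub> r" using ab cc by (simp_all add: r_def)
      have "p z = \<one>\<^bsub>E n\<^esub>" "p r = \<one>\<^bsub>E n\<^esub>" using ab by (simp_all add: z_def r_def pmult pinv pc)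
      then have zB: "z \<in> B (\<Delta> n)" and rB: "r \<in> B (\<Delta> n)" using p_ker z r by auto
      have zc: "z \<in> carrier F0" "r \<in> carrier F0" using z r by auto
      have 1: "commutator Q (q z) (q c) = \<one>\<^bsub>Q\<^esub>" "commutator Q (q c) (q r) = \<one>\<^bsub>Q\<^esub>"
        if c: "c \<in> \<Delta> n F0" for c
        using B_delta_commutator(1)[OF zB c] B_delta_commutator(2)[OF rB c] zc D.mem_carrier[OF c]
        by (simp_all add: q_one flip: q.hom_commutator)
      have "q (commutator F0 a b) = commutator Q (q z \<otimes>\<^bsub>Q\<^esub> q a') (q b)"
        using zc cc z(2) by (simp add: q.hom_commutator)
      also have "\<dots> = commutator Q (q a') (q b)"
        using 1 ab zc cc by (intro q.H.commutator_central_left) auto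
      also have "\<dots> = commutator Q (q a') (q b' \<otimes>\<^bsub>Q\<^esub> q r)"
        using zc cc r(2) by simp
      also have "\<dots> = commutator Q (q a') (q b')"
        using 1 ab zc cc by (intro q.H.commutator_right) auto
      also have "\<dots> = q (commutator F0 a' b')" using cc by (simp add: q.hom_commutator)
      finally show ?thesis .
    qed
    define \<phi> where "\<phi> x y = q (commutator F0 (inv_into (\<Delta> n F0) p x) (inv_into (\<Delta> n F0) p y))" for x y
    have li: "inv_into (\<Delta> n F0) p x \<in> \<Delta> n F0" "p (inv_into (\<Delta> n F0) p x) = x" if "x \<in> carrier (E n)" for x
      using that inv_into_into[of x p "\<Delta> n F0"] f_inv_into_f[of x p "\<Delta> n F0"] unfolding p_surj by auto
    have phi: "\<phi> (p a) (p b) = q (commutator F0 a b)" if ab: "a \<in> \<Delta> n F0" "b \<in> \<Delta> n F0" for a b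
    proof -
      have "p a \<in> carrier (E n)" "p b \<in> carrier (E n)" using ab p_surj by blast+
      then show ?thesis unfolding \<phi>_def using li ab by (intro well) auto
    qed
    have lift: "\<exists>a\<in>\<Delta> n F0. x = p a" if "x \<in> carrier (E n)" for x
      using that p_surj by blast
    have p_conj: "conjugate (E n) (p a) (p b) = p (conjugate F0 a b)"
      and p_mult: "p a \<otimes>\<^bsub>E n\<^esub> p b = p (a \<otimes>\<^bsub>F0\<^esub> b)"
      and conj_D: "conjugate F0 a b \<in> \<Delta> n F0"
      if ab: "a \<in> \<Delta> n F0" "b \<in> \<Delta> n F0" for a b
      using ab p.hom_conjugate[of a b] p.hom_mult[of a b] conj_M[OF ab] by (simp_all add: conjugate_def)
    have closed: "\<phi> x y \<in> carrier Q" if "x \<in> carrier (E n)" "y \<in> carrier (E n)" for x y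
      using li[OF that(1)] li[OF that(2)] unfolding \<phi>_def by auto
    have 1: "\<phi> (x \<otimes>\<^bsub>E n\<^esub> x') y = \<phi> (conjugate (E n) x x') (conjugate (E n) x y) \<otimes>\<^bsub>Q\<^esub> \<phi> x y"
      if x: "x \<in> carrier (E n)" "x' \<in> carrier (E n)" "y \<in> carrier (E n)" for x x' y
    proof -
      obtain a a' b where ab: "a \<in> \<Delta> n F0" "a' \<in> \<Delta> n F0" "b \<in> \<Delta> n F0" "x = p a" "x' = p a'" "y = p b"
        using lift x by metis
      have "\<phi> (x \<otimes>\<^bsub>E n\<^esub> x') y = q (commutator F0 (a \<otimes>\<^bsub>F0\<^esub> a') b)"
        "\<phi> (conjugate (E n) x x') (conjugate (E n) x y)
          = q (commutator F0 (conjugate F0 a a') (conjugate F0 a b))"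
        "\<phi> x y = q (commutator F0 a b)"
        using ab by (simp_all add: p_conj p_mult phi conj_D)
      then show ?thesis using ab by (simp add: \<epsilon>.G.commutator_mult_left)
    qed
    have 2: "\<phi> x (y \<otimes>\<^bsub>E n\<^esub> y') = \<phi> x y \<otimes>\<^bsub>Q\<^esub> \<phi> (conjugate (E n) y x) (conjugate (E n) y y')"
      if x: "x \<in> carrier (E n)" "y \<in> carrier (E n)" "y' \<in> carrier (E n)" for x y y'
    proof -
      obtain a b b' where ab: "a \<in> \<Delta> n F0" "b \<in> \<Delta> n F0" "b' \<in> \<Delta> n F0" "x = p a" "y = p b" "y' = p b'"
        using lift x by metis
      have "\<phi> x (y \<otimes>\<^bsub>E n\<^esub> y') = q (commutator F0 a (b \<otimes>\<^bsub>F0\<^esub> b'))"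
        "\<phi> (conjugate (E n) y x) (conjugate (E n) y y')
          = q (commutator F0 (conjugate F0 b a) (conjugate F0 b b'))"
        "\<phi> x y = q (commutator F0 a b)"
        using ab by (simp_all add: p_conj p_mult phi conj_D)
      then show ?thesis using ab by (simp add: \<epsilon>.G.commutator_mult_right)
    qed
    have 3: "\<phi> x x = \<one>\<^bsub>Q\<^esub>" if x: "x \<in> carrier (E n)" for x
    proof -
      obtain a where a: "a \<in> \<Delta> n F0" "x = p a" using lift[OF x] by blast
      then have "commutator F0 a a = \<one>\<^bsub>F0\<^esub>" using D.mem_carrier[OF a(1)] by (simp add: \<epsilon>.G.word_simps)
      then show ?thesis using a by (simp add: phi)
    qed
    let ?\<Phi> = "hom_extend Q (\<lambda>s. \<phi> (left s) (right s))"
    have Phi: "group_hom X.K.P Q ?\<Phi>"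
      by (rule X.K.exterior_hom[OF q.H.group_axioms closed 1 2 3])
    have Phi_w: "?\<Phi> (X.K.w x y) = \<phi> x y" if "x \<in> carrier (E n)" "y \<in> carrier (E n)" for x y
      by (rule X.K.exterior_hom_w[OF q.H.group_axioms closed 1 2 3 that])
    \<comment> \<open>On \<open>\<Delta> (Suc n) F0\<close> the composite of \<open>p'\<close> and
      \<open>?\<Phi>\<close> is the projection \<open>q\<close>; this is tested on generators of the
      exterior square of \<open>M n\<close>.\<close>
    have "?\<Phi> (X.emap (l a)) = q (X.A.\<mu> (l a))"
    proof (rule X.A.hom_eq_w[OF group_hom.hom_comp[OF X.emap_hom Phi]
          group_hom.hom_comp[OF X.A.mu_hom] _ l(1)[OF a(1)]])
      show "group_hom (M n) Q q" by (rule q.restrict_hom[OF delta_subgroup])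
      fix x y assume "x \<in> carrier (M n)" "y \<in> carrier (M n)"
      then have xy: "x \<in> \<Delta> n F0" "y \<in> \<Delta> n F0" by auto
      then have "p x \<in> carrier (E n)" "p y \<in> carrier (E n)" using p_surj by blast+
      then show "?\<Phi> (X.emap (X.A.w x y)) = q (X.A.\<mu> (X.A.w x y))"
        using xy by (simp add: X.emap_w X.A.mu_w comm_M Phi_w phi)
    qed
    then have "q a = ?\<Phi> (p' a)" using l(2)[OF a(1)] by (simp add: p'_def)
    also have "\<dots> = \<one>\<^bsub>Q\<^esub>" unfolding a(2) E_Suc by (rule group_hom.hom_one[OF Phi])
    finally show ?thesis using a(1) delta_subset q_one by blast
  qed
  have "is_proj (Suc n) p'"
    unfolding is_proj_def using hom m_hom surj m_p' p'_d p'_ker by blast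
  then show ?thesis by blast
qed

lemma proj_exists: "\<exists>p. is_proj n p"
  by (induction n) (use proj_0 proj_Suc in blast)+

end

text \<open>\<open>W\<close> maps onto the kernel of \<open>m k\<close> through \<open>p\<close>
  after \<open>d1\<close>, and onto the derived functor through \<zeta>. Both maps have as kernel
  the elements whose \<open>d1\<close> lies in \<open>B\<close>, so their targets are
  isomorphic.\<close>

lemma exterior_kernel_iso:
  fixes G :: "'a uni monoid"
  assumes "group G"
  shows "kernel_group (exterior_power G (Suc k)) G (exterior_mu_iter G (Suc k))
    \<cong> left_derived 1 (quotient_functor (\<lambda>K. derived_series K (Suc k))) G"
proof -
  let ?S = "\<lambda>K :: 'a uni monoid. derived_series K (Suc k)"
  interpret resolved_functor ?S G
    by (intro resolved_functor.intro functorial_derived_series resolved_functor_axioms.intro assms)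
  interpret exterior_resolution G F0 F1 F2
    "counit G" "counit F0" "free_map G (counit G)"
    "counit F1" "free_map F0 (counit F0)" "free_map F0 (free_map G (counit G))"
    "comult G" "comult F0" "free_map F1 (comult G)"
    by (intro exterior_resolution.intro exterior_resolution_axioms.intro truncated_resolution_axioms
        free_subgroup.injective free_subgroup.intro)
  obtain p where p: "is_proj k p" using proj_exists by blast
  interpret p: group_hom "M k" "E k" p using p by (simp add: is_proj_def)
  interpret mk: group_hom "E k" G "m k" using p by (simp add: is_proj_def)
  have p_surj: "p ` \<Delta> k F0 = carrier (E k)" and m_p: "\<And>a. a \<in> \<Delta> k F0 \<Longrightarrow> m k (p a) = counit G a"
    and p_d: "\<And>x. x \<in> \<Delta> k F1 \<Longrightarrow> p (counit F0 x) = p (free_map G (counit G) x)"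
    and p_ker: "\<And>a. a \<in> \<Delta> k F0 \<Longrightarrow> p a = \<one>\<^bsub>E k\<^esub> \<Longrightarrow> a \<in> B ?S"
    using p by (simp_all add: is_proj_def)
  define L where "L = left_derived 1 (quotient_functor ?S) G"
  obtain \<zeta> where \<zeta>: "group_hom (F1\<lparr>carrier := W\<rparr>) L \<zeta>" "\<zeta> ` W = carrier L"
    "\<And>x. x \<in> W \<Longrightarrow> \<zeta> x = \<one>\<^bsub>L\<^esub> \<longleftrightarrow> free_map G (counit G) x \<in> B ?S"
    using derived_epi unfolding L_def left_derived_eq by blast
  let ?A = "kernel_group (E k) G (m k)" and ?M = "F1\<lparr>carrier := W\<rparr>"
  let ?r = "\<lambda>w. p (free_map G (counit G) w)"
  interpret z: group_hom ?M L \<zeta> by (rule \<zeta>(1))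
  have W: "w \<in> carrier F1" "free_map G (counit G) w \<in> \<Delta> k F0"
    "counit G (free_map G (counit G) w) = \<one>\<^bsub>G\<^esub>" if "w \<in> W" for w
    using that d1_W by (auto simp: W_def)
  have incl: "group_hom ?A (E k) (\<lambda>x. x)"
    unfolding kernel_group_def
    by (rule group_hom.restrict_hom[OF id_group_hom[OF p.H.group_axioms] mk.subgroup_kernel])
  have r: "group_hom ?M (E k) ?r"
  proof (intro group_homI z.G.group_axioms p.H.group_axioms homI)
    fix v w assume "v \<in> carrier ?M" "w \<in> carrier ?M"
    then have vw: "v \<in> W" "w \<in> W" by auto
    show "?r (v \<otimes>\<^bsub>?M\<^esub> w) = ?r v \<otimes>\<^bsub>E k\<^esub> ?r w"
      using W[OF vw(1)] W[OF vw(2)] p.hom_mult[of "free_map G (counit G) v" "free_map G (counit G) w"] by simp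
  next
    fix w assume "w \<in> carrier ?M"
    then have "free_map G (counit G) w \<in> \<Delta> k F0" using W(2) by simp
    then show "?r w \<in> carrier (E k)" using p_surj by blast
  qed
  have img: "(\<lambda>x. x) ` carrier ?A = ?r ` carrier ?M"
  proof (intro equalityI subsetI)
    fix x assume "x \<in> (\<lambda>x. x) ` carrier ?A"
    then have x: "x \<in> carrier (E k)" "m k x = \<one>\<^bsub>G\<^esub>" by (auto simp: kernel_group_def kernel_def)
    obtain a where a: "a \<in> \<Delta> k F0" "x = p a" using x(1) p_surj by blast
    then have "a \<in> free_map G (counit G) ` W" unfolding d1_W using x(2) m_p by simp
    then show "x \<in> ?r ` carrier ?M" using a by auto
  next
    fix x assume "x \<in> ?r ` carrier ?M"
    then obtain w where w: "x = ?r w" "w \<in> W" by auto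
    then have "m k x = \<one>\<^bsub>G\<^esub>" "x \<in> carrier (E k)" using W[OF w(2)] m_p p_surj by auto
    then show "x \<in> (\<lambda>x. x) ` carrier ?A" by (simp add: kernel_group_def kernel_def)
  qed
  have ker: "\<zeta> w = \<one>\<^bsub>L\<^esub>" if "w \<in> carrier ?M" "?r w = \<one>\<^bsub>E k\<^esub>" for w
    using that \<zeta>(3)[of w] W(2)[of w] p_ker by simp
  \<comment> \<open>The equaliser clause of \<open>is_proj\<close>, applied to an element with
    trivial \<open>d0\<close>, shows that \<open>p\<close> kills \<open>B\<close>.\<close>
  have ker': "?r w = \<one>\<^bsub>E k\<^esub>" if w: "w \<in> W" "\<zeta> w = \<one>\<^bsub>L\<^esub>" for w
  proof -
    obtain x where x: "x \<in> \<Delta> k F1" "counit F0 x = \<one>\<^bsub>F0\<^esub>" "free_map G (counit G) w = free_map G (counit G) x"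
      using \<zeta>(3)[OF w(1)] w(2) by (auto simp: B_def)
    then show ?thesis using p_d[OF x(1)] p.hom_one by simp
  qed
  have surj: "\<zeta> ` carrier ?M = carrier L" using \<zeta>(2) by simp
  show ?thesis
  proof (rule epi_through[OF incl r \<zeta>(1) img surj ker])
    fix \<phi> assume \<phi>: "\<phi> \<in> epi ?A L"
      and val: "\<And>x w. x \<in> carrier ?A \<Longrightarrow> w \<in> carrier ?M \<Longrightarrow> ?r w = x \<Longrightarrow> \<phi> x = \<zeta> w"
    interpret A: group ?A using incl by (rule group_hom.axioms)
    have h: "group_hom ?A L \<phi>"
      using \<phi> by (intro group_homI A.group_axioms z.H.group_axioms) (simp add: epi_def)
    have "kernel ?A L \<phi> = {\<one>\<^bsub>?A\<^esub>}"
    proof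
      show "kernel ?A L \<phi> \<subseteq> {\<one>\<^bsub>?A\<^esub>}"
      proof
        fix x assume "x \<in> kernel ?A L \<phi>"
        then have x: "x \<in> carrier ?A" "\<phi> x = \<one>\<^bsub>L\<^esub>" by (auto simp: kernel_def)
        obtain w where w: "w \<in> carrier ?M" "x = ?r w" using x(1) img by auto
        then have "\<zeta> w = \<one>\<^bsub>L\<^esub>" using val[OF x(1) w(1)] x(2) by simp
        then show "x \<in> {\<one>\<^bsub>?A\<^esub>}" using ker' w by (simp add: kernel_group_def)
      qed
      show "{\<one>\<^bsub>?A\<^esub>} \<subseteq> kernel ?A L \<phi>"
        using group_hom.hom_one[OF h] by (simp add: kernel_def)
    qed
    then have "inj_on \<phi> (carrier ?A)" by (rule group_hom.trivial_ker_imp_inj[OF h])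
    then have "\<phi> \<in> iso ?A L" using \<phi> by (simp add: iso_iff_mon_epi mon_def epi_def)
    then show ?thesis unfolding L_def by (rule is_isoI)
  qed
qed

theorem proposition4p2:
  fixes G :: "('a, 'b) monoid_scheme" and k :: nat
  assumes "group G" and "k \<ge> 1"
  shows "(\<exists>\<phi>. \<phi> \<in> epi (kernel_group (tensor_power (embed_group G) (k + 1)) (embed_group G)
                          (tensor_lambda (embed_group G) (k + 1)))
                     (left_derived 1 (nilpotent_quotient k) (embed_group G)))
       \<and> kernel_group (exterior_power (embed_group G) (k + 1)) (embed_group G)
                      (exterior_mu_iter (embed_group G) (k + 1))
          \<cong> left_derived 1 (solvable_quotient k) (embed_group G)"
  using tensor_kernel_epi[OF embed_group_group[OF assms(1)], of k]
    exterior_kernel_iso[OF embed_group_group[OF assms(1)], of k]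
  by (simp add: nilpotent_quotient_def solvable_quotient_def)

end
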